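(* Let $\sigma>0$ and $c\in\mathbb{R}$. Writing $\mathbf{W}=W_\alpha$, the equation $$i\sigma\,\partial_\alpha\!\left(\frac{1+\mathbf{W}}{|1+\mathbf{W}|}\right)=c^2\left[\mathbf{W}+\frac{\bar{\mathbf{W}}}{1+\bar{\mathbf{W}}}\right]\qquad\text{on }\mathbb{R}$$ has no nontrivial holomorphic solutions $W$ with regularity $$W_\alpha\in\dot B^{1/2}_{2,1}(\mathbb{R}),\qquad |1+W_\alpha|\ge\delta>0\ \text{ for some constant }\delta .$$ That is, every holomorphic solution $W$ with this regularity satisfies $W_\alpha\equiv 0$.
   Context: $W=W(\alpha)$ is a complex valued function on $\mathbb{R}$, $W_\alpha=\partial_\alpha W$; the equation is understood in the sense of distributions. Besov space. Let $1=\sum_{k\in\mathbb{Z}}P_k$ be a standard dyadic Littlewood-Paley decomposition on $\mathbb{R}$, where $P_k$ selects frequencies $\approx 2^k$. Then $\|u\|_{\dot B^{1/2}_{2,1}}=\sum_{k\in\mathbb{Z}}2^{k/2}\|P_ku\|_{L^2}$. Elements of $\dot B^{1/2}_{2,1}$ are realized as functions $u=\sum_k P_ku$ (uniformly convergent series), so that they are bounded and continuous and vanish at infinity. "Holomorphic" means that $W$ admits a Lipschitz extension to the closed lower half plane which is holomorphic in $\mathbb{H}=\{\alpha-i\beta:\beta>0\}$; at the level of $W_\alpha$ this says that the Fourier transform of $W_\alpha$ is supported in $(-\infty,0]$. Moreover $Z=\alpha+W$ is (the boundary value of) a conformal map on $\mathbb{H}$; of this, only the fact that the holomorphic extension of $1+W_\alpha$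 has no zeros in $\mathbb{H}$ is assumed. No assumption that the curve $Z(\mathbb{R})$ is a graph is made. Trivial solutions are the constant ones, $W_\alpha\equiv0$. *)

theory Defs
  imports "HOL-Complex_Analysis.Complex_Analysis"
begin

definition smooth :: "(real \<Rightarrow> real) \<Rightarrow> bool" where
  "smooth f \<longleftrightarrow> (\<forall>n x. (deriv ^^ n) f field_differentiable (at x))"

subsection \<open>Distributions on the line\<close>

text \<open>Real-valued test functions suffice, since the distributions below are extended
  to complex-valued ones by linearity.\<close>

definition test_function :: "(real \<Rightarrow> real) \<Rightarrow> bool" where
  "test_function \<theta> \<longleftrightarrow> smooth \<theta> \<and> compact (closure {x. \<theta> x \<noteq> 0})"

definition dist_of :: "(real \<Rightarrow> complex) \<Rightarrow> (real \<Rightarrow> real) \<Rightarrow> complex" where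
  "dist_of f \<theta> = (LINT x|lborel. f x * of_real (\<theta> x))"

definition dist_deriv :: "((real \<Rightarrow> real) \<Rightarrow> complex) \<Rightarrow> (real \<Rightarrow> real) \<Rightarrow> complex" where
  "dist_deriv T \<theta> = - T (deriv \<theta>)"

subsection \<open>The homogeneous Besov space with indices 1/2, 2, 1\<close>

text \<open>The symbol of \<open>P\<^sub>k\<close> is \<open>\<phi> (\<xi> / 2\<^sup>k)\<close>, where \<open>\<phi>\<close> is supported in an arbitrary
  annulus away from the origin.\<close>

definition littlewood_paley :: "(real \<Rightarrow> real) \<Rightarrow> bool" where
  "littlewood_paley \<phi> \<longleftrightarrow>
     smooth \<phi> \<and>
     (\<exists>a>0. \<exists>b. \<forall>\<xi>. \<phi> \<xi> \<noteq> 0 \<longrightarrow> a \<le> \<bar>\<xi>\<bar> \<and> \<bar>\<xi>\<bar> \<le> b) \<and>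
     (\<forall>\<xi>. \<xi> \<noteq> 0 \<longrightarrow> ((\<lambda>k::int. \<phi> (\<xi> / 2 powi k)) has_sum 1) UNIV)"

definition LP_kernel :: "(real \<Rightarrow> real) \<Rightarrow> int \<Rightarrow> real \<Rightarrow> complex" where
  "LP_kernel \<phi> k x =
     (LINT \<xi>|lborel. of_real (\<phi> (\<xi> / 2 powi k)) * exp (\<i> * of_real (\<xi> * x))) / (2 * of_real pi)"

definition LP_proj :: "(real \<Rightarrow> real) \<Rightarrow> int \<Rightarrow> (real \<Rightarrow> complex) \<Rightarrow> real \<Rightarrow> complex" where
  "LP_proj \<phi> k u x = (LINT y|lborel. LP_kernel \<phi> k (x - y) * u y)"

definition in_L2 :: "(real \<Rightarrow> complex) \<Rightarrow> bool" where
  "in_L2 f \<longleftrightarrow> f \<in> borel_measurable lborel \<and> integrable lborel (\<lambda>x. (norm (f x))\<^sup>2)"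

definition L2_normf :: "(real \<Rightarrow> complex) \<Rightarrow> real" where
  "L2_normf f = sqrt (LINT x|lborel. (norm (f x))\<^sup>2)"

text \<open>The function \<open>u\<close> is the realization of an element of the space as the uniformly
  convergent series of its dyadic pieces. Continuity and boundedness hold automatically
  for a realization; they are listed so that the convolutions defining \<open>P\<^sub>k u\<close> converge.\<close>

definition besov_half_2_1 :: "(real \<Rightarrow> real) \<Rightarrow> (real \<Rightarrow> complex) \<Rightarrow> bool" where
  "besov_half_2_1 \<phi> u \<longleftrightarrow>
     continuous_on UNIV u \<and> bounded (range u) \<and>
     (\<forall>k. in_L2 (LP_proj \<phi> k u)) \<and>
     (\<lambda>k::int. 2 powr (of_int k / 2) * L2_normf (LP_proj \<phi> k u)) summable_on UNIV \<and>
     uniform_limit UNIV (\<lambda>K x. \<Sum>k\<in>K. LP_proj \<phi> k u x) u (finite_subsets_at_top UNIV)"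

subsection \<open>Holomorphic extension to the lower half plane\<close>

text \<open>Such an extension is unique, by Schwarz reflection. The holomorphic extension of
  the derivative of \<open>W\<close> is \<open>deriv E\<close>.\<close>

definition lower_extension :: "(real \<Rightarrow> complex) \<Rightarrow> (complex \<Rightarrow> complex) \<Rightarrow> bool" where
  "lower_extension W E \<longleftrightarrow>
     (\<exists>L. L-lipschitz_on {z. Im z \<le> 0} E) \<and>
     E holomorphic_on {z. Im z < 0} \<and>
     (\<forall>x. E (of_real x) = W x)"

end

theory Submission
  imports Defs "HOL-Probability.Sinc_Integral"
begin

text \<open>
  Let \<open>F = log (1 + W\<^sub>\<alpha>)\<close>, extended holomorphically to the lower half plane, and let
  \<open>F = A + i\<theta>\<close>. Since \<open>(1 + W\<^sub>\<alpha>) / \<bar>1 + W\<^sub>\<alpha>\<bar> = e\<^sup>i\<^sup>\<theta>\<close> and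
  \<open>W\<^sub>\<alpha> + cnj W\<^sub>\<alpha> / (1 + cnj W\<^sub>\<alpha>) = 2 e\<^sup>i\<^sup>\<theta> sinh A\<close>, the equation says that
  \<open>\<theta>' = - \<kappa> sinh A\<close> on the real line, with \<open>\<kappa> = 2 c\<^sup>2 / \<sigma>\<close>. By the Cauchy-Riemann equations
  this is a nonlinear Neumann condition for the harmonic function \<open>A\<close>.

  The contradiction is a local form of the Pohozaev identity. Let \<open>G\<close> be the primitive of
  \<open>(F')\<^sup>2\<close> that vanishes at \<open>-i\<infinity>\<close>. On the boundary \<open>Im (F')\<^sup>2 = 2 A\<^sub>x \<theta>\<^sub>x = - 2 \<kappa> (cosh A)\<^sub>x\<close>,
  hence \<open>Im G = - 2 \<kappa> (cosh A - 1) \<le> 0\<close> there. A harmonic function on the half plane which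
  vanishes at infinity and whose boundary values are nonpositive and not identically zero is at
  most \<open>- const / \<bar>y\<bar>\<close> on a vertical ray (\<open>Re_boundary_zero\<close> compares with an explicit
  function). On the other hand \<open>F\<close> tends to \<open>0\<close> at infinity, so by Cauchy's estimates
  \<open>F' = o (1 / \<bar>y\<bar>)\<close> and therefore \<open>G = o (1 / \<bar>y\<bar>)\<close> (\<open>squared_deriv_primitive\<close>). Thus
  \<open>A = 0\<close> on the real line, so \<open>\<theta>\<close> is constant, and its value is \<open>0\<close> because \<open>F\<close> vanishes at
  infinity; this is \<open>boundary_zero\<close>. For \<open>c = 0\<close> the argument gives nothing, but then
  \<open>\<theta>' = 0\<close>, so \<open>Im F = 0\<close> on the boundary and \<open>F\<close> is constant.

  The boundary identity for \<open>G\<close> needs some regularity, because \<open>A\<^sub>x\<close> is not known to be bounded near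
  the line. Boundedness of \<open>\<theta>'\<close> gives \<open>F' = O (y\<^bsup>-1/4\<^esup>)\<close> at depth \<open>y\<close>, so that \<open>F\<close> is Hoelder
  continuous, which in turn gives \<open>\<theta>\<^sub>x + \<kappa> sinh A = O (y\<^bsup>1/2\<^esup>)\<close> (\<open>boundary_defect\<close>). The error in
  the identity is the product of the two rates and tends to \<open>0\<close>.

  Two facts connect this with the hypotheses. The dyadic pieces of a function in the Besov
  space are square integrable and Lipschitz, so the function vanishes at infinity. Continuous
  functions related by a weak derivative are related by a classical one, which makes the
  equation pointwise and, with the maximum principle, shows that the derivative of the holomorphic
  extension is continuous up to the boundary with boundary values \<open>W\<^sub>\<alpha>\<close>.
\<close>

section \<open>Maximum principles in the lower half plane\<close>

abbreviation lower :: "complex set" where "lower \<equiv> {z. Im z < 0}"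
abbreviation lower_closed :: "complex set" where "lower_closed \<equiv> {z. Im z \<le> 0}"

lemma open_lower: "open lower"
  by (simp add: open_halfspace_Im_lt)

lemma convex_lower: "convex lower"
  by (simp add: convex_halfspace_Im_lt)

lemma convex_lower_closed: "convex lower_closed"
  by (simp add: convex_halfspace_Im_le)

text \<open>The half disc of large radius has its frontier where the bound is known up to \<open>e\<close>: on the
  line, or far away.\<close>

lemma lower_maximum_real_at_infinity:
  assumes cont: "continuous_on lower_closed f" and hol: "f holomorphic_on lower"
    and bd: "\<And>x. Re (f (of_real x)) \<le> B"
    and inf: "\<And>e. e > 0 \<Longrightarrow> \<exists>R. \<forall>z. Im z \<le> 0 \<and> R \<le> norm z \<longrightarrow> Re (f z) \<le> B + e"
    and z: "Im z \<le> 0"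
  shows "Re (f z) \<le> B"
proof (cases "Im z = 0")
  case True
  then have "z = of_real (Re z)" by (simp add: complex_eq_iff)
  then show ?thesis using bd by metis
next
  case False
  show ?thesis
  proof (rule field_le_epsilon)
    fix e :: real assume "e > 0"
    then obtain R where R: "\<And>z. Im z \<le> 0 \<Longrightarrow> R \<le> norm z \<Longrightarrow> Re (f z) \<le> B + e"
      using inf by blast
    define r where "r = max R (norm z + 1)"
    define S where "S = lower \<inter> ball 0 r"
    have op: "open S" unfolding S_def using open_lower by blast
    have cl: "closure S \<subseteq> lower_closed \<inter> cball 0 r"
      unfolding S_def
      by (rule closure_minimal)
         (auto intro!: closed_Int closed_halfspace_Im_le simp: less_imp_le)
    show "Re (f z) \<le> B + e"
    proof (rule maximum_real_frontier[of f S])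
      show "f holomorphic_on interior S"
        unfolding interior_open[OF op] using hol by (rule holomorphic_on_subset) (auto simp: S_def)
      show "continuous_on (closure S) f"
        using cont cl by (blast intro: continuous_on_subset)
      show "bounded S" unfolding S_def by (metis bounded_ball bounded_subset inf_le2)
      show "z \<in> S" using z False by (simp add: S_def r_def)
    next
      fix y assume "y \<in> frontier S"
      then have y: "y \<in> closure S" "y \<notin> S" using op by (auto simp: frontier_def interior_open)
      then have "Im y \<le> 0" "norm y \<le> r" using cl by auto
      with y(2) have "Im y = 0 \<or> norm y = r" by (auto simp: S_def)
      then show "Re (f y) \<le> B + e"
      proof
        assume "Im y = 0"
        then have "y = of_real (Re y)" by (simp add: complex_eq_iff)
        then have "Re (f y) \<le> B" using bd by metis
        then show ?thesis using \<open>e > 0\<close> by simp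
      next
        assume "norm y = r"
        then show ?thesis using R \<open>Im y \<le> 0\<close> by (auto simp: r_def)
      qed
    qed
  qed
qed

text \<open>The real part of the square root is comparable to its modulus on the right half plane. This
  makes \<open>csqrt (d + i (z - a))\<close> a positive harmonic function in the lower half plane that grows like
  \<open>\<bar>z - a\<bar>\<^bsup>1/2\<^esup>\<close>; the shift by \<open>d > 0\<close> keeps it away from the branch point. It serves as a barrier,
  both at infinity and at a boundary point.\<close>

lemma Re_csqrt_ge:
  assumes "Re w \<ge> 0"
  shows "sqrt (norm w / 2) \<le> Re (csqrt w)"
proof -
  let ?s = "csqrt w"
  have "(Re ?s)\<^sup>2 - (Im ?s)\<^sup>2 = Re w"
    by (metis Re_power2 power2_csqrt)
  moreover have "(Re ?s)\<^sup>2 + (Im ?s)\<^sup>2 = norm w"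
    by (metis cmod_power2 norm_power power2_csqrt)
  ultimately have "norm w / 2 \<le> (Re ?s)\<^sup>2" using assms by simp
  then show ?thesis
    by (metis Re_csqrt real_le_lsqrt real_sqrt_le_iff real_sqrt_pow2_iff real_sqrt_abs abs_of_nonneg)
qed

lemma
  fixes d :: real and a :: real
  assumes "d > 0"
  shows continuous_on_half_plane_barrier:
      "continuous_on lower_closed (\<lambda>z. csqrt (of_real d + \<i> * (z - of_real a)))"
    and holomorphic_on_half_plane_barrier:
      "(\<lambda>z. csqrt (of_real d + \<i> * (z - of_real a))) holomorphic_on lower"
proof -
  have "of_real d + \<i> * (z - of_real a) \<notin> \<real>\<^sub>\<le>\<^sub>0" if "Im z \<le> 0" for z
    using that assms by (auto simp: complex_nonpos_Reals_iff)
  note nonpos = this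
  show "continuous_on lower_closed (\<lambda>z. csqrt (of_real d + \<i> * (z - of_real a)))"
    by (rule continuous_on_compose2[where t = "-\<real>\<^sub>\<le>\<^sub>0", OF continuous_on_csqrt])
       (use nonpos in \<open>auto intro!: continuous_intros\<close>)
  show "(\<lambda>z. csqrt (of_real d + \<i> * (z - of_real a))) holomorphic_on lower"
    by (rule holomorphic_on_csqrt') (use nonpos in \<open>auto intro!: holomorphic_intros simp: less_imp_le\<close>)
qed

text \<open>For a function that is merely bounded above, subtracting a small multiple of the barrier
  produces the decay at infinity required by the previous maximum principle.\<close>

lemma lower_maximum_real:
  assumes cont: "continuous_on lower_closed f" and hol: "f holomorphic_on lower"
    and bd: "\<And>x. Re (f (of_real x)) \<le> B"
    and K: "\<And>z. Im z \<le> 0 \<Longrightarrow> Re (f z) \<le> K"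
    and z: "Im z \<le> 0"
  shows "Re (f z) \<le> B"
proof -
  let ?s = "\<lambda>z. csqrt (of_real 1 + \<i> * (z - of_real 0))"
  have *: "Re (f z) \<le> B + d * Re (?s z)" if "d > 0" for d :: real
  proof -
    have "Re (f z - of_real d * ?s z) \<le> B"
    proof (rule lower_maximum_real_at_infinity[OF _ _ _ _ z])
      show "continuous_on lower_closed (\<lambda>z. f z - of_real d * ?s z)"
        by (intro continuous_on_diff continuous_on_mult continuous_on_const cont
            continuous_on_half_plane_barrier) auto
      show "(\<lambda>z. f z - of_real d * ?s z) holomorphic_on lower"
        by (intro holomorphic_on_diff holomorphic_on_mult holomorphic_on_const hol
            holomorphic_on_half_plane_barrier) auto
      show "Re (f (of_real x) - of_real d * ?s (of_real x)) \<le> B" for x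
        using bd[of x] Re_csqrt[of "of_real 1 + \<i> * (of_real x - of_real 0)"] \<open>d > 0\<close>
        by (simp add: add_increasing2 diff_le_eq)
      show "\<exists>R. \<forall>z. Im z \<le> 0 \<and> R \<le> norm z \<longrightarrow> Re (f z - of_real d * ?s z) \<le> B + e"
        if "e > 0" for e
      proof (intro exI allI impI)
        fix y :: complex
        define T where "T = \<bar>K - B\<bar> / d"
        assume y: "Im y \<le> 0 \<and> 2 * T\<^sup>2 + 1 \<le> norm y"
        have "norm y - 1 \<le> norm (of_real 1 + \<i> * (y - of_real 0))"
          using norm_triangle_ineq2[of "\<i> * y" "-1"] by (simp add: norm_mult add.commute)
        with y have "T\<^sup>2 \<le> norm (of_real 1 + \<i> * (y - of_real 0)) / 2" by simp
        then have "T \<le> sqrt (norm (of_real 1 + \<i> * (y - of_real 0)) / 2)"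
          using real_le_rsqrt by blast
        also have "\<dots> \<le> Re (?s y)" using y by (intro Re_csqrt_ge) auto
        finally have "d * T \<le> d * Re (?s y)" using \<open>d > 0\<close> by simp
        then have "K - B \<le> d * Re (?s y)" using \<open>d > 0\<close> by (simp add: T_def)
        then show "Re (f y - of_real d * ?s y) \<le> B + e"
          using K[of y] y that by simp
      qed
    qed
    then show ?thesis by simp
  qed
  have "((\<lambda>d. B + d * Re (?s z)) \<longlongrightarrow> B + 0 * Re (?s z)) (at_right 0)"
    by (intro tendsto_intros)
  then have "((\<lambda>d. B + d * Re (?s z)) \<longlongrightarrow> B) (at_right 0)" by simp
  then show ?thesis
    by (rule tendsto_lowerbound)
       (use * in \<open>auto simp del: csqrt.simps intro!: eventually_at_rightI[of 0 1]\<close>)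
qed

text \<open>Rotating \<open>f\<close> so that its value at \<open>z\<close> is positive reduces the modulus to a real part.\<close>

lemma lower_maximum_modulus:
  assumes cont: "continuous_on lower_closed f" and hol: "f holomorphic_on lower"
    and bd: "\<And>x. norm (f (of_real x)) \<le> B"
    and K: "\<And>z. Im z \<le> 0 \<Longrightarrow> norm (f z) \<le> K"
    and z: "Im z \<le> 0"
  shows "norm (f z) \<le> B"
proof (cases "f z = 0")
  case True
  then show ?thesis using bd[of 0] norm_ge_zero order_trans by (metis norm_zero)
next
  case False
  define e where "e = cnj (f z) / of_real (norm (f z))"
  have ne: "norm e = 1" using False by (simp add: e_def norm_divide)
  have ez: "e * f z = of_real (norm (f z))"
    using False complex_norm_square[of "f z"] 
    by (simp add: e_def field_simps power2_eq_square)
  have le: "Re (e * w) \<le> norm w" for w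
    using complex_Re_le_cmod[of "e * w"] ne by (simp add: norm_mult)
  have "Re (e * f z) \<le> B"
  proof (rule lower_maximum_real[OF _ _ _ _ z])
    show "Re (e * f (of_real x)) \<le> B" for x using le bd order_trans by blast
    show "Im z \<le> 0 \<Longrightarrow> Re (e * f z) \<le> K" for z using le K order_trans by blast
  qed (use cont hol in \<open>auto intro!: continuous_intros holomorphic_intros\<close>)
  then show ?thesis by (simp add: ez)
qed

text \<open>A bounded holomorphic function inherits decay from its boundary values. The factor
  \<open>z / (z - i N)\<close> has modulus at most \<open>1\<close>, is small on the part of the line where \<open>f\<close> is not yet
  small, and tends to \<open>1\<close> at infinity.\<close>

lemma lower_vanishing_at_infinity:
  assumes cont: "continuous_on lower_closed f" and hol: "f holomorphic_on lower"
    and K: "\<And>z. Im z \<le> 0 \<Longrightarrow> norm (f z) \<le> K"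
    and bd: "((\<lambda>x. f (of_real x)) \<longlongrightarrow> 0) at_infinity"
    and e: "e > 0"
  shows "\<exists>R. \<forall>z. Im z \<le> 0 \<and> R \<le> norm z \<longrightarrow> norm (f z) \<le> e"
proof -
  have "eventually (\<lambda>x. norm (f (of_real x)) < e/2) at_infinity"
    using bd e half_gt_zero tendstoD by (fastforce simp: dist_norm)
  then obtain r where r: "\<And>x. r \<le> norm x \<Longrightarrow> norm (f (of_real x)) < e/2"
    by (auto simp: eventually_at_infinity)
  have K0: "K \<ge> 0" using K[of 0] norm_ge_zero order_trans by (metis order_refl zero_complex.sel(2))
  define r' where "r' = max r 1"
  define N where "N = 2 * (K + 1) * r' / e + 1"
  have N: "N > 0" unfolding N_def r'_def using e K0 by (simp add: add_nonneg_pos)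
  define k where "k z = z / (z - \<i> * of_real N)" for z
  have nz: "z - \<i> * of_real N \<noteq> 0" if "Im z \<le> 0" for z
    using that N by (auto simp: complex_eq_iff)
  have k1: "norm (k z) \<le> 1" if "Im z \<le> 0" for z
  proof -
    have "(Im z)\<^sup>2 \<le> (Im z - N)\<^sup>2" using that N
      unfolding abs_le_square_iff[symmetric] by auto
    then have "norm z \<le> norm (z - \<i> * of_real N)" by (simp add: cmod_def)
    then show ?thesis using nz[OF that] by (simp add: k_def norm_divide divide_le_eq)
  qed
  have fk: "norm (f z * k z) \<le> e / 2" if "Im z \<le> 0" for z
  proof (rule lower_maximum_modulus[OF _ _ _ _ that, where K = K])
    show "continuous_on lower_closed (\<lambda>z. f z * k z)"
      unfolding k_def using cont nz by (auto intro!: continuous_intros)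
    show "(\<lambda>z. f z * k z) holomorphic_on lower"
      unfolding k_def using hol nz by (auto intro!: holomorphic_intros)
    show "norm (f z * k z) \<le> K" if "Im z \<le> 0" for z
      using mult_mono[OF K[OF that] k1[OF that] K0] by (simp add: norm_mult)
    show "norm (f (of_real x) * k (of_real x)) \<le> e / 2" for x
    proof (cases "r \<le> norm x")
      case True
      then show ?thesis
        using mult_mono[OF less_imp_le[OF r[OF True]] k1[of "of_real x"]] e by (simp add: norm_mult)
    next
      case False
      have "N \<le> norm (complex_of_real x - \<i> * of_real N)"
        using abs_Im_le_cmod[of "complex_of_real x - \<i> * of_real N"] N by simp
      then have "norm (k (of_real x)) \<le> r' / N"
        using False N unfolding k_def norm_divide r'_def by (intro frac_le) auto
      then have "norm (f (of_real x) * k (of_real x)) \<le> K * (r' / N)"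
        unfolding norm_mult using K[of "of_real x"] K0 by (intro mult_mono) auto
      also have "\<dots> \<le> e / 2"
      proof -
        have "K * r' * 2 \<le> N * e"
          using e K0 unfolding N_def r'_def by (simp add: field_simps add_nonneg_nonneg)
        then show ?thesis using N by (simp add: field_simps)
      qed
      finally show ?thesis .
    qed
  qed
  show ?thesis
  proof (intro exI allI impI)
    fix z :: complex assume z: "Im z \<le> 0 \<and> N \<le> norm z"
    have "norm (z - \<i> * of_real N) \<le> norm z + N"
      using norm_triangle_ineq4[of z "\<i> * of_real N"] N by (simp add: norm_mult)
    also have "\<dots> \<le> 2 * norm z" using z by simp
    finally have "norm (f z) * (norm z / (2 * norm z)) \<le> norm (f z) * norm (k z)"
      unfolding k_def norm_divide using nz[of z] z N
      by (intro mult_left_mono divide_left_mono mult_pos_pos) auto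
    also have "\<dots> \<le> e / 2" using fk[of z] z by (simp add: norm_mult)
    finally show "norm (f z) \<le> e" using z N by (auto split: if_splits)
  qed
qed

section \<open>Derivatives of holomorphic functions near the boundary\<close>

text \<open>A bound on the imaginary part alone controls the derivative, because \<open>exp (- i f)\<close> is bounded
  above and below. The exponential constant is harmless for what follows.\<close>

lemma deriv_norm_le_of_Im_bounded:
  assumes hol: "f holomorphic_on ball z r" and r: "r > 0"
    and M: "\<And>w. w \<in> ball z r \<Longrightarrow> \<bar>Im (f w)\<bar> \<le> M"
  shows "norm (deriv f z) \<le> 2 * exp (2 * M) / r"
proof -
  define g where "g w = exp (- \<i> * f w)" for w
  have holg: "g holomorphic_on ball z r"
    unfolding g_def using hol by (intro holomorphic_intros)
  have ng: "norm (g w) = exp (Im (f w))" for w by (simp add: g_def)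
  have sub: "cball z (r/2) \<subseteq> ball z r" using r by auto
  have "norm ((deriv ^^ 1) g z) \<le> fact 1 * exp M / (r/2)^1"
  proof (rule Cauchy_inequality)
    show "g holomorphic_on ball z (r/2)"
      using holg by (rule holomorphic_on_subset) (use r in auto)
    show "continuous_on (cball z (r/2)) g"
      using holg sub holomorphic_on_imp_continuous_on continuous_on_subset by blast
    show "norm (g w) \<le> exp M" if "norm (z - w) = r/2" for w
    proof -
      have "w \<in> ball z r" using that r by (simp add: dist_norm)
      from M[OF this] show ?thesis by (simp add: ng)
    qed
  qed (use r in auto)
  then have 1: "norm (deriv g z) \<le> 2 * exp M / r" by (simp add: mult.commute)
  have "(f has_field_derivative deriv f z) (at z)"
    using hol r by (intro holomorphic_derivI[of _ "ball z r"]) auto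
  then have "(g has_field_derivative (g z * (- \<i> * deriv f z))) (at z)"
    unfolding g_def by (auto intro!: derivative_eq_intros)
  then have "norm (deriv g z) = norm (g z) * norm (deriv f z)"
    by (simp add: DERIV_imp_deriv norm_mult)
  then have "norm (deriv f z) = norm (deriv g z) * exp (- Im (f z))"
    by (simp add: ng exp_minus field_simps)
  also have "\<dots> \<le> (2 * exp M / r) * exp M"
  proof (intro mult_mono 1)
    show "exp (- Im (f z)) \<le> exp M" using M[of z] r by (simp add: abs_le_iff)
  qed (use r in auto)
  also have "\<dots> = 2 * exp (2 * M) / r" by (simp add: mult_exp_exp flip: mult_2)
  finally show ?thesis .
qed

text \<open>Control of \<open>Im f'\<close> by the boundary derivative of \<open>Im f\<close>, without knowing that \<open>f'\<close> extends to
  the boundary: the maximum principle is applied to difference quotients, whose boundary values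
  are given by the mean value theorem. The barrier turns a square root modulus of continuity at
  \<open>a\<close> into a square root rate at depth \<open>y\<close> below \<open>a\<close>.\<close>

lemma Im_deriv_le_of_boundary:
  fixes f :: "complex \<Rightarrow> complex" and g :: "real \<Rightarrow> real"
  assumes cont: "continuous_on lower_closed f" and hol: "f holomorphic_on lower"
    and K: "\<And>z. Im z \<le> 0 \<Longrightarrow> norm (f z) \<le> K"
    and dg: "\<And>x. ((\<lambda>x. Im (f (of_real x))) has_real_derivative g x) (at x)"
    and g: "\<And>x. g x \<le> b + C * sqrt \<bar>x - a\<bar>" and C: "C \<ge> 0" and y: "y > 0"
  shows "Im (deriv f (Complex a (- y))) \<le> b + 2 * C * sqrt y"
proof -
  define z0 where "z0 = Complex a (- y)"
  have z0: "Im z0 < 0" using y by (simp add: z0_def)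
  let ?q = "\<lambda>h z. (f (z + of_real h) - f z) / of_real h"
  let ?s = "\<lambda>z. csqrt (of_real y + \<i> * (z - of_real a))"
  have *: "Im (?q h z0) \<le> b + 2 * C * sqrt y + C * sqrt h" if h: "h > 0" for h :: real
  proof -
    have "Re (- \<i> * ?q h z0 - of_real (sqrt 2 * C) * ?s z0) \<le> b + C * sqrt h"
    proof (rule lower_maximum_real[where f = "\<lambda>z. - \<i> * ?q h z - of_real (sqrt 2 * C) * ?s z"
          and K = "(K + K) / h"])
      show "Im z0 \<le> 0" using z0 by simp
      have "continuous_on lower_closed (\<lambda>z. f (z + of_real h))"
        by (rule continuous_on_compose2[OF cont]) (auto intro!: continuous_intros)
      then show "continuous_on lower_closed (\<lambda>z. - \<i> * ?q h z - of_real (sqrt 2 * C) * ?s z)"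
        using h y by (intro continuous_intros cont continuous_on_half_plane_barrier) auto
      have "f \<circ> (\<lambda>z. z + of_real h) holomorphic_on lower"
        by (rule holomorphic_on_compose_gen[OF _ hol]) (auto intro!: holomorphic_intros)
      then have "(\<lambda>z. f (z + of_real h)) holomorphic_on lower" by (simp add: o_def)
      then show "(\<lambda>z. - \<i> * ?q h z - of_real (sqrt 2 * C) * ?s z) holomorphic_on lower"
        using h y by (intro holomorphic_intros hol holomorphic_on_half_plane_barrier) auto
    next
      fix x :: real
      obtain t where t: "x < t" "t < x + h"
        "Im (f (of_real (x + h))) - Im (f (of_real x)) = (x + h - x) * g t"
        using MVT2[of x "x + h" "\<lambda>x. Im (f (of_real x))" g] dg h by auto
      have "Im (?q h (of_real x)) = g t"
        using t(3) h by (simp add: field_simps)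
      also have "g t \<le> b + C * sqrt \<bar>t - a\<bar>" by (rule g)
      also have "sqrt \<bar>t - a\<bar> \<le> sqrt (\<bar>x - a\<bar> + h)" using t by simp
      also have "\<dots> \<le> sqrt \<bar>x - a\<bar> + sqrt h" using h by (intro sqrt_add_le_add_sqrt) auto
      also have "sqrt \<bar>x - a\<bar> = sqrt 2 * sqrt (\<bar>x - a\<bar> / 2)"
        by (simp add: real_sqrt_divide)
      also have "sqrt (\<bar>x - a\<bar> / 2) \<le> sqrt (norm (of_real y + \<i> * (of_real x - of_real a)) / 2)"
        using abs_Im_le_cmod[of "of_real y + \<i> * (of_real x - of_real a)"] by simp
      also have "\<dots> \<le> Re (?s (of_real x))" using y by (intro Re_csqrt_ge) auto
      finally have "Im (?q h (of_real x)) \<le> b + C * (sqrt 2 * Re (?s (of_real x)) + sqrt h)"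
        using C by (simp add: mult_left_mono)
      then show "Re (- \<i> * ?q h (of_real x) - of_real (sqrt 2 * C) * ?s (of_real x)) \<le> b + C * sqrt h"
        by (simp add: algebra_simps del: csqrt.simps)
    next
      fix z :: complex assume z: "Im z \<le> 0"
      have "Re (- \<i> * ?q h z) \<le> norm (?q h z)"
        by (rule order_trans[OF complex_Re_le_cmod]) (simp add: norm_mult norm_divide)
      also have "\<dots> \<le> (K + K) / h"
        using h K[OF z] K[of "z + of_real h"] z norm_triangle_ineq4[of "f (z + of_real h)" "f z"]
        by (simp add: norm_divide divide_right_mono)
      finally show "Re (- \<i> * ?q h z - of_real (sqrt 2 * C) * ?s z) \<le> (K + K) / h"
        using C Re_csqrt[of "of_real y + \<i> * (z - of_real a)"]
        by (simp del: csqrt.simps add: add_increasing2 diff_le_eq)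
    qed
    moreover have "of_real y + \<i> * (z0 - of_real a) = of_real (2 * y)"
      by (simp add: z0_def complex_eq_iff)
    then have "Re (?s z0) = sqrt 2 * sqrt y"
      using y by (simp add: real_sqrt_mult del: csqrt.simps of_real_mult add: csqrt_of_real)
    ultimately show ?thesis by (simp add: algebra_simps del: csqrt.simps)
  qed
  have "(f has_field_derivative deriv f z0) (at z0)"
    using hol z0 open_lower by (intro holomorphic_derivI[of _ lower]) auto
  then have "((\<lambda>h. (f (z0 + h) - f z0) / h) \<longlongrightarrow> deriv f z0) (at 0)"
    by (simp add: DERIV_def)
  moreover have "filterlim complex_of_real (at 0) (at_right 0)"
    by (auto simp: filterlim_at eventually_at_filter intro!: tendsto_eq_intros)
  ultimately have "((\<lambda>h. ?q h z0) \<longlongrightarrow> deriv f z0) (at_right 0)"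
    by (rule filterlim_compose)
  then have 1: "((\<lambda>h. Im (?q h z0)) \<longlongrightarrow> Im (deriv f z0)) (at_right 0)"
    by (rule tendsto_Im)
  have 2: "((\<lambda>h. b + 2 * C * sqrt y + C * sqrt h) \<longlongrightarrow> b + 2 * C * sqrt y + C * sqrt 0) (at_right 0)"
    by (intro tendsto_intros)
  have "eventually (\<lambda>h. Im (?q h z0) \<le> b + 2 * C * sqrt y + C * sqrt h) (at_right 0)"
    by (rule eventually_at_rightI[of 0 1]) (use * in \<open>simp_all del: csqrt.simps\<close>)
  from tendsto_le[OF _ 2 1 this] show ?thesis unfolding z0_def[symmetric] by simp
qed

lemma abs_Im_deriv_le_of_boundary:
  fixes f :: "complex \<Rightarrow> complex" and g :: "real \<Rightarrow> real"
  assumes cont: "continuous_on lower_closed f" and hol: "f holomorphic_on lower"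
    and K: "\<And>z. Im z \<le> 0 \<Longrightarrow> norm (f z) \<le> K"
    and dg: "\<And>x. ((\<lambda>x. Im (f (of_real x))) has_real_derivative g x) (at x)"
    and g: "\<And>x. \<bar>g x - b\<bar> \<le> M + C * sqrt \<bar>x - a\<bar>" and C: "C \<ge> 0" and y: "y > 0"
  shows "\<bar>Im (deriv f (Complex a (- y))) - b\<bar> \<le> M + 2 * C * sqrt y"
proof -
  let ?z = "Complex a (- y)"
  have "g x \<le> (b + M) + C * sqrt \<bar>x - a\<bar>" for x using g[of x] by linarith
  from Im_deriv_le_of_boundary[OF cont hol K dg this C y]
  have 1: "Im (deriv f ?z) \<le> b + M + 2 * C * sqrt y" by simp
  have "- g x \<le> (M - b) + C * sqrt \<bar>x - a\<bar>" for x using g[of x] by linarith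
  moreover have "((\<lambda>x. Im (- f (of_real x))) has_real_derivative - g x) (at x)" for x
    using DERIV_minus[OF dg] by simp
  ultimately have "Im (deriv (\<lambda>z. - f z) ?z) \<le> (M - b) + 2 * C * sqrt y"
    using cont hol K C y
    by (intro Im_deriv_le_of_boundary[where K = K and g = "\<lambda>x. - g x"])
       (auto intro!: continuous_intros holomorphic_intros)
  moreover have "f field_differentiable at ?z"
    using hol y open_lower by (intro holomorphic_on_imp_differentiable_at[of _ lower]) auto
  then have "deriv (\<lambda>z. - f z) ?z = - deriv f ?z" by simp
  ultimately show ?thesis using 1 by (simp add: abs_le_iff)
qed

text \<open>Integration along a vertical segment, allowed to start on the boundary, where the
  derivative of \<open>f\<close> may blow up.\<close>

lemma vertical_increment_bound:
  fixes f :: "complex \<Rightarrow> complex" and \<phi> \<phi>' :: "real \<Rightarrow> real"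
  assumes cont: "continuous_on {z. Im z \<le> - a} f" and hol: "f holomorphic_on lower"
    and ab: "0 \<le> a" "a \<le> b"
    and \<phi>: "continuous_on {a..b} \<phi>"
    and d\<phi>: "\<And>t. a < t \<Longrightarrow> t < b \<Longrightarrow> (\<phi> has_real_derivative \<phi>' t) (at t)"
    and le: "\<And>t. a < t \<Longrightarrow> t < b \<Longrightarrow> norm (deriv f (Complex x (- t))) \<le> \<phi>' t"
  shows "norm (f (Complex x (- b)) - f (Complex x (- a))) \<le> \<phi> b - \<phi> a"
proof (cases "a = b")
  case False
  then have "a < b" using ab by simp
  have cx: "Complex x (- t) = of_real x - \<i> * of_real t" for t by (simp add: complex_eq_iff)
  show ?thesis
  proof (rule differentiable_bound_general[OF \<open>a < b\<close> _ \<phi>])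
    show "continuous_on {a..b} (\<lambda>t. f (Complex x (- t)))"
      unfolding cx by (rule continuous_on_compose2[OF cont]) (auto intro!: continuous_intros)
    fix t assume t: "a < t" "t < b"
    then show "(\<phi> has_vector_derivative \<phi>' t) (at t)"
      using d\<phi> by (simp add: has_real_derivative_iff_has_vector_derivative)
    have "(f has_field_derivative deriv f (Complex x (- t))) (at (Complex x (- t)))"
      using hol t ab open_lower by (intro holomorphic_derivI[of _ lower]) auto
    moreover have "((\<lambda>t. Complex x (- t)) has_vector_derivative - \<i>) (at t)"
      unfolding cx has_vector_derivative_def by (auto intro!: derivative_eq_intros simp: scaleR_conv_of_real mult.commute)
    ultimately have "(f \<circ> (\<lambda>t. Complex x (- t)) has_vector_derivative
        (- \<i> * deriv f (Complex x (- t)))) (at t)"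
      by (intro field_vector_diff_chain_at)
    then show "((\<lambda>t. f (Complex x (- t))) has_vector_derivative
        (- \<i> * deriv f (Complex x (- t)))) (at t)"
      by (simp add: o_def)
    show "norm (- \<i> * deriv f (Complex x (- t))) \<le> \<phi>' t"
      using le[OF t] by (simp add: norm_mult)
  qed
qed simp

lemma convex_horizontal_line: "convex {z. Im z = c}"
proof -
  have "{z. Im z = c} = {z. Im z \<le> c} \<inter> {z. Im z \<ge> c}" by auto
  then show ?thesis by (metis convex_Int convex_halfspace_Im_le convex_halfspace_Im_ge)
qed

lemma
  assumes "(f has_field_derivative d) (at (Complex x y))"
  shows horizontal_Re_derivative: "((\<lambda>t. Re (f (Complex t y))) has_real_derivative Re d) (at x)"
    and horizontal_Im_derivative: "((\<lambda>t. Im (f (Complex t y))) has_real_derivative Im d) (at x)"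
proof -
  have cx: "Complex t y = of_real t + \<i> * of_real y" for t by (simp add: complex_eq_iff)
  have "((\<lambda>t. Complex t y) has_vector_derivative 1) (at x)"
    unfolding cx has_vector_derivative_def
    by (auto intro!: derivative_eq_intros simp: scaleR_conv_of_real)
  then have "((\<lambda>t. f (Complex t y)) has_vector_derivative 1 * d) (at x)"
    using field_vector_diff_chain_at[of "\<lambda>t. Complex t y" 1 x f d] assms by (simp add: o_def)
  then have *: "((\<lambda>t. f (Complex t y)) has_vector_derivative d) (at x)" by simp
  show "((\<lambda>t. Re (f (Complex t y))) has_real_derivative Re d) (at x)"
    using bounded_linear.has_vector_derivative[OF bounded_linear_Re *]
    by (simp add: has_real_derivative_iff_has_vector_derivative)
  show "((\<lambda>t. Im (f (Complex t y))) has_real_derivative Im d) (at x)"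
    using bounded_linear.has_vector_derivative[OF bounded_linear_Im *]
    by (simp add: has_real_derivative_iff_has_vector_derivative)
qed

section \<open>Decaying solutions of the sinh boundary problem\<close>

lemma sinh_lipschitz:
  fixes a b B :: real
  assumes "\<bar>a\<bar> \<le> B" "\<bar>b\<bar> \<le> B"
  shows "\<bar>sinh a - sinh b\<bar> \<le> cosh B * \<bar>a - b\<bar>"
proof -
  have "norm (sinh a - sinh b) \<le> cosh B * norm (a - b)"
  proof (rule field_differentiable_bound[of "{-B..B}"])
    fix t assume "t \<in> {-B..B}"
    then have "\<bar>t\<bar> \<le> B" by auto
    then have "cosh \<bar>t\<bar> \<le> cosh B" by (intro cosh_real_nonneg_le_iff[THEN iffD2]) auto
    then show "norm (cosh t) \<le> cosh B" by (simp add: cosh_real_abs)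
  qed (use assms in \<open>auto intro!: derivative_eq_intros\<close>)
  then show ?thesis by simp
qed

text \<open>The difference of two Poisson kernels at different heights. Its boundary values are
  positive only near the origin (where \<open>s\<^sup>2 < 14\<close>), but the total mass is positive, so that it is
  still of order \<open>1/t\<close> at depth \<open>t\<close>. It is the lower bound for harmonic functions with positive
  boundary values in a neighbourhood of a point.\<close>

lemma half_plane_bump:
  defines "p \<equiv> \<lambda>\<zeta>::complex. 1 / (1 + \<i> * \<zeta>) - 1 / (2 * (4 + \<i> * \<zeta>))"
  shows half_plane_bump_boundary: "Re (p (of_real s)) = 1 / (1 + s\<^sup>2) - 2 / (16 + s\<^sup>2)"
    and half_plane_bump_axis: "t \<ge> 0 \<Longrightarrow> 1 / (2 * (1 + t)) \<le> Re (p (Complex 0 (- t)))"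
    and half_plane_bump_decay: "norm \<zeta> \<ge> 8 \<Longrightarrow> norm (p \<zeta>) \<le> 3 / norm \<zeta>"
    and half_plane_bump_holomorphic: "p holomorphic_on lower"
    and half_plane_bump_continuous: "continuous_on lower_closed p"
proof -
  have nz: "1 + \<i> * \<zeta> \<noteq> 0" "4 + \<i> * \<zeta> \<noteq> 0" if "Im \<zeta> \<le> 0" for \<zeta>
    using that by (auto simp: complex_eq_iff)
  show "Re (p (of_real s)) = 1 / (1 + s\<^sup>2) - 2 / (16 + s\<^sup>2)"
    by (simp add: p_def Re_divide power2_eq_square) (simp add: divide_simps)
  show "1 / (2 * (1 + t)) \<le> Re (p (Complex 0 (- t)))" if t: "t \<ge> 0"
  proof -
    have "\<i> * Complex 0 (- t) = of_real t" by (simp add: complex_eq_iff)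
    then have "p (Complex 0 (- t)) = of_real (1 / (1 + t) - 1 / (2 * (4 + t)))"
      by (simp add: p_def)
    moreover have "1 / (2 * (1 + t)) \<le> 1 / (1 + t) - 1 / (2 * (4 + t))"
      using t by (simp add: divide_simps) (simp add: algebra_simps)
    ultimately show ?thesis by simp
  qed
  show "norm (p \<zeta>) \<le> 3 / norm \<zeta>" if "norm \<zeta> \<ge> 8"
  proof -
    have a: "norm \<zeta> / 2 \<le> norm (1 + \<i> * \<zeta>)"
      using norm_triangle_ineq2[of "\<i> * \<zeta>" "- 1"] that by (simp add: norm_mult add.commute)
    have b: "norm \<zeta> / 2 \<le> norm (4 + \<i> * \<zeta>)"
      using norm_triangle_ineq2[of "\<i> * \<zeta>" "- 4"] that by (simp add: norm_mult add.commute)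
    have "norm (p \<zeta>) \<le> 1 / norm (1 + \<i> * \<zeta>) + 1 / (2 * norm (4 + \<i> * \<zeta>))"
      unfolding p_def by (rule order_trans[OF norm_triangle_ineq4]) (simp only: norm_divide norm_mult norm_one norm_numeral order_refl)
    also have "\<dots> \<le> 1 / (norm \<zeta> / 2) + 1 / (2 * (norm \<zeta> / 2))"
      using a b that by (intro add_mono divide_left_mono mult_pos_pos mult_left_mono) auto
    finally show ?thesis using that by (simp add: field_simps)
  qed
  show "p holomorphic_on lower"
    unfolding p_def using nz by (intro holomorphic_intros) (auto simp: less_imp_le simp del: distrib_left_numeral)
  show "continuous_on lower_closed p"
    unfolding p_def using nz by (intro continuous_intros) (auto simp del: distrib_left_numeral)
qed

text \<open>The harmonic function \<open>Re F\<close> satisfies a nonlinear Neumann condition, written for the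
  harmonic conjugate.\<close>

locale sinh_boundary_problem =
  fixes F :: "complex \<Rightarrow> complex" and \<kappa> :: real
  assumes cont: "continuous_on lower_closed F"
    and hol: "F holomorphic_on lower"
    and vanish: "\<And>e. e > 0 \<Longrightarrow> \<exists>R. \<forall>z. Im z \<le> 0 \<and> R \<le> norm z \<longrightarrow> norm (F z) \<le> e"
    and boundary: "\<And>x. ((\<lambda>x. Im (F (of_real x))) has_real_derivative
                     - \<kappa> * sinh (Re (F (of_real x)))) (at x)"
    and \<kappa>_pos: "\<kappa> > 0"
begin

lemma bounded: obtains B where "B > 0" "\<And>z. Im z \<le> 0 \<Longrightarrow> norm (F z) \<le> B"
proof -
  obtain R where R: "\<And>z. Im z \<le> 0 \<Longrightarrow> R \<le> norm z \<Longrightarrow> norm (F z) \<le> 1"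
    using vanish[of 1] by auto
  have "compact (lower_closed \<inter> cball 0 R)"
    by (intro closed_Int_compact closed_halfspace_Im_le compact_cball)
  then have "compact (F ` (lower_closed \<inter> cball 0 R))"
    by (intro compact_continuous_image continuous_on_subset[OF cont]) auto
  then have "bounded (F ` (lower_closed \<inter> cball 0 R))" by (rule compact_imp_bounded)
  then obtain b where "\<And>y. y \<in> F ` (lower_closed \<inter> cball 0 R) \<Longrightarrow> norm y \<le> b"
    unfolding bounded_iff by blast
  then have b: "\<And>z. Im z \<le> 0 \<Longrightarrow> norm z \<le> R \<Longrightarrow> norm (F z) \<le> b" by auto
  have "norm (F z) \<le> max 1 b" if "Im z \<le> 0" for z
    using R[OF that] b[OF that] by (cases "R \<le> norm z") (auto simp: max.coboundedI1 max.coboundedI2)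
  then show thesis using that[of "max 1 b"] by simp
qed

lemma has_deriv: "Im z < 0 \<Longrightarrow> (F has_field_derivative deriv F z) (at z)"
  using hol open_lower by (intro holomorphic_derivI[of _ lower]) auto

lemma holomorphic_deriv_lower: "deriv F holomorphic_on lower"
  using hol open_lower by (rule holomorphic_deriv)

text \<open>The boundary condition bounds \<open>Im F'\<close>, hence \<open>F'' = O (1/y)\<close>, hence \<open>F' = O (log (1/y))\<close>. The
  power \<open>y\<^bsup>-1/4\<^esup>\<close> is a convenient majorant of the logarithm; any exponent between \<open>-1/2\<close> and \<open>0\<close>
  would make \<open>(F')\<^sup>2\<close> integrable up to the boundary.\<close>

lemma deriv_growth_near_boundary:
  obtains C where "C > 0"
    "\<And>x y. 0 < y \<Longrightarrow> y \<le> 1 \<Longrightarrow> norm (deriv F (Complex x (- y))) \<le> C * y powr (-1/4)"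
proof -
  obtain B where B: "B > 0" "\<And>z. Im z \<le> 0 \<Longrightarrow> norm (F z) \<le> B" using bounded by blast
  define M where "M = \<kappa> * sinh B"
  have sh: "\<bar>- \<kappa> * sinh (Re (F (of_real x))) - 0\<bar> \<le> M + 0 * sqrt \<bar>x - a\<bar>" for x a
  proof -
    have "\<bar>Re (F (of_real x))\<bar> \<le> B" using B(2)[of "of_real x"] abs_Re_le_cmod order_trans by fastforce
    then have "sinh \<bar>Re (F (of_real x))\<bar> \<le> sinh B" by (subst sinh_real_le_iff)
    then show ?thesis using \<kappa>_pos by (simp add: M_def abs_mult sinh_real_abs)
  qed
  have M: "\<bar>Im (deriv F z)\<bar> \<le> M" if "Im z < 0" for z
    using abs_Im_deriv_le_of_boundary[OF cont hol B(2) boundary sh, of "- Im z" "Re z"] that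
    by (simp add: complex.collapse)
  have d1: "norm (deriv F (Complex x (-1))) \<le> 2 * exp (2 * B)" for x
  proof -
    have "norm (deriv F (Complex x (-1))) \<le> 2 * exp (2 * B) / 1"
    proof (rule deriv_norm_le_of_Im_bounded)
      have *: "Im w < 0" if "w \<in> ball (Complex x (-1)) 1" for w
        using that abs_Im_le_cmod[of "Complex x (-1) - w"] by (auto simp: dist_norm)
      show "F holomorphic_on ball (Complex x (-1)) 1"
        using hol by (rule holomorphic_on_subset) (use * in auto)
      show "\<bar>Im (F w)\<bar> \<le> B" if "w \<in> ball (Complex x (-1)) 1" for w
        using B(2)[of w] *[OF that] abs_Im_le_cmod[of "F w"] by simp
    qed simp
    then show ?thesis by simp
  qed
  have d2: "norm (deriv (deriv F) (Complex x (- t))) \<le> 2 * exp (2 * M) / t" if "t > 0" for x t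
  proof (rule deriv_norm_le_of_Im_bounded[OF _ that])
    have *: "Im w < 0" if "w \<in> ball (Complex x (-t)) t" for w
      using that abs_Im_le_cmod[of "Complex x (-t) - w"] by (auto simp: dist_norm)
    show "deriv F holomorphic_on ball (Complex x (-t)) t"
      using holomorphic_deriv_lower by (rule holomorphic_on_subset) (use * in auto)
    show "\<bar>Im (deriv F w)\<bar> \<le> M" if "w \<in> ball (Complex x (-t)) t" for w
      using M *[OF that] by simp
  qed
  define c where "c = 2 * exp (2 * M)"
  show thesis
  proof (rule that[of "2 * exp (2 * B) + 4 * c"])
    fix x y :: real assume y: "0 < y" "y \<le> 1"
    have "norm (deriv F (Complex x (- 1)) - deriv F (Complex x (- y))) \<le> c * ln 1 - c * ln y"
    proof (rule vertical_increment_bound[OF _ holomorphic_deriv_lower])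
      show "continuous_on {z. Im z \<le> - y} (deriv F)"
        using holomorphic_on_imp_continuous_on[OF holomorphic_deriv_lower]
        by (rule continuous_on_subset) (use y in auto)
      show "continuous_on {y..1} (\<lambda>t. c * ln t)" using y by (intro continuous_intros) auto
      show "((\<lambda>t. c * ln t) has_real_derivative c / t) (at t)" if "y < t" for t
        using that y by (auto intro!: derivative_eq_intros)
      show "norm (deriv (deriv F) (Complex x (- t))) \<le> c / t" if "y < t" for t
        using d2[of t x] that y by (simp add: c_def)
    qed (use y in auto)
    then have "norm (deriv F (Complex x (- y))) \<le> 2 * exp (2 * B) + c * (- ln y)"
      using d1[of x] norm_triangle_ineq2[of "deriv F (Complex x (- y))" "deriv F (Complex x (- 1))"]
      by (simp add: norm_minus_commute)
    also have "- ln y \<le> 4 * y powr (-1/4)"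
    proof -
      have "ln (y powr (-1/4)) \<le> y powr (-1/4) - 1" using y by (intro ln_le_minus_one) auto
      then show ?thesis using y by (simp add: ln_powr)
    qed
    also have "1 \<le> y powr (-1/4)"
      using y powr_mono'[of "-1/4" 0 y] by simp
    then have "2 * exp (2 * B) + c * (4 * y powr (-1/4))
        \<le> 2 * exp (2 * B) * y powr (-1/4) + c * (4 * y powr (-1/4))" by simp
    finally show "norm (deriv F (Complex x (- y))) \<le> (2 * exp (2 * B) + 4 * c) * y powr (-1/4)"
      by (simp add: c_def algebra_simps)
  qed (simp add: c_def add_pos_pos)
qed

text \<open>Two boundary points at distance \<open>d\<close> are joined through depth \<open>d\<close>, where the growth of \<open>F'\<close>
  gives \<open>O (d\<^bsup>3/4\<^esup>)\<close> on each of the three segments.\<close>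

lemma Holder_half:
  obtains C where "C > 0"
    "\<And>x y. 0 \<le> y \<Longrightarrow> y \<le> 1 \<Longrightarrow> norm (F (Complex x (- y)) - F (of_real x)) \<le> C * sqrt y"
    "\<And>x x'. norm (F (of_real x) - F (of_real x')) \<le> C * sqrt \<bar>x - x'\<bar>"
proof -
  obtain B where B: "B > 0" "\<And>z. Im z \<le> 0 \<Longrightarrow> norm (F z) \<le> B" using bounded by blast
  obtain C where C: "C > 0"
    "\<And>x y. 0 < y \<Longrightarrow> y \<le> 1 \<Longrightarrow> norm (deriv F (Complex x (- y))) \<le> C * y powr (-1/4)"
    using deriv_growth_near_boundary by blast
  have le_sqrt: "y powr (3/4) \<le> sqrt y" if "0 \<le> y" "y \<le> 1" for y :: real
    using that powr_mono'[of "1/2" "3/4" y] by (cases "y = 0") (auto simp: powr_half_sqrt)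
  have vert: "norm (F (Complex x (- y)) - F (of_real x)) \<le> 2 * C * sqrt y"
    if y: "0 \<le> y" "y \<le> 1" for x y
  proof -
    have "norm (F (Complex x (- y)) - F (Complex x (- 0)))
        \<le> 4/3 * C * y powr (3/4) - 4/3 * C * 0 powr (3/4)"
    proof (rule vertical_increment_bound[OF _ hol])
      show "continuous_on {0..y} (\<lambda>t. 4/3 * C * t powr (3/4))"
        by (intro continuous_intros continuous_on_powr') auto
      show "((\<lambda>t. 4/3 * C * t powr (3/4)) has_real_derivative C * t powr (-1/4)) (at t)"
        if "0 < t" for t
      proof -
        have "((\<lambda>t. t powr (3/4)) has_real_derivative 3/4 * t powr (3/4 - 1)) (at t)"
          using that by (rule has_real_derivative_powr)
        from DERIV_cmult[OF this, of "4/3 * C"] show ?thesis by simp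
      qed
      show "norm (deriv F (Complex x (- t))) \<le> C * t powr (-1/4)" if "0 < t" "t < y" for t
        using C(2) that y by simp
    qed (use y cont in auto)
    also have "\<dots> \<le> 4/3 * C * sqrt y" using le_sqrt[OF y] C(1) by simp
    also have "\<dots> \<le> 2 * C * sqrt y" using C(1) y by simp
    finally show ?thesis by (simp add: complex_of_real_def)
  qed
  have horiz: "norm (F (of_real x) - F (of_real x')) \<le> (5 * C + 2 * B) * sqrt \<bar>x - x'\<bar>" for x x'
  proof -
    define d where "d = \<bar>x - x'\<bar>"
    consider "d = 0" | "d \<ge> 1" | "0 < d" "d < 1" unfolding d_def by linarith
    then have "norm (F (of_real x) - F (of_real x')) \<le> (5 * C + 2 * B) * sqrt d"
    proof cases
      case 1
      then show ?thesis by (simp add: d_def)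
    next
      case 2
      have "norm (F (of_real x) - F (of_real x')) \<le> (2 * B) * 1"
        using B(2)[of "of_real x"] B(2)[of "of_real x'"]
          norm_triangle_ineq4[of "F (of_real x)" "F (of_real x')"] by simp
      also have "\<dots> \<le> (5 * C + 2 * B) * sqrt d"
        using 2 B C by (intro mult_mono) auto
      finally show ?thesis .
    next
      case 3
      have "norm (F (Complex x (- d)) - F (Complex x' (- d)))
          \<le> (C * d powr (-1/4)) * norm (Complex x (- d) - Complex x' (- d))"
      proof (rule field_differentiable_bound[of "{z. Im z = - d}"])
        show "convex {z. Im z = - d}" by (rule convex_horizontal_line)
        fix z assume "z \<in> {z. Im z = - d}"
        then have z: "Complex (Re z) (- d) = z" "Im z < 0" using 3 by (auto simp: complex_eq_iff)
        show "norm (deriv F z) \<le> C * d powr (-1/4)"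
          using C(2)[of d "Re z"] 3 unfolding z(1) by simp
        show "(F has_field_derivative deriv F z) (at z within {z. Im z = - d})"
          using has_deriv[OF z(2)] by (rule has_field_derivative_at_within)
      qed auto
      also have "norm (Complex x (- d) - Complex x' (- d)) = d" by (simp add: cmod_def d_def)
      also have "(C * d powr (-1/4)) * d = C * d powr (3/4)"
        using 3 powr_add[of d "-1/4" 1] by simp
      also have "\<dots> \<le> C * sqrt d" using le_sqrt[of d] 3 C(1) by simp
      finally have "norm (F (Complex x (- d)) - F (Complex x' (- d))) \<le> C * sqrt d" .
      moreover have "norm (p - q + r) \<le> norm p + norm q + norm r" for p q r :: complex
        using norm_triangle_ineq[of "p - q" r] norm_triangle_ineq4[of p q] by simp
      from this[of "F (Complex x (- d)) - F (Complex x' (- d))" "F (Complex x (- d)) - F (of_real x)"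
          "F (Complex x' (- d)) - F (of_real x')"]
      have "norm (F (of_real x) - F (of_real x')) \<le>
         norm (F (Complex x (- d)) - F (Complex x' (- d))) + norm (F (Complex x (- d)) - F (of_real x))
         + norm (F (Complex x' (- d)) - F (of_real x'))" by simp
      ultimately have "norm (F (of_real x) - F (of_real x')) \<le> 5 * C * sqrt d"
        using vert[of d x] vert[of d x'] 3 by simp
      also have "\<dots> \<le> (5 * C + 2 * B) * sqrt d" using B 3 by (intro mult_right_mono) auto
      finally show ?thesis .
    qed
    then show ?thesis by (simp add: d_def)
  qed
  show thesis
  proof (rule that[of "5 * C + 2 * B"])
    show "norm (F (Complex x (- y)) - F (of_real x)) \<le> (5 * C + 2 * B) * sqrt y"
      if "0 \<le> y" "y \<le> 1" for x y
      using vert[OF that, of x] mult_right_mono[of "2 * C" "5 * C + 2 * B" "sqrt y"] B C that by simp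
  qed (use horiz B C in auto)
qed

text \<open>The boundary condition holds approximately inside. This is the second half of the
  bootstrap: \<open>F\<close> is Hoelder continuous on the line, so \<open>\<theta>'\<close> is, and the rate propagates to \<open>\<theta>\<^sub>x\<close>.\<close>

lemma boundary_defect:
  obtains C where "C > 0"
    "\<And>x y. 0 < y \<Longrightarrow> y \<le> 1 \<Longrightarrow>
       \<bar>Im (deriv F (Complex x (- y))) + \<kappa> * sinh (Re (F (Complex x (- y))))\<bar> \<le> C * sqrt y"
proof -
  obtain B where B: "B > 0" "\<And>z. Im z \<le> 0 \<Longrightarrow> norm (F z) \<le> B" using bounded by blast
  obtain C where C: "C > 0"
    "\<And>x y. 0 \<le> y \<Longrightarrow> y \<le> 1 \<Longrightarrow> norm (F (Complex x (- y)) - F (of_real x)) \<le> C * sqrt y"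
    "\<And>x x'. norm (F (of_real x) - F (of_real x')) \<le> C * sqrt \<bar>x - x'\<bar>"
    using Holder_half by blast
  have ReB: "\<bar>Re (F z)\<bar> \<le> B" if "Im z \<le> 0" for z
    using B(2)[OF that] abs_Re_le_cmod[of "F z"] by simp
  define K where "K = \<kappa> * cosh B * C"
  have K: "K > 0" using \<kappa>_pos C by (simp add: K_def)
  have sh: "\<bar>\<kappa> * sinh (Re (F z)) - \<kappa> * sinh (Re (F w))\<bar> \<le> K * s"
    if "Im z \<le> 0" "Im w \<le> 0" "norm (F z - F w) \<le> C * s" for z w s
  proof -
    have "\<bar>Re (F z) - Re (F w)\<bar> \<le> C * s"
      using that(3) abs_Re_le_cmod[of "F z - F w"] by simp
    then have "cosh B * \<bar>Re (F z) - Re (F w)\<bar> \<le> cosh B * (C * s)" by (intro mult_left_mono) auto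
    then have "\<bar>sinh (Re (F z)) - sinh (Re (F w))\<bar> \<le> cosh B * (C * s)"
      using sinh_lipschitz[OF ReB ReB, OF that(1,2)] by (rule order_trans[rotated])
    then have "\<kappa> * \<bar>sinh (Re (F z)) - sinh (Re (F w))\<bar> \<le> \<kappa> * (cosh B * (C * s))"
      using \<kappa>_pos by simp
    then show ?thesis using \<kappa>_pos by (simp add: K_def abs_mult mult.assoc flip: right_diff_distrib)
  qed
  show thesis
  proof (rule that[of "3 * K"])
    fix x y :: real assume y: "0 < y" "y \<le> 1"
    let ?z = "Complex x (- y)" and ?b = "- \<kappa> * sinh (Re (F (of_real x)))"
    have "\<bar>Im (deriv F ?z) - ?b\<bar> \<le> 0 + 2 * K * sqrt y"
    proof (rule abs_Im_deriv_le_of_boundary[OF cont hol B(2) boundary])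
      show "\<bar>- \<kappa> * sinh (Re (F (of_real s))) - ?b\<bar> \<le> 0 + K * sqrt \<bar>s - x\<bar>" for s
        using sh[of "of_real x" "of_real s", OF _ _ C(3)] by (simp add: abs_minus_commute)
    qed (use K y in auto)
    moreover have "\<bar>\<kappa> * sinh (Re (F ?z)) - \<kappa> * sinh (Re (F (of_real x)))\<bar> \<le> K * sqrt y"
      using y by (intro sh C(2)) auto
    ultimately show "\<bar>Im (deriv F ?z) + \<kappa> * sinh (Re (F ?z))\<bar> \<le> 3 * K * sqrt y" by simp
  qed (use K in simp)
qed

text \<open>Cauchy's estimate on the disc whose radius is half the depth of \<open>z\<close>; this disc stays
  outside the ball of radius \<open>R\<close>.\<close>

lemma deriv_decay:
  assumes m: "\<And>z. Im z \<le> 0 \<Longrightarrow> R \<le> norm z \<Longrightarrow> norm (F z) \<le> m"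
    and z: "Im z < 0" "2 * R \<le> norm z"
  shows "norm (deriv F z) \<le> 2 * m / (- Im z)"
proof -
  define r where "r = - Im z / 2"
  have r: "r > 0" using z by (simp add: r_def)
  have in_lower: "Im w < 0" and far: "R \<le> norm w" if "w \<in> cball z r" for w
  proof -
    have d: "norm (z - w) \<le> r" using that by (simp add: dist_norm)
    then show "Im w < 0" using abs_Im_le_cmod[of "z - w"] z by (simp add: r_def)
    have "r \<le> norm z / 2" using abs_Im_le_cmod[of z] z by (simp add: r_def)
    then show "R \<le> norm w" using d z norm_triangle_ineq2[of z w] by simp
  qed
  have "norm ((deriv ^^ 1) F z) \<le> fact 1 * m / r ^ 1"
  proof (rule Cauchy_inequality)
    show "F holomorphic_on ball z r"
      using hol by (rule holomorphic_on_subset) (use in_lower in auto)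
    show "continuous_on (cball z r) F"
      using cont by (rule continuous_on_subset) (use in_lower in \<open>auto simp: less_imp_le\<close>)
    show "norm (F w) \<le> m" if "norm (z - w) = r" for w
      using m[of w] in_lower[of w] far[of w] that by (simp add: dist_norm)
  qed (use r in auto)
  then show ?thesis by (simp add: r_def mult.commute)
qed

text \<open>The second property says that \<open>G = o (1 / \<bar>Im z\<bar>)\<close>, because \<open>m\<close> may be taken small for \<open>R\<close> large.
  It comes from integrating \<open>deriv_decay\<close> along vertical rays, all of which have the same limit
  since \<open>(F')\<^sup>2\<close> is \<open>O (1 / y\<^sup>2)\<close> on horizontal lines.\<close>

lemma squared_deriv_primitive:
  obtains G where
    "\<And>z. Im z < 0 \<Longrightarrow> (G has_field_derivative (deriv F z)\<^sup>2) (at z)"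
    "\<And>R m z. (\<And>z. Im z \<le> 0 \<Longrightarrow> R \<le> norm z \<Longrightarrow> norm (F z) \<le> m) \<Longrightarrow>
        Im z < 0 \<Longrightarrow> 2 * R \<le> norm z \<Longrightarrow> norm (G z) \<le> 4 * m\<^sup>2 / (- Im z)"
proof -
  obtain G where "\<And>z. z \<in> lower \<Longrightarrow> (G has_field_derivative (deriv F z)\<^sup>2) (at z within lower)"
    using holomorphic_convex_primitive'[OF convex_lower open_lower, of "\<lambda>z. (deriv F z)\<^sup>2"]
      holomorphic_deriv_lower by (auto intro: holomorphic_on_power)
  then have dG: "(G has_field_derivative (deriv F z)\<^sup>2) (at z)" if "Im z < 0" for z
    using that at_within_open[OF _ open_lower] by fastforce
  then have holG: "G holomorphic_on lower"
    by (auto simp: holomorphic_on_open[OF open_lower])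
  have incr: "norm (G (Complex x (- b)) - G (Complex x (- a))) \<le> 4 * m\<^sup>2 / a"
    if m: "\<And>z. Im z \<le> 0 \<Longrightarrow> R \<le> norm z \<Longrightarrow> norm (F z) \<le> m"
      and a: "0 < a" "a \<le> b" and R: "2 * R \<le> norm (Complex x (- a))" for R m a b x
  proof -
    have "norm (G (Complex x (- b)) - G (Complex x (- a))) \<le> - 4 * m\<^sup>2 / b - (- 4 * m\<^sup>2 / a)"
    proof (rule vertical_increment_bound[OF _ holG])
      show "continuous_on {z. Im z \<le> - a} G"
        using holomorphic_on_imp_continuous_on[OF holG]
        by (rule continuous_on_subset) (use a in auto)
      show "continuous_on {a..b} (\<lambda>t. - 4 * m\<^sup>2 / t)" using a by (intro continuous_intros) auto
      fix t assume t: "a < t" "t < b"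
      then show "((\<lambda>t. - 4 * m\<^sup>2 / t) has_real_derivative (2 * m / t)\<^sup>2) (at t)"
        using a by (auto intro!: derivative_eq_intros simp: power2_eq_square field_simps)
      have "norm (Complex x (- a)) \<le> norm (Complex x (- t))"
        using t a by (simp add: cmod_def)
      then have "norm (deriv F (Complex x (- t))) \<le> 2 * m / (- Im (Complex x (- t)))"
        using t a R by (intro deriv_decay[OF m]) auto
      then have "(norm (deriv F (Complex x (- t))))\<^sup>2 \<le> (2 * m / t)\<^sup>2" by (intro power_mono) auto
      then show "norm (deriv G (Complex x (- t))) \<le> (2 * m / t)\<^sup>2"
        using dG[of "Complex x (- t)"] t a by (simp add: DERIV_imp_deriv norm_power)
    qed (use a in auto)
    also have "\<dots> \<le> 4 * m\<^sup>2 / a" using a by simp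
    finally show ?thesis .
  qed
  obtain B where B: "B > 0" "\<And>z. Im z \<le> 0 \<Longrightarrow> norm (F z) \<le> B" using bounded by blast
  let ?g = "\<lambda>x n. G (Complex x (- real n))"
  have "Cauchy (?g 0)"
  proof (rule metric_CauchyI)
    fix e :: real assume e: "e > 0"
    obtain N where N: "real N > 8 * B\<^sup>2 / e" using reals_Archimedean2 by blast
    have Np: "real N > 0" by (rule le_less_trans[OF _ N]) (use e in simp)
    then have "8 * B\<^sup>2 / N < e" using N e by (simp add: field_simps)
    moreover have near: "dist (?g 0 n) (?g 0 N) \<le> 4 * B\<^sup>2 / N" if "n \<ge> N" for n
      using incr[of 0 B "real N" "real n" 0] B that Np by (simp add: dist_norm)
    ultimately have "dist (?g 0 n) (?g 0 m) < e" if "n \<ge> N" "m \<ge> N" for n m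
      using dist_triangle2[of "?g 0 n" "?g 0 m" "?g 0 N"] near[OF that(1)] near[OF that(2)]
      by simp
    then show "\<exists>N. \<forall>m\<ge>N. \<forall>n\<ge>N. dist (?g 0 m) (?g 0 n) < e" by blast
  qed
  then obtain l where l: "?g 0 \<longlonglongrightarrow> l" using Cauchy_convergent_iff convergent_def by blast
  have lx: "?g x \<longlonglongrightarrow> l" for x
  proof -
    have "norm (?g x n - ?g 0 n) \<le> (2 * B / n)\<^sup>2 * \<bar>x\<bar>" if n: "n > 0" for n
    proof -
      have "norm (?g x n - ?g 0 n) \<le> (2 * B / n)\<^sup>2 * norm (Complex x (- real n) - Complex 0 (- real n))"
      proof (rule field_differentiable_bound[OF convex_horizontal_line[of "- real n"]])
        fix z assume "z \<in> {z. Im z = - real n}"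
        then have z: "Im z = - real n" "Im z < 0" using n by auto
        show "(G has_field_derivative (deriv F z)\<^sup>2) (at z within {z. Im z = - real n})"
          using dG[OF z(2)] by (rule has_field_derivative_at_within)
        have "norm (deriv F z) \<le> 2 * B / (- Im z)"
          using B z by (intro deriv_decay[of 0]) auto
        then show "norm ((deriv F z)\<^sup>2) \<le> (2 * B / real n)\<^sup>2"
          unfolding norm_power using z by (intro power_mono) auto
      qed auto
      also have "norm (Complex x (- real n) - Complex 0 (- real n)) = \<bar>x\<bar>" by (simp add: cmod_def)
      finally show ?thesis .
    qed
    then have "eventually (\<lambda>n. norm (?g x n - ?g 0 n) \<le> (2 * B / n)\<^sup>2 * \<bar>x\<bar>) sequentially"
      by (rule eventually_mono[OF eventually_gt_at_top[of 0]])
    moreover have "(\<lambda>n. (2 * B * inverse (real n))\<^sup>2 * \<bar>x\<bar>) \<longlonglongrightarrow> (2 * B * 0)\<^sup>2 * \<bar>x\<bar>"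
      by (intro tendsto_intros lim_inverse_n)
    then have "(\<lambda>n. (2 * B / real n)\<^sup>2 * \<bar>x\<bar>) \<longlonglongrightarrow> 0" by (simp add: divide_inverse)
    ultimately have "(\<lambda>n. ?g x n - ?g 0 n) \<longlonglongrightarrow> 0" by (rule Lim_null_comparison)
    from tendsto_add[OF this l] show ?thesis by simp
  qed
  show thesis
  proof (rule that[of "\<lambda>z. G z - l"])
    show "((\<lambda>z. G z - l) has_field_derivative (deriv F z)\<^sup>2) (at z)" if "Im z < 0" for z
      using DERIV_diff[OF dG[OF that] DERIV_const[of l]] by simp
    fix R m z
    assume m: "\<And>z. Im z \<le> 0 \<Longrightarrow> R \<le> norm z \<Longrightarrow> norm (F z) \<le> m"
      and z: "Im z < 0" "2 * R \<le> norm z"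
    define x a where "x = Re z" and "a = - Im z"
    have za: "z = Complex x (- a)" "0 < a" using z by (simp_all add: x_def a_def complex.collapse)
    have "norm (l - G z) \<le> 4 * m\<^sup>2 / a"
    proof (rule Lim_norm_ubound)
      show "(\<lambda>n. ?g x n - G z) \<longlonglongrightarrow> l - G z" by (intro tendsto_intros lx)
      show "eventually (\<lambda>n. norm (?g x n - G z) \<le> 4 * m\<^sup>2 / a) sequentially"
        using eventually_ge_at_top[of "nat \<lceil>a\<rceil>"]
      proof eventually_elim
        case (elim n)
        then have "a \<le> real n" by linarith
        then show ?case unfolding za(1) using za z m by (intro incr[of R]) auto
      qed
    qed simp
    then show "norm (G z - l) \<le> 4 * m\<^sup>2 / (- Im z)" by (simp add: a_def norm_minus_commute)
  qed
qed

text \<open>Below depth \<open>s\<close> the decay of \<open>G\<close> suffices; above it, one integrates \<open>(F')\<^sup>2 = O (y\<^bsup>-1/2\<^esup>)\<close>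
  over a segment of length at most \<open>s\<close>.\<close>

lemma primitive_vanishes_at_infinity:
  assumes dG: "\<And>z. Im z < 0 \<Longrightarrow> (G has_field_derivative (deriv F z)\<^sup>2) (at z)"
    and decay: "\<And>R m z. (\<And>z. Im z \<le> 0 \<Longrightarrow> R \<le> norm z \<Longrightarrow> norm (F z) \<le> m) \<Longrightarrow>
        Im z < 0 \<Longrightarrow> 2 * R \<le> norm z \<Longrightarrow> norm (G z) \<le> 4 * m\<^sup>2 / (- Im z)"
    and e: "e > 0"
  shows "\<exists>R. \<forall>z. Im z < 0 \<and> R \<le> norm z \<longrightarrow> norm (G z) \<le> e"
proof -
  obtain C where C: "C > 0"
    "\<And>x y. 0 < y \<Longrightarrow> y \<le> 1 \<Longrightarrow> norm (deriv F (Complex x (- y))) \<le> C * y powr (-1/4)"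
    using deriv_growth_near_boundary by blast
  \<comment> \<open>The strip of depth \<open>s\<close> contributes at most \<open>2 C\<^sup>2 s\<^bsup>1/2\<^esup> \<le> e/2\<close>, and \<open>m\<close> is chosen for the rest.\<close>
  define s where "s = min 1 ((e / (4 * C\<^sup>2))\<^sup>2)"
  have s: "0 < s" "s \<le> 1" using e C by (auto simp: s_def)
  have "sqrt s \<le> e / (4 * C\<^sup>2)"
    using e C by (intro real_le_lsqrt) (auto simp: s_def)
  then have Cs: "2 * C\<^sup>2 * sqrt s \<le> e / 2" using C by (simp add: field_simps)
  define m where "m = sqrt (e * s / 8)"
  have m: "m > 0" "4 * m\<^sup>2 / s = e / 2" using e s by (auto simp: m_def)
  obtain R where R: "\<And>z. Im z \<le> 0 \<Longrightarrow> R \<le> norm z \<Longrightarrow> norm (F z) \<le> m"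
    using vanish[OF m(1)] by auto
  have holG: "G holomorphic_on lower"
    using dG by (auto simp: holomorphic_on_open[OF open_lower])
  have deep: "norm (G z) \<le> e / 2" if "Im z \<le> - s" "2 * R \<le> norm z" for z
  proof -
    have "norm (G z) \<le> 4 * m\<^sup>2 / (- Im z)" using that s by (intro decay[OF R]) auto
    also have "\<dots> \<le> 4 * m\<^sup>2 / s" using that s by (intro divide_left_mono mult_pos_pos) auto
    finally show ?thesis using m by simp
  qed
  show ?thesis
  proof (intro exI allI impI)
    fix z assume z: "Im z < 0 \<and> 2 * R \<le> norm z"
    show "norm (G z) \<le> e"
    proof (cases "Im z \<le> - s")
      case True
      then show ?thesis using deep[of z] z e by simp
    next
      case False
      define x y where "x = Re z" and "y = - Im z"
      have zy: "z = Complex x (- y)" "0 < y" "y < s"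
        using z False by (simp_all add: x_def y_def complex.collapse)
      have "norm z \<le> norm (Complex x (- s))" using zy by (simp add: cmod_def)
      then have 1: "norm (G (Complex x (- s))) \<le> e / 2" using z by (intro deep) auto
      have "norm (G (Complex x (- s)) - G (Complex x (- y))) \<le> 2 * C\<^sup>2 * sqrt s - 2 * C\<^sup>2 * sqrt y"
      proof (rule vertical_increment_bound[OF _ holG])
        show "continuous_on {z. Im z \<le> - y} G"
          using holomorphic_on_imp_continuous_on[OF holG]
          by (rule continuous_on_subset) (use zy in auto)
        show "continuous_on {y..s} (\<lambda>t. 2 * C\<^sup>2 * sqrt t)" by (intro continuous_intros)
        fix t assume t: "y < t" "t < s"
        then show "((\<lambda>t. 2 * C\<^sup>2 * sqrt t) has_real_derivative C\<^sup>2 * t powr (-1/2)) (at t)"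
          using zy by (auto intro!: derivative_eq_intros simp: powr_minus powr_half_sqrt field_simps)
        have "norm (deriv F (Complex x (- t))) \<le> C * t powr (-1/4)"
          using C(2) t zy s by simp
        then have "(norm (deriv F (Complex x (- t))))\<^sup>2 \<le> (C * t powr (-1/4))\<^sup>2"
          by (intro power_mono) auto
        also have "\<dots> = C\<^sup>2 * t powr (-1/2)"
          using t zy by (simp add: power_mult_distrib powr_power)
        finally show "norm (deriv G (Complex x (- t))) \<le> C\<^sup>2 * t powr (-1/2)"
          using dG[of "Complex x (- t)"] t zy by (simp add: DERIV_imp_deriv norm_power)
      qed (use zy in auto)
      also have "\<dots> \<le> e / 2" using Cs C zy by (simp add: diff_le_eq add_increasing2)
      finally show ?thesis
        using 1 norm_triangle_ineq2[of "G z" "G (Complex x (- s))"] zy(1)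
        by (simp add: norm_minus_commute)
    qed
  qed
qed

text \<open>Let \<open>q\<close> be the quantity to be estimated. Then \<open>q\<^sub>x = 2 A\<^sub>x (\<theta>\<^sub>x + \<kappa> sinh A)\<close> is
  \<open>O (y\<^bsup>-1/4\<^esup> y\<^bsup>1/2\<^esup>)\<close>, so \<open>q\<close> is nearly constant on compact parts of the line at depth \<open>y\<close>,
  and it is small far away.\<close>

lemma primitive_boundary_values:
  assumes dG: "\<And>z. Im z < 0 \<Longrightarrow> (G has_field_derivative (deriv F z)\<^sup>2) (at z)"
    and G0: "\<And>e. e > 0 \<Longrightarrow> \<exists>R. \<forall>z. Im z < 0 \<and> R \<le> norm z \<longrightarrow> norm (G z) \<le> e"
    and e: "e > 0"
  shows "\<exists>y0>0. \<forall>x y. 0 < y \<and> y < y0 \<longrightarrow>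
    \<bar>Im (G (Complex x (- y))) + 2 * \<kappa> * (cosh (Re (F (Complex x (- y)))) - 1)\<bar> \<le> e"
proof -
  define q where "q x y = Im (G (Complex x (- y))) + 2 * \<kappa> * (cosh (Re (F (Complex x (- y)))) - 1)" for x y
  obtain C where C: "C > 0"
    "\<And>x y. 0 < y \<Longrightarrow> y \<le> 1 \<Longrightarrow> norm (deriv F (Complex x (- y))) \<le> C * y powr (-1/4)"
    using deriv_growth_near_boundary by blast
  obtain D where D: "D > 0" "\<And>x y. 0 < y \<Longrightarrow> y \<le> 1 \<Longrightarrow>
       \<bar>Im (deriv F (Complex x (- y))) + \<kappa> * sinh (Re (F (Complex x (- y))))\<bar> \<le> D * sqrt y"
    using boundary_defect by blast
  let ?d = "\<lambda>x y. 2 * Re (deriv F (Complex x (- y))) *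
      (Im (deriv F (Complex x (- y))) + \<kappa> * sinh (Re (F (Complex x (- y)))))"
  have dq: "((\<lambda>x. q x y) has_real_derivative ?d x y) (at x)" if "y > 0" for x y
  proof -
    let ?z = "Complex x (- y)"
    have 1: "((\<lambda>t. Im (G (Complex t (- y)))) has_real_derivative Im ((deriv F ?z)\<^sup>2)) (at x)"
      by (rule horizontal_Im_derivative[OF dG]) (use that in simp)
    have 2: "((\<lambda>t. Re (F (Complex t (- y)))) has_real_derivative Re (deriv F ?z)) (at x)"
      by (rule horizontal_Re_derivative[OF has_deriv]) (use that in simp)
    show ?thesis unfolding q_def
      by (rule derivative_eq_intros 1 2 refl)+ (simp add: Im_power2 algebra_simps)
  qed
  have d_le: "\<bar>?d x y\<bar> \<le> 2 * C * D * y powr (1/4)" if y: "0 < y" "y \<le> 1" for x y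
  proof -
    have "\<bar>Re (deriv F (Complex x (- y)))\<bar> \<le> C * y powr (-1/4)"
      using C(2)[OF y, of x] abs_Re_le_cmod[of "deriv F (Complex x (- y))"] by simp
    then have "\<bar>?d x y\<bar> \<le> 2 * (C * y powr (-1/4)) * (D * sqrt y)"
      unfolding abs_mult using D(2)[OF y, of x] by (intro mult_mono) auto
    also have "\<dots> = 2 * C * D * (y powr (-1/4) * y powr (1/2))" using y by (simp add: powr_half_sqrt)
    also have "\<dots> = 2 * C * D * y powr (1/4)" by (simp flip: powr_add)
    finally show ?thesis .
  qed
  have "isCont cosh (0::real)" by (intro continuous_intros)
  then have "\<forall>r>0. \<exists>s>0. \<forall>t. norm (t - 0) < s \<longrightarrow> norm (cosh t - cosh (0::real)) < r"
    by (simp add: continuous_at_eps_delta dist_norm)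
  moreover have "e / (8 * \<kappa>) > 0" using e \<kappa>_pos by simp
  ultimately obtain s where s: "s > 0" "\<And>t::real. \<bar>t\<bar> < s \<Longrightarrow> \<bar>cosh t - 1\<bar> < e / (8 * \<kappa>)"
    by fastforce
  obtain R1 where R1: "\<And>z. Im z \<le> 0 \<Longrightarrow> R1 \<le> norm z \<Longrightarrow> norm (F z) \<le> s / 2"
    using vanish[of "s/2"] s by auto
  obtain R2 where R2: "\<And>z. Im z < 0 \<Longrightarrow> R2 \<le> norm z \<Longrightarrow> norm (G z) \<le> e / 4"
    using G0[of "e/4"] e by auto
  define R where "R = max 1 (max R1 R2)"
  have far: "\<bar>q x y\<bar> \<le> e / 2" if "y > 0" "R \<le> \<bar>x\<bar>" for x y
  proof -
    let ?z = "Complex x (- y)"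
    have z: "R1 \<le> norm ?z" "R2 \<le> norm ?z"
      using that abs_Re_le_cmod[of ?z] by (auto simp: R_def)
    have "\<bar>Im (G ?z)\<bar> \<le> e / 4" using R2[of ?z] abs_Im_le_cmod[of "G ?z"] z that by simp
    moreover have "\<bar>Re (F ?z)\<bar> < s" using R1[of ?z] abs_Re_le_cmod[of "F ?z"] z that s by simp
    from s(2)[OF this] have "2 * \<kappa> * \<bar>cosh (Re (F ?z)) - 1\<bar> \<le> e / 4"
      using \<kappa>_pos by (simp add: field_simps)
    then have "\<bar>2 * \<kappa> * (cosh (Re (F ?z)) - 1)\<bar> \<le> e / 4"
      using \<kappa>_pos by (simp add: abs_mult)
    ultimately show ?thesis unfolding q_def by linarith
  qed
  define c where "c = 2 * C * D * (2 * R)"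
  have cpos: "c > 0" using C D by (simp add: c_def R_def)
  define y0 where "y0 = min 1 ((e / (2 * c)) powr 4)"
  show ?thesis unfolding q_def[symmetric]
  proof (intro exI[of _ y0] conjI allI impI)
    show "y0 > 0" using e cpos by (simp add: y0_def)
    fix x y assume "0 < y \<and> y < y0"
    then have y: "0 < y" "y \<le> 1" "y < (e / (2 * c)) powr 4" by (auto simp: y0_def)
    show "\<bar>q x y\<bar> \<le> e"
    proof (cases "R \<le> \<bar>x\<bar>")
      case True
      then show ?thesis using far[OF y(1) True] e by simp
    next
      case False
      have "norm (q x y - q R y) \<le> 2 * C * D * y powr (1/4) * norm (x - R)"
        by (rule field_differentiable_bound[of UNIV])
           (use dq y(1) d_le[OF y(1,2)] in auto)
      also have "norm (x - R) \<le> 2 * R" using False by simp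
      also have "2 * C * D * y powr (1/4) * (2 * R) = c * y powr (1/4)" by (simp add: c_def)
      also have "y powr (1/4) \<le> ((e / (2 * c)) powr 4) powr (1/4)"
        using y by (intro powr_mono2) auto
      also have "\<dots> = e / (2 * c)" using e cpos by (subst powr_powr) simp
      finally have "\<bar>q x y - q R y\<bar> \<le> e / 2" using cpos C D by (simp add: mult_left_mono)
      moreover have "\<bar>q R y\<bar> \<le> e / 2" by (rule far[OF y(1) abs_ge_self])
      ultimately show ?thesis by linarith
    qed
  qed
qed

text \<open>If \<open>cosh A - 1\<close> were positive near \<open>a\<close>, then \<open>Im G\<close> would lie below a negative multiple of the bump
  function, up to an error \<open>e\<close>. At depth \<open>\<tau> r\<close> below \<open>a\<close> the bump contributes at least \<open>c / (4 \<tau>)\<close>,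
  while \<open>\<bar>G\<bar> \<le> c / (8 \<tau>)\<close> by its decay.\<close>

lemma Re_boundary_zero: "Re (F (of_real a)) = 0"
proof (rule ccontr)
  assume "Re (F (of_real a)) \<noteq> 0"
  define h where "h z = cosh (Re (F z)) - 1" for z
  have h_nonneg: "h z \<ge> 0" for z by (simp add: h_def cosh_real_ge_1)
  have ha: "h (of_real a) > 0"
    using \<open>Re (F (of_real a)) \<noteq> 0\<close> cosh_real_strict_mono[of 0 "\<bar>Re (F (of_real a))\<bar>"]
    by (simp add: h_def cosh_real_abs)
  obtain G where dG: "\<And>z. Im z < 0 \<Longrightarrow> (G has_field_derivative (deriv F z)\<^sup>2) (at z)"
    and decay: "\<And>R m z. (\<And>z. Im z \<le> 0 \<Longrightarrow> R \<le> norm z \<Longrightarrow> norm (F z) \<le> m) \<Longrightarrow>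
        Im z < 0 \<Longrightarrow> 2 * R \<le> norm z \<Longrightarrow> norm (G z) \<le> 4 * m\<^sup>2 / (- Im z)"
    using squared_deriv_primitive by metis
  have G0: "\<exists>R. \<forall>z. Im z < 0 \<and> R \<le> norm z \<longrightarrow> norm (G z) \<le> e" if "e > 0" for e
    by (rule primitive_vanishes_at_infinity[OF dG decay that])
  define h0 where "h0 = h (of_real a) / 2"
  have h0: "h0 > 0" using ha by (simp add: h0_def)
  have "continuous_on lower_closed h"
    unfolding h_def by (intro continuous_intros cont)
  then obtain \<rho> where \<rho>: "\<rho> > 0"
    "\<And>z. Im z \<le> 0 \<Longrightarrow> dist z (of_real a) < \<rho> \<Longrightarrow> dist (h z) (h (of_real a)) < h0"
    unfolding continuous_on_iff using h0 by force
  have near: "h z \<ge> h0" if "Im z \<le> 0" "norm (z - of_real a) < \<rho>" for z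
  proof -
    have "\<bar>h z - h (of_real a)\<bar> < h0" using \<rho>(2)[of z] that by (simp add: dist_norm)
    then show ?thesis unfolding h0_def by linarith
  qed
  define r where "r = \<rho> / 8"
  have r: "r > 0" using \<rho> by (simp add: r_def)
  define c where "c = 2 * \<kappa> * h0"
  have c: "c > 0" using \<kappa>_pos h0 by (simp add: c_def)
  define m where "m = sqrt (c * r / 32)"
  have m: "m > 0" "4 * m\<^sup>2 = c * r / 8" using c r by (auto simp: m_def)
  obtain R where R: "\<And>z. Im z \<le> 0 \<Longrightarrow> R \<le> norm z \<Longrightarrow> norm (F z) \<le> m"
    using vanish[OF m(1)] by auto
  define \<tau> where "\<tau> = max 1 (2 * R / r)"
  have \<tau>: "\<tau> \<ge> 1" "2 * R \<le> \<tau> * r" using r by (auto simp: \<tau>_def field_simps max_def)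
  \<comment> \<open>This error is smaller than the gap between \<open>c / (4 \<tau>)\<close> and \<open>c / (8 \<tau>)\<close>.\<close>
  define e where "e = c / (16 * \<tau>)"
  have e: "e > 0" using c \<tau> by (simp add: e_def)
  have "\<exists>y0>0. \<forall>x y. 0 < y \<and> y < y0 \<longrightarrow>
      \<bar>Im (G (Complex x (- y))) + 2 * \<kappa> * h (Complex x (- y))\<bar> \<le> e"
    unfolding h_def by (rule primitive_boundary_values[OF dG G0 e])
  then obtain y0 where y0: "y0 > 0" "\<And>x y. 0 < y \<Longrightarrow> y < y0 \<Longrightarrow>
      \<bar>Im (G (Complex x (- y))) + 2 * \<kappa> * h (Complex x (- y))\<bar> \<le> e"
    by (elim exE conjE) simp
  \<comment> \<open>The comparison is made for \<open>G\<close> shifted down by \<open>y\<close>, since \<open>G\<close> is defined only inside.\<close>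
  define y where "y = min (y0 / 2) r"
  have y: "0 < y" "y < y0" "y \<le> r" using y0 r by (auto simp: y_def)
  let ?p = "\<lambda>\<zeta>. 1 / (1 + \<i> * \<zeta>) - 1 / (2 * (4 + \<i> * \<zeta>)) :: complex"
  let ?f = "\<lambda>z. - \<i> * G (z - \<i> * of_real y) + of_real c * ?p ((z - of_real a) / of_real r)"
  let ?z = "Complex a (- \<tau> * r)"
  have holG: "G holomorphic_on lower"
    using dG by (auto simp: holomorphic_on_open[OF open_lower])
  have contp: "continuous_on lower_closed (\<lambda>z. ?p ((z - of_real a) / of_real r))"
    by (rule continuous_on_compose2[OF half_plane_bump_continuous])
       (use r in \<open>auto intro!: continuous_intros simp: divide_nonpos_pos\<close>)
  have "?p \<circ> (\<lambda>z. (z - of_real a) / of_real r) holomorphic_on lower"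
    by (rule holomorphic_on_compose_gen[OF _ half_plane_bump_holomorphic])
       (use r in \<open>auto intro!: holomorphic_intros simp: divide_neg_pos\<close>)
  then have holp: "(\<lambda>z. ?p ((z - of_real a) / of_real r)) holomorphic_on lower" by (simp add: o_def)
  have contG: "continuous_on lower_closed (\<lambda>z. G (z - \<i> * of_real y))"
    by (rule continuous_on_compose2[OF holomorphic_on_imp_continuous_on[OF holG]])
       (use y in \<open>auto intro!: continuous_intros\<close>)
  have "G \<circ> (\<lambda>z. z - \<i> * of_real y) holomorphic_on lower"
    by (rule holomorphic_on_compose_gen[OF _ holG])
       (use y in \<open>auto intro!: holomorphic_intros\<close>)
  then have holG': "(\<lambda>z. G (z - \<i> * of_real y)) holomorphic_on lower" by (simp add: o_def)
  have "Re (?f ?z) \<le> e"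
  proof (rule lower_maximum_real_at_infinity[where f = ?f])
    show "continuous_on lower_closed ?f"
      by (intro continuous_on_add continuous_on_mult continuous_on_const contG contp)
    show "?f holomorphic_on lower"
      by (intro holomorphic_on_add holomorphic_on_mult holomorphic_on_const holG' holp)
    show "Im ?z \<le> 0" using r \<tau> by simp
  next
    fix x :: real
    define s where "s = (x - a) / r"
    have "(of_real x - of_real a) / of_real r = complex_of_real s" by (simp add: s_def)
    moreover have "complex_of_real x - \<i> * of_real y = Complex x (- y)" by (simp add: complex_eq_iff)
    ultimately have "Re (?f (of_real x))
        = Im (G (Complex x (- y))) + c * (1 / (1 + s\<^sup>2) - 2 / (16 + s\<^sup>2))"
      using half_plane_bump_boundary[of s] by (simp del: minus_divide_left)
    also have "c * (1 / (1 + s\<^sup>2) - 2 / (16 + s\<^sup>2)) \<le> 2 * \<kappa> * h (Complex x (- y))"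
    proof (cases "\<bar>s\<bar> < 4")
      case True
      have "norm (Complex x (- y) - of_real a) \<le> \<bar>x - a\<bar> + y"
        using norm_triangle_ineq4[of "of_real (x - a)" "\<i> * of_real y"] y
        by (simp add: Complex_eq norm_mult del: of_real_diff) (simp add: algebra_simps)
      also have "\<bar>x - a\<bar> < 4 * r" using True r by (simp add: s_def abs_divide field_simps)
      finally have "h (Complex x (- y)) \<ge> h0" using y r by (intro near) (auto simp: r_def)
      moreover have "1 / (1 + s\<^sup>2) - 2 / (16 + s\<^sup>2) \<le> 1 - 0"
        by (intro diff_mono) (auto simp: divide_le_eq add_pos_nonneg)
      then have "c * (1 / (1 + s\<^sup>2) - 2 / (16 + s\<^sup>2)) \<le> c * 1" using c by (intro mult_left_mono) auto
      ultimately show ?thesis using \<kappa>_pos by (simp add: c_def)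
    next
      case False
      then have "4\<^sup>2 \<le> s\<^sup>2" unfolding abs_le_square_iff[symmetric] by simp
      then have "1 / (1 + s\<^sup>2) - 2 / (16 + s\<^sup>2) \<le> 0"
        by (simp add: divide_simps add_pos_nonneg not_less)
      then have "c * (1 / (1 + s\<^sup>2) - 2 / (16 + s\<^sup>2)) \<le> 0" using c by (simp add: mult_nonneg_nonpos)
      also have "0 \<le> 2 * \<kappa> * h (Complex x (- y))" using \<kappa>_pos h_nonneg by simp
      finally show ?thesis .
    qed
    also have "Im (G (Complex x (- y))) + 2 * \<kappa> * h (Complex x (- y)) \<le> e"
      using y0(2)[OF y(1,2), of x] by simp
    finally show "Re (?f (of_real x)) \<le> e" by simp
  next
    fix \<epsilon> :: real assume \<epsilon>: "\<epsilon> > 0"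
    obtain R2 where R2: "\<And>z. Im z < 0 \<Longrightarrow> R2 \<le> norm z \<Longrightarrow> norm (G z) \<le> \<epsilon> / 2"
      using G0[of "\<epsilon> / 2"] \<epsilon> by auto
    define N where "N = Max {R2 + y, \<bar>a\<bar> + 8 * r, \<bar>a\<bar> + 6 * c * r / \<epsilon>}"
    show "\<exists>R. \<forall>z. Im z \<le> 0 \<and> R \<le> norm z \<longrightarrow> Re (?f z) \<le> e + \<epsilon>"
    proof (intro exI allI impI)
      fix z assume "Im z \<le> 0 \<and> N \<le> norm z"
      then have z: "Im z \<le> 0" "R2 + y \<le> norm z" "\<bar>a\<bar> + 8 * r \<le> norm z"
        "\<bar>a\<bar> + 6 * c * r / \<epsilon> \<le> norm z" by (auto simp: N_def)
      have "norm z - y \<le> norm (z - \<i> * of_real y)"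
        using norm_triangle_ineq2[of z "\<i> * of_real y"] y by (simp add: norm_mult)
      then have 1: "norm (G (z - \<i> * of_real y)) \<le> \<epsilon> / 2"
        using z y by (intro R2) auto
      let ?\<zeta> = "(z - of_real a) / of_real r"
      have "norm z - \<bar>a\<bar> \<le> norm (z - of_real a)"
        using norm_triangle_ineq2[of z "of_real a"] by simp
      then have \<zeta>: "norm ?\<zeta> \<ge> (norm z - \<bar>a\<bar>) / r" using r by (simp add: norm_divide divide_right_mono)
      moreover have "(norm z - \<bar>a\<bar>) / r \<ge> 8" "(norm z - \<bar>a\<bar>) / r \<ge> 6 * c / \<epsilon>"
        using z r by (simp_all add: field_simps)
      ultimately have \<zeta>8: "norm ?\<zeta> \<ge> 8" and \<zeta>c: "norm ?\<zeta> \<ge> 6 * c / \<epsilon>" by linarith+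
      have "norm (?p ?\<zeta>) \<le> 3 / norm ?\<zeta>" by (rule half_plane_bump_decay[OF \<zeta>8])
      also have "\<dots> \<le> 3 / (6 * c / \<epsilon>)"
        using \<zeta>c \<zeta>8 c \<epsilon> by (intro divide_left_mono mult_pos_pos) auto
      also have "\<dots> = \<epsilon> / (2 * c)" using c \<epsilon> by simp
      finally have "c * norm (?p ?\<zeta>) \<le> c * (\<epsilon> / (2 * c))" using c by (intro mult_left_mono) auto
      then have 2: "c * norm (?p ?\<zeta>) \<le> \<epsilon> / 2" using c by simp
      have "Re (?f z) \<le> norm (?f z)" by (rule complex_Re_le_cmod)
      also have "\<dots> \<le> norm (- \<i> * G (z - \<i> * of_real y)) + norm (of_real c * ?p ?\<zeta>)"
        by (rule norm_triangle_ineq)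
      also have "\<dots> = norm (G (z - \<i> * of_real y)) + c * norm (?p ?\<zeta>)"
        unfolding norm_mult using c by simp
      finally show "Re (?f z) \<le> e + \<epsilon>" using 1 2 e by linarith
    qed
  qed
  moreover have "(?z - of_real a) / of_real r = Complex 0 (- \<tau>)"
    using r by (simp add: complex_eq_iff Re_divide Im_divide power2_eq_square)
  then have "c * (1 / (2 * (1 + \<tau>))) \<le> c * Re (?p ((?z - of_real a) / of_real r))"
    using half_plane_bump_axis[of \<tau>] \<tau> c by (intro mult_left_mono) auto
  moreover have "Re (?f ?z) = Im (G (?z - \<i> * of_real y)) + c * Re (?p ((?z - of_real a) / of_real r))"
    by simp
  moreover have "norm (G (?z - \<i> * of_real y)) \<le> c / (8 * \<tau>)"
  proof -
    let ?w = "?z - \<i> * of_real y"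
    have w: "\<tau> * r \<le> - Im ?w" using y by simp
    have p: "0 < \<tau> * r" using \<tau> r by simp
    have "2 * R \<le> norm ?w" using w \<tau> abs_Im_le_cmod[of ?w] by linarith
    then have "norm (G ?w) \<le> 4 * m\<^sup>2 / (- Im ?w)" using w p by (intro decay[OF R]) auto
    also have "\<dots> \<le> 4 * m\<^sup>2 / (\<tau> * r)" using w less_le_trans[OF p w] p by (intro divide_left_mono mult_pos_pos[of "- Im ?w" "\<tau> * r"]) auto
    also have "\<dots> = c / (8 * \<tau>)" unfolding m(2) using r \<tau> by (simp add: field_simps)
    finally show ?thesis .
  qed
  then have "- (c / (8 * \<tau>)) \<le> Im (G (?z - \<i> * of_real y))"
    using abs_Im_le_cmod[of "G (?z - \<i> * of_real y)"] by linarith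
  moreover have "c / (4 * \<tau>) \<le> c * (1 / (2 * (1 + \<tau>)))"
    using \<tau> c by (simp add: field_simps)
  moreover have "c / (4 * \<tau>) - c / (8 * \<tau>) > c / (16 * \<tau>)"
    using \<tau> c by (simp add: field_simps)
  ultimately show False by (simp only: e_def)
qed

theorem boundary_zero: "F (of_real x) = 0"
proof -
  let ?\<theta> = "\<lambda>x. Im (F (of_real x))"
  have "(?\<theta> has_real_derivative 0) (at x)" for x
    using boundary[of x] by (simp add: Re_boundary_zero)
  then have const: "?\<theta> x = ?\<theta> y" for x y
    using DERIV_isconst_all by blast
  have "\<bar>?\<theta> x\<bar> \<le> e" if e: "e > 0" for e
  proof -
    obtain R where R: "\<And>z. Im z \<le> 0 \<Longrightarrow> R \<le> norm z \<Longrightarrow> norm (F z) \<le> e"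
      using vanish[OF e] by auto
    have "norm (F (of_real \<bar>R\<bar>)) \<le> e" by (rule R) auto
    then have "\<bar>?\<theta> (\<bar>R\<bar>)\<bar> \<le> e"
      using abs_Im_le_cmod[of "F (of_real \<bar>R\<bar>)"] by linarith
    then show ?thesis using const[of x "\<bar>R\<bar>"] by simp
  qed
  then have "\<bar>?\<theta> x\<bar> \<le> 0" using field_le_epsilon[of "\<bar>?\<theta> x\<bar>" 0] by simp
  then show ?thesis using Re_boundary_zero[of x] by (simp add: complex_eq_iff)
qed

end

section \<open>Weak derivatives of continuous functions\<close>

lemma smoothI:
  assumes "\<And>x. f field_differentiable at x" "smooth (deriv f)"
  shows "smooth f"
  unfolding smooth_def
proof (intro allI)
  fix n x
  show "(deriv ^^ n) f field_differentiable at x"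
    using assms by (cases n) (auto simp: smooth_def funpow_Suc_right simp del: funpow.simps(2))
qed

lemma smooth_field_differentiable: "smooth f \<Longrightarrow> f field_differentiable at x"
  unfolding smooth_def by (metis funpow_0)

lemma smooth_has_derivative: "smooth f \<Longrightarrow> (f has_real_derivative deriv f x) (at x)"
  by (simp add: DERIV_deriv_iff_field_differentiable smooth_field_differentiable)

lemma smooth_deriv: "smooth f \<Longrightarrow> smooth (deriv f)"
  unfolding smooth_def by (metis funpow_Suc_right o_apply)

lemma smooth_continuous_on: "smooth f \<Longrightarrow> continuous_on A f"
  using smooth_has_derivative by (meson DERIV_isCont continuous_at_imp_continuous_on)

text \<open>Smoothness by coinduction: membership in a class of differentiable functions that is closed
  under taking derivatives.\<close>

lemma smooth_induct_closed:
  assumes "f \<in> S" and diff: "\<And>f x. f \<in> S \<Longrightarrow> f field_differentiable at x"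
    and deriv: "\<And>f. f \<in> S \<Longrightarrow> deriv f \<in> S"
  shows "smooth f"
proof -
  have "(deriv ^^ n) f \<in> S" for n
    by (induction n) (use assms in auto)
  then show ?thesis unfolding smooth_def using diff by blast
qed

text \<open>The class is that of finite sums of products of smooth functions. The sums are indexed by
  sets of naturals; the derivative doubles the index set, even indices carrying the derivative
  of the first factor and odd ones that of the second.\<close>

lemma smooth_square:
  assumes "smooth f"
  shows "smooth (\<lambda>x. f x * f x)"
proof (rule smooth_induct_closed)
  define S where "S = {h. \<exists>(I :: nat set) a b. finite I \<and> (\<forall>i. smooth (a i) \<and> smooth (b i)) \<and>
    h = (\<lambda>x. \<Sum>i\<in>I. a i x * b i x)}"
  show "(\<lambda>x. f x * f x) \<in> S"
    unfolding S_def by (intro CollectI exI[of _ "{0}"] exI[of _ "\<lambda>_. f"]) (use assms in auto)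
  have der: "((\<lambda>x. \<Sum>i\<in>I. a i x * b i x) has_real_derivative
      (\<Sum>i\<in>I. deriv (a i) x * b i x + deriv (b i) x * a i x)) (at x)"
    if "finite I" "\<forall>i. smooth (a i) \<and> smooth (b i)" for I :: "nat set" and a b :: "nat \<Rightarrow> real \<Rightarrow> real" and x
    using that by (intro DERIV_sum DERIV_mult smooth_has_derivative) auto
  show "h field_differentiable at x" if "h \<in> S" for h x
    using that der unfolding S_def field_differentiable_def by blast
  show "deriv h \<in> S" if hS: "h \<in> S" for h
  proof -
    obtain I :: "nat set" and a b where I: "finite I" "\<forall>i. smooth (a i) \<and> smooth (b i)"
      and h: "h = (\<lambda>x. \<Sum>i\<in>I. a i x * b i x)" using hS unfolding S_def by blast
    define a' where "a' j = (if even j then deriv (a (j div 2)) else deriv (b (j div 2)))" for j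
    define b' where "b' j = (if even j then b (j div 2) else a (j div 2))" for j
    define J where "J = (\<lambda>i. 2 * i) ` I \<union> (\<lambda>i. 2 * i + 1) ` I"
    have "deriv h x = (\<Sum>j\<in>J. a' j x * b' j x)" for x
    proof -
      have "(\<Sum>j\<in>J. a' j x * b' j x)
          = (\<Sum>j\<in>(\<lambda>i. 2 * i) ` I. a' j x * b' j x) + (\<Sum>j\<in>(\<lambda>i. 2 * i + 1) ` I. a' j x * b' j x)"
        unfolding J_def using I by (intro sum.union_disjoint) (auto, presburger)
      also have "\<dots> = (\<Sum>i\<in>I. deriv (a i) x * b i x) + (\<Sum>i\<in>I. deriv (b i) x * a i x)"
        by (subst (1 2) sum.reindex) (auto simp: inj_on_def a'_def b'_def)
      finally show ?thesis using der[OF I, of x] by (simp add: h DERIV_imp_deriv sum.distrib)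
    qed
    then have "deriv h = (\<lambda>x. \<Sum>j\<in>J. a' j x * b' j x)" by blast
    moreover have "finite J" using I by (simp add: J_def)
    moreover have "\<forall>j. smooth (a' j) \<and> smooth (b' j)"
      using I by (auto simp: a'_def b'_def smooth_deriv)
    ultimately show ?thesis unfolding S_def by blast
  qed
qed

lemma smooth_affine_combination:
  assumes "smooth f"
  shows "smooth (\<lambda>x. p * f (r * x + s) + q * f (r * x + t))"
proof (rule smooth_induct_closed)
  define S where "S = {h. \<exists>p q f. smooth f \<and> h = (\<lambda>x. p * f (r * x + s) + q * f (r * x + t))}"
  show "(\<lambda>x. p * f (r * x + s) + q * f (r * x + t)) \<in> S"
    unfolding S_def using assms by blast
  have der: "((\<lambda>x. p * f (r * x + s) + q * f (r * x + t)) has_real_derivative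
      (p * r) * deriv f (r * x + s) + (q * r) * deriv f (r * x + t)) (at x)"
    if "smooth f" for p q f x
  proof -
    have "((\<lambda>x. f (r * x + u)) has_real_derivative deriv f (r * x + u) * r) (at x)" for u
      by (rule DERIV_chain2[OF smooth_has_derivative[OF that]]) (auto intro!: derivative_eq_intros)
    from DERIV_add[OF DERIV_cmult[OF this] DERIV_cmult[OF this]] show ?thesis
      by (simp add: ac_simps)
  qed
  show "h field_differentiable at x" if "h \<in> S" for h x
    using that der unfolding S_def field_differentiable_def by blast
  show "deriv h \<in> S" if "h \<in> S" for h
  proof -
    obtain p q f where f: "smooth f" and h: "h = (\<lambda>x. p * f (r * x + s) + q * f (r * x + t))"
      using \<open>h \<in> S\<close> unfolding S_def by blast
    have "deriv h = (\<lambda>x. (p * r) * deriv f (r * x + s) + (q * r) * deriv f (r * x + t))"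
      unfolding h by (rule ext, rule DERIV_imp_deriv, rule der[OF f])
    then show ?thesis unfolding S_def using smooth_deriv[OF f] by blast
  qed
qed

lemma test_functionI:
  assumes "smooth \<theta>" "\<And>x. b < \<bar>x\<bar> \<Longrightarrow> \<theta> x = 0"
  shows "test_function \<theta>"
proof -
  have "{x. \<theta> x \<noteq> 0} \<subseteq> {-b..b}" using assms(2) by (force simp: abs_le_iff not_less[symmetric])
  then have "bounded {x. \<theta> x \<noteq> 0}" using bounded_subset bounded_closed_interval by blast
  then show ?thesis using assms(1) by (simp add: test_function_def compact_closure)
qed

lemma test_function_support:
  assumes "test_function \<theta>"
  obtains b where "b > 0" "\<And>x. b < \<bar>x\<bar> \<Longrightarrow> \<theta> x = 0" "\<And>x. b < \<bar>x\<bar> \<Longrightarrow> deriv \<theta> x = 0"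
proof -
  have "bounded (closure {x. \<theta> x \<noteq> 0})"
    using assms compact_imp_bounded unfolding test_function_def by blast
  then obtain b where "b > 0" "\<forall>x\<in>closure {x. \<theta> x \<noteq> 0}. norm x \<le> b"
    unfolding bounded_pos by blast
  then have b: "b > 0" "\<And>x. b < \<bar>x\<bar> \<Longrightarrow> \<theta> x = 0"
    using closure_subset[of "{x. \<theta> x \<noteq> 0}"] by force+
  have "deriv \<theta> x = 0" if "b < \<bar>x\<bar>" for x
  proof -
    have "open {x::real. b < \<bar>x\<bar>}" by (intro open_Collect_less continuous_intros)
    then have "eventually (\<lambda>y. b < \<bar>y\<bar>) (nhds x)"
      using that eventually_nhds by (metis (mono_tags, lifting) mem_Collect_eq)
    then have "eventually (\<lambda>y. \<theta> y = 0) (nhds x)" by eventually_elim (rule b)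
    then have "deriv \<theta> x = deriv (\<lambda>_. 0) x" by (intro deriv_cong_ev) auto
    then show ?thesis by simp
  qed
  with b that show thesis by blast
qed

lemma continuous_compact_support_eq_indicator:
  fixes f :: "real \<Rightarrow> 'a::real_vector"
  assumes "\<And>x. b < \<bar>x\<bar> \<Longrightarrow> f x = 0"
  shows "(\<lambda>x. indicator {-b..b} x *\<^sub>R f x) = f"
  using assms by (auto simp: indicator_def fun_eq_iff not_le[symmetric] abs_le_iff)

lemma integrable_compact_support:
  fixes f :: "real \<Rightarrow> complex"
  assumes "continuous_on UNIV f" "\<And>x. b < \<bar>x\<bar> \<Longrightarrow> f x = 0"
  shows "integrable lborel f"
  using borel_integrable_compact[of "{-b..b}" f] continuous_on_subset[OF assms(1)]
    continuous_compact_support_eq_indicator[OF assms(2)] by auto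

lemma integral_derivative_compact_support:
  fixes h :: "real \<Rightarrow> complex"
  assumes "\<And>x. (h has_vector_derivative h' x) (at x)" "continuous_on UNIV h'"
    "\<And>x. b < \<bar>x\<bar> \<Longrightarrow> h x = 0" "\<And>x. b < \<bar>x\<bar> \<Longrightarrow> h' x = 0"
  shows "(LINT x|lborel. h' x) = 0"
proof -
  define c where "c = \<bar>b\<bar> + 1"
  have c: "\<And>x. c < \<bar>x\<bar> \<Longrightarrow> h' x = 0" using assms(4) by (simp add: c_def)
  have "(LINT x|lborel. indicator {-c..c} x *\<^sub>R h' x) = h c - h (- c)"
    using assms(1,2) by (intro integral_FTC_Icc)
      (auto simp: c_def intro: has_vector_derivative_at_within continuous_on_subset)
  also have "\<dots> = 0" using assms(3)[of c] assms(3)[of "- c"] by (simp add: c_def)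
  finally show ?thesis by (subst (asm) continuous_compact_support_eq_indicator[OF c])
qed

lemma dist_of_diff:
  assumes "continuous_on UNIV f" "continuous_on UNIV g" "continuous_on UNIV \<theta>"
    "\<And>x. b < \<bar>x\<bar> \<Longrightarrow> \<theta> x = 0"
  shows "dist_of (\<lambda>x. f x - g x) \<theta> = dist_of f \<theta> - dist_of g \<theta>"
  unfolding dist_of_def left_diff_distrib
  by (rule Bochner_Integration.integral_diff;
      rule integrable_compact_support[where b = b]; use assms in \<open>auto intro!: continuous_intros\<close>)

lemma continuous_antiderivative:
  fixes g :: "real \<Rightarrow> 'a::euclidean_space"
  assumes "continuous_on UNIV g"
  obtains G where "\<And>x. (G has_vector_derivative g x) (at x)"
proof -
  have "\<exists>F. \<forall>x::real. - \<infinity> < ereal x \<longrightarrow> ereal x < \<infinity> \<longrightarrow> (F has_vector_derivative g x) (at x)"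
    by (rule einterval_antiderivative) (use assms in \<open>auto simp: continuous_on_eq_continuous_at\<close>)
  then show thesis using that by auto
qed

text \<open>Averages of \<open>V\<close> against a bump shrinking to the point \<open>t\<close>.\<close>

lemma integral_rescaled_limit:
  fixes V :: "real \<Rightarrow> complex" and \<psi> :: "real \<Rightarrow> real"
  assumes V: "continuous_on UNIV V" and \<psi>: "continuous_on UNIV \<psi>" "\<And>x. b < \<bar>x\<bar> \<Longrightarrow> \<psi> x = 0"
  shows "(\<lambda>n. LINT u|lborel. V (t + u / real (Suc n)) * of_real (\<psi> u))
     \<longlonglongrightarrow> V t * of_real (LINT u|lborel. \<psi> u)"
proof -
  obtain M where M: "\<And>x. x \<in> {t-b..t+b} \<Longrightarrow> norm (V x) \<le> M"
  proof -
    have "compact (V ` {t-b..t+b})"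
      by (intro compact_continuous_image continuous_on_subset[OF V]) auto
    then have "bounded (V ` {t-b..t+b})" by (rule compact_imp_bounded)
    then obtain a where "\<forall>y\<in>V ` {t-b..t+b}. norm y \<le> a" unfolding bounded_iff by blast
    then show thesis using that[of a] by blast
  qed
  have int\<psi>: "integrable lborel (\<lambda>u. complex_of_real (\<psi> u))"
    using \<psi> by (intro integrable_compact_support[where b = b] continuous_intros) auto
  have "(\<lambda>n. LINT u|lborel. V (t + u / real (Suc n)) * of_real (\<psi> u))
     \<longlonglongrightarrow> (LINT u|lborel. V t * of_real (\<psi> u))"
  proof (rule integral_dominated_convergence[where w = "\<lambda>u. M * norm (complex_of_real (\<psi> u))"])
    show "integrable lborel (\<lambda>u. M * norm (complex_of_real (\<psi> u)))"
      using int\<psi> by (intro integrable_mult_right integrable_norm)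
    show "AE u in lborel. (\<lambda>n. V (t + u / real (Suc n)) * of_real (\<psi> u)) \<longlonglongrightarrow> V t * of_real (\<psi> u)"
    proof (rule AE_I2)
      fix u :: real
      have "(\<lambda>n. t + u * inverse (real (Suc n))) \<longlonglongrightarrow> t + u * 0"
        by (intro tendsto_intros LIMSEQ_inverse_real_of_nat)
      then have "(\<lambda>n. t + u / real (Suc n)) \<longlonglongrightarrow> t" by (simp add: divide_inverse)
      moreover have "isCont V t" using V by (simp add: continuous_on_eq_continuous_at)
      ultimately have "(\<lambda>n. V (t + u / real (Suc n))) \<longlonglongrightarrow> V t"
        by (rule isCont_tendsto_compose[rotated])
      then show "(\<lambda>n. V (t + u / real (Suc n)) * of_real (\<psi> u)) \<longlonglongrightarrow> V t * of_real (\<psi> u)"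
        by (intro tendsto_intros)
    qed
    show "AE u in lborel. norm (V (t + u / real (Suc n)) * of_real (\<psi> u))
        \<le> M * norm (complex_of_real (\<psi> u))" for n
    proof (rule AE_I2)
      fix u :: real
      show "norm (V (t + u / real (Suc n)) * of_real (\<psi> u)) \<le> M * norm (complex_of_real (\<psi> u))"
      proof (cases "b < \<bar>u\<bar>")
        case False
        have "\<bar>u / real (Suc n)\<bar> \<le> \<bar>u\<bar>"
          by (simp add: abs_divide divide_le_eq mult_le_cancel_left1)
        with False have "t + u / real (Suc n) \<in> {t-b..t+b}" unfolding atLeastAtMost_iff by linarith
        then show ?thesis unfolding norm_mult by (intro mult_right_mono M) auto
      qed (simp add: \<psi>(2))
    qed
    have [measurable]: "V \<in> borel_measurable borel" "\<psi> \<in> borel_measurable borel"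
      using V \<psi> by (auto intro: borel_measurable_continuous_onI)
    show "(\<lambda>u. V (t + u / real (Suc n)) * of_real (\<psi> u)) \<in> borel_measurable lborel" for n
      by measurable
    show "(\<lambda>u. V t * of_real (\<psi> u)) \<in> borel_measurable lborel" by measurable
  qed
  then show ?thesis by simp
qed

text \<open>The Littlewood-Paley function itself provides a nontrivial smooth function of compact
  support. It may change sign, so its square is taken to have nonzero integral.\<close>

lemma littlewood_paley_bump:
  assumes "littlewood_paley \<phi>"
  obtains \<psi> b where "smooth \<psi>" "b > 0" "\<And>x. b < \<bar>x\<bar> \<Longrightarrow> \<psi> x = 0" "(LINT u|lborel. \<psi> u) \<noteq> 0"
proof -
  obtain b where sm: "smooth \<phi>" and supp: "\<And>x. \<phi> x \<noteq> 0 \<Longrightarrow> \<bar>x\<bar> \<le> b"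
    using assms unfolding littlewood_paley_def by blast
  have "((\<lambda>k::int. \<phi> (1 / 2 powi k)) has_sum 1) UNIV"
    using assms unfolding littlewood_paley_def by simp
  then obtain x0 where x0: "\<phi> x0 \<noteq> 0"
    by (metis (full_types) has_sum_0 has_sum_unique zero_neq_one)
  let ?\<psi> = "\<lambda>x. \<phi> x * \<phi> x"
  define c where "c = \<bar>b\<bar> + 1"
  have sm\<psi>: "smooth ?\<psi>" by (rule smooth_square[OF sm])
  have supp\<psi>: "?\<psi> x = 0" if "c < \<bar>x\<bar>" for x using supp[of x] that abs_ge_self[of b] by (cases "\<phi> x = 0") (auto simp: c_def)
  have "(LINT u|lborel. ?\<psi> u) = (LINT u|lborel. indicator {-c..c} u *\<^sub>R ?\<psi> u)"
    by (subst continuous_compact_support_eq_indicator) (use supp\<psi> in auto)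
  also have "\<dots> = (LINT u:{-c..c}|lborel. ?\<psi> u)" by (simp add: set_lebesgue_integral_def)
  also have "\<dots> = integral {-c..c} ?\<psi>"
    by (rule set_borel_integral_eq_integral)
       (auto intro!: borel_integrable_atLeastAtMost' smooth_continuous_on sm\<psi>)
  also have "\<dots> \<noteq> 0"
  proof -
    have "x0 \<in> {-c..c}" using supp[OF x0] by (auto simp: c_def)
    moreover have "integral {-c..c} ?\<psi> = 0 \<longleftrightarrow> (\<forall>x\<in>{-c..c}. ?\<psi> x = 0)"
      by (rule integral_eq_0_iff) (auto simp: c_def intro: smooth_continuous_on[OF sm\<psi>])
    ultimately show ?thesis using x0 by force
  qed
  finally show thesis using that[OF sm\<psi>, of c] supp\<psi> by (simp add: c_def)
qed

text \<open>The difference of two translates of a rescaled bump is the derivative of a test function,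
  namely of the difference of the translates of its primitive \<open>\<Psi>\<close>. So the averages of \<open>V\<close> near
  \<open>s\<close> and near \<open>t\<close> agree at every scale.\<close>

lemma constant_of_weak_derivative_zero:
  fixes V :: "real \<Rightarrow> complex"
  assumes \<psi>: "smooth \<psi>" "b > 0" "\<And>x. b < \<bar>x\<bar> \<Longrightarrow> \<psi> x = 0" "(LINT u|lborel. \<psi> u) \<noteq> 0"
    and V: "continuous_on UNIV V"
    and weak: "\<And>\<theta>. test_function \<theta> \<Longrightarrow> dist_of V (deriv \<theta>) = 0"
  shows "V s = V t"
proof -
  obtain \<Psi> where "\<And>x. (\<Psi> has_vector_derivative \<psi> x) (at x)"
    using continuous_antiderivative[OF smooth_continuous_on[OF \<psi>(1)]] by blast
  then have d\<Psi>: "(\<Psi> has_real_derivative \<psi> x) (at x)" for x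
    by (simp add: has_real_derivative_iff_has_vector_derivative)
  then have deriv\<Psi>: "deriv \<Psi> = \<psi>" by (intro ext DERIV_imp_deriv)
  have sm\<Psi>: "smooth \<Psi>"
    by (rule smoothI) (use d\<Psi> \<psi> deriv\<Psi> in \<open>auto simp: field_differentiable_def\<close>)
  have d0: "(\<Psi> has_real_derivative 0) (at y within S)" if "b < \<bar>y\<bar>" for y S
    using d\<Psi>[of y] \<psi>(3)[OF that] by (auto intro: has_field_derivative_at_within)
  have "\<exists>c. \<forall>y\<in>{b<..}. \<Psi> y = c"
    using \<psi>(2) by (intro has_field_derivative_zero_constant d0) (auto simp: convex_real_interval)
  then have right: "\<Psi> x = \<Psi> (b + 1)" if "x \<ge> b + 1" for x
    using that by force
  have "\<exists>c. \<forall>y\<in>{..<- b}. \<Psi> y = c"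
    using \<psi>(2) by (intro has_field_derivative_zero_constant d0) (auto simp: convex_real_interval)
  then have left: "\<Psi> x = \<Psi> (- b - 1)" if "x \<le> - b - 1" for x
    using that by force
  have const: "(LINT u|lborel. V (s + u / real (Suc n)) * of_real (\<psi> u))
      = (LINT u|lborel. V (t + u / real (Suc n)) * of_real (\<psi> u))" for n
  proof -
    define r where "r = real (Suc n)"
    have r: "r \<ge> 1" by (simp add: r_def)
    define \<theta> where "\<theta> x = \<Psi> (r * x + (- r * s)) - \<Psi> (r * x + (- r * t))" for x
    define c where "c = \<bar>s\<bar> + \<bar>t\<bar> + b + 1"
    have large: "b + 1 < r * x + (- r * u)" if "c < x" "u \<in> {s, t}" for x u
    proof -
      have "b + 1 < x - u" using that \<psi> by (auto simp: c_def)
      also have "\<dots> \<le> r * (x - u)" using r \<open>b + 1 < x - u\<close> \<psi> by (simp add: mult_le_cancel_right1)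
      finally show ?thesis by (simp add: algebra_simps)
    qed
    have small: "r * x + (- r * u) < - b - 1" if "x < - c" "u \<in> {s, t}" for x u
    proof -
      have "b + 1 < u - x" using that \<psi> by (auto simp: c_def)
      also have "\<dots> \<le> r * (u - x)" using r \<open>b + 1 < u - x\<close> \<psi> by (simp add: mult_le_cancel_right1)
      finally show ?thesis by (simp add: algebra_simps)
    qed
    have "test_function \<theta>"
    proof (rule test_functionI[where b = c])
      show "smooth \<theta>" 
        using smooth_affine_combination[OF sm\<Psi>, of 1 r "- r * s" "- 1" "- r * t"] by (simp add: \<theta>_def[abs_def])
      show "\<theta> x = 0" if "c < \<bar>x\<bar>" for x
      proof (cases "x > 0")
        case True
        then show ?thesis
          using large[of x s] large[of x t] that
            right[of "r * x + (- r * s)"] right[of "r * x + (- r * t)"] unfolding \<theta>_def by simp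
      next
        case False
        then show ?thesis
          using small[of x s] small[of x t] that
            left[of "r * x + (- r * s)"] left[of "r * x + (- r * t)"] unfolding \<theta>_def by simp
      qed
    qed
    from weak[OF this] have "dist_of V (deriv \<theta>) = 0" .
    moreover have "deriv \<theta> x = r * (\<psi> (r * (x - s)) - \<psi> (r * (x - t)))" for x
    proof (rule DERIV_imp_deriv)
      have d: "((\<lambda>x. \<Psi> (r * x + u)) has_real_derivative \<psi> (r * x + u) * r) (at x)" for u
        by (rule DERIV_chain2[OF d\<Psi>]) (auto intro!: derivative_eq_intros)
      show "(\<theta> has_real_derivative r * (\<psi> (r * (x - s)) - \<psi> (r * (x - t)))) (at x)"
        unfolding \<theta>_def
        by (rule DERIV_cong[OF DERIV_diff[OF d[of "- r * s"] d[of "- r * t"]]])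
           (simp add: algebra_simps)
    qed
    ultimately have 0: "(LINT x|lborel. V x * of_real (r * (\<psi> (r * (x - s)) - \<psi> (r * (x - t))))) = 0"
      by (simp add: dist_of_def)
    have supp: "\<psi> (r * (x - u)) = 0" if "c < \<bar>x\<bar>" "u \<in> {s, t}" for x u
      using large[of x u] small[of x u] that \<psi>(3)[of "r * (x - u)"]
      by (auto simp: algebra_simps abs_if split: if_splits)
    have int: "integrable lborel (\<lambda>x. V x * of_real (\<psi> (r * (x - u))))" if "u \<in> {s, t}" for u
    proof (rule integrable_compact_support[where b = c])
      have "continuous_on UNIV (\<lambda>x. \<psi> (r * (x - u)))"
        by (rule continuous_on_compose2[OF smooth_continuous_on[OF \<psi>(1), of UNIV]])
           (auto intro!: continuous_intros)
      then show "continuous_on UNIV (\<lambda>x. V x * of_real (\<psi> (r * (x - u))))"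
        by (intro continuous_intros V)
    qed (use supp that in auto)
    have "v * of_real (r * (p - q)) = of_real r * (v * of_real p - v * of_real q)"
      for v :: complex and p q by (simp add: right_diff_distrib mult.left_commute)
    note 0 [unfolded this integral_mult_right_zero
        Bochner_Integration.integral_diff[OF int[of s] int[of t], simplified]]
    then have "of_real r * ((LINT x|lborel. V x * of_real (\<psi> (r * (x - s))))
        - (LINT x|lborel. V x * of_real (\<psi> (r * (x - t))))) = 0" .
    then have eq: "(LINT x|lborel. V x * of_real (\<psi> (r * (x - s))))
        = (LINT x|lborel. V x * of_real (\<psi> (r * (x - t))))" using r by simp
    have subst: "(LINT x|lborel. V x * of_real (\<psi> (r * (x - u))))
        = (1 / r) *\<^sub>R (LINT v|lborel. V (u + v / r) * of_real (\<psi> v))" for u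
      using r by (subst lborel_integral_real_affine[of "1 / r" _ u]) auto
    show ?thesis using eq r unfolding subst by (simp add: r_def)
  qed
  have c\<psi>: "continuous_on UNIV \<psi>" by (rule smooth_continuous_on[OF \<psi>(1)])
  have "V s * of_real (LINT u|lborel. \<psi> u) = V t * of_real (LINT u|lborel. \<psi> u)"
    by (rule LIMSEQ_unique[OF integral_rescaled_limit[OF V c\<psi> \<psi>(3), where t = s, unfolded const]
        integral_rescaled_limit[OF V c\<psi> \<psi>(3), where t = t]])
  then show ?thesis using \<psi>(4) by simp
qed

text \<open>After subtracting an antiderivative of \<open>g\<close> the weak derivative is zero.\<close>

lemma has_vector_derivative_of_weak_derivative:
  fixes V g :: "real \<Rightarrow> complex"
  assumes \<phi>: "littlewood_paley \<phi>"
    and V: "continuous_on UNIV V" and g: "continuous_on UNIV g"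
    and weak: "\<And>\<theta>. test_function \<theta> \<Longrightarrow> dist_deriv (dist_of V) \<theta> = dist_of g \<theta>"
  shows "(V has_vector_derivative g x) (at x)"
proof -
  obtain G where dG: "\<And>x. (G has_vector_derivative g x) (at x)"
    using continuous_antiderivative[OF g] by blast
  then have cG: "continuous_on UNIV G"
    by (meson continuous_at_imp_continuous_on has_vector_derivative_continuous)
  obtain \<psi> b where \<psi>: "smooth \<psi>" "b > 0" "\<And>x. b < \<bar>x\<bar> \<Longrightarrow> \<psi> x = 0" "(LINT u|lborel. \<psi> u) \<noteq> 0"
    using littlewood_paley_bump[OF \<phi>] by blast
  have const: "V s - G s = V t - G t" for s t
  proof (rule constant_of_weak_derivative_zero[OF \<psi>, where V = "\<lambda>x. V x - G x"])
    show "continuous_on UNIV (\<lambda>x. V x - G x)" by (intro continuous_intros V cG)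
    fix \<theta> assume \<theta>: "test_function \<theta>"
    then have sm: "smooth \<theta>" by (simp add: test_function_def)
    obtain c where "c > 0"
      and c: "\<And>x. c < \<bar>x\<bar> \<Longrightarrow> \<theta> x = 0" "\<And>x. c < \<bar>x\<bar> \<Longrightarrow> deriv \<theta> x = 0"
      using test_function_support[OF \<theta>] by metis
    have c\<theta>: "continuous_on UNIV \<theta>" "continuous_on UNIV (deriv \<theta>)"
      using sm smooth_deriv smooth_continuous_on by blast+
    have "(LINT x|lborel. G x * of_real (deriv \<theta> x) + g x * of_real (\<theta> x)) = 0"
    proof (rule integral_derivative_compact_support[where b = c and h = "\<lambda>x. G x * of_real (\<theta> x)"])
      have "((\<lambda>x. complex_of_real (\<theta> x)) has_vector_derivative of_real (deriv \<theta> x)) (at x)" for x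
        using smooth_has_derivative[OF sm]
        by (simp add: has_vector_derivative_of_real has_real_derivative_iff_has_vector_derivative)
      then show "((\<lambda>x. G x * of_real (\<theta> x)) has_vector_derivative
          G x * of_real (deriv \<theta> x) + g x * of_real (\<theta> x)) (at x)" for x
        by (intro has_vector_derivative_mult dG)
      show "continuous_on UNIV (\<lambda>x. G x * of_real (deriv \<theta> x) + g x * of_real (\<theta> x))"
        by (intro continuous_intros cG g c\<theta>)
    qed (use c in auto)
    moreover have "integrable lborel (\<lambda>x. G x * of_real (deriv \<theta> x))"
      "integrable lborel (\<lambda>x. g x * of_real (\<theta> x))"
      by (rule integrable_compact_support[where b = c]; use c in \<open>auto intro!: continuous_intros cG g c\<theta>\<close>)+
    ultimately have "dist_of G (deriv \<theta>) + dist_of g \<theta> = 0"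
      by (simp add: dist_of_def)
    moreover have "- dist_of V (deriv \<theta>) = dist_of g \<theta>"
      using weak[OF \<theta>] by (simp add: dist_deriv_def)
    moreover have "dist_of (\<lambda>x. V x - G x) (deriv \<theta>) = dist_of V (deriv \<theta>) - dist_of G (deriv \<theta>)"
      by (rule dist_of_diff[OF V cG c\<theta>(2) c(2)])
    ultimately show "dist_of (\<lambda>x. V x - G x) (deriv \<theta>) = 0"
      by (simp add: add_eq_0_iff)
  qed
  have "V = (\<lambda>y. G y + (V 0 - G 0))"
    using const[of _ 0] by (auto simp: fun_eq_iff algebra_simps)
  moreover have "((\<lambda>y. G y + (V 0 - G 0)) has_vector_derivative g x) (at x)"
    using has_vector_derivative_add[OF dG has_vector_derivative_const] by simp
  ultimately show ?thesis by simp
qed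

section \<open>Besov functions vanish at infinity\<close>

lemma norm_integral_compact_support_le:
  fixes f :: "real \<Rightarrow> complex"
  assumes "continuous_on UNIV f" "\<And>x. b < \<bar>x\<bar> \<Longrightarrow> f x = 0" "\<And>x. norm (f x) \<le> M" "b \<ge> 0"
  shows "norm (LINT x|lborel. f x) \<le> 2 * b * M"
proof -
  have int: "integrable lborel f" by (rule integrable_compact_support[OF assms(1,2)])
  have "norm (LINT x|lborel. f x) \<le> (LINT x|lborel. norm (f x))" by (rule integral_norm_bound)
  also have "\<dots> \<le> (LINT x|lborel. indicator {-b..b} x *\<^sub>R M)"
  proof (rule integral_mono)
    show "integrable lborel (\<lambda>x. indicator {-b..b} x *\<^sub>R M)"
      using assms(4) by (intro integrable_scaleR_left integrable_real_indicator) auto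
    show "norm (f x) \<le> indicator {-b..b} x *\<^sub>R M" for x
      using assms(2)[of x] assms(3)[of x] by (auto simp: indicator_def abs_if split: if_splits)
  qed (use int in simp)
  also have "\<dots> = 2 * b * M" using assms(4) by simp
  finally show ?thesis .
qed

text \<open>Two integrations by parts give \<open>x\<^sup>2 \<integral> f e\<^bsup>i\<xi>x\<^esup> = - \<integral> f'' e\<^bsup>i\<xi>x\<^esup>\<close>.\<close>

lemma fourier_integral_decay:
  fixes f f' f'' :: "real \<Rightarrow> complex"
  assumes f: "\<And>\<xi>. (f has_vector_derivative f' \<xi>) (at \<xi>)"
    and f': "\<And>\<xi>. (f' has_vector_derivative f'' \<xi>) (at \<xi>)"
    and cont: "continuous_on UNIV f''"
    and supp: "\<And>\<xi>. b < \<bar>\<xi>\<bar> \<Longrightarrow> f \<xi> = 0" "\<And>\<xi>. b < \<bar>\<xi>\<bar> \<Longrightarrow> f' \<xi> = 0" "\<And>\<xi>. b < \<bar>\<xi>\<bar> \<Longrightarrow> f'' \<xi> = 0"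
    and M: "\<And>\<xi>. norm (f \<xi>) \<le> M" "\<And>\<xi>. norm (f'' \<xi>) \<le> M" and b: "b \<ge> 0"
  shows "norm (LINT \<xi>|lborel. f \<xi> * exp (\<i> * of_real (\<xi> * x))) \<le> 4 * b * M / (1 + x\<^sup>2)"
proof -
  let ?e = "\<lambda>\<xi>. exp (\<i> * of_real (\<xi> * x)) :: complex"
  let ?I = "\<lambda>g. LINT \<xi>|lborel. g \<xi> * ?e \<xi>"
  have cf: "continuous_on UNIV f" "continuous_on UNIV f'"
    using f f' by (meson continuous_at_imp_continuous_on has_vector_derivative_continuous)+
  have ce: "continuous_on UNIV ?e" by (intro continuous_intros)
  have ne: "norm (?e \<xi>) = 1" for \<xi> by simp
  have bound: "norm (?I g) \<le> 2 * b * M"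
    if "continuous_on UNIV g" "\<And>\<xi>. b < \<bar>\<xi>\<bar> \<Longrightarrow> g \<xi> = 0" "\<And>\<xi>. norm (g \<xi>) \<le> M" for g
    by (rule norm_integral_compact_support_le)
       (use that b in \<open>auto intro!: continuous_intros simp: norm_mult simp del: of_real_mult\<close>)
  have "(LINT \<xi>|lborel. f'' \<xi> * ?e \<xi> + of_real (x\<^sup>2) * (f \<xi> * ?e \<xi>)) = 0"
  proof (rule integral_derivative_compact_support[where b = b
        and h = "\<lambda>\<xi>. f' \<xi> * ?e \<xi> - (\<i> * of_real x) * (f \<xi> * ?e \<xi>)"])
    fix \<xi>
    have "((\<lambda>z. exp (\<i> * (z * of_real x))) has_field_derivative \<i> * of_real x * ?e \<xi>) (at (of_real \<xi>))"
      by (auto intro!: derivative_eq_intros)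
    then have de: "(?e has_vector_derivative \<i> * of_real x * ?e \<xi>) (at \<xi>)"
      using has_vector_derivative_real_field by fastforce
    show "((\<lambda>\<xi>. f' \<xi> * ?e \<xi> - (\<i> * of_real x) * (f \<xi> * ?e \<xi>)) has_vector_derivative
        f'' \<xi> * ?e \<xi> + of_real (x\<^sup>2) * (f \<xi> * ?e \<xi>)) (at \<xi>)"
      by (rule derivative_eq_intros f f' de has_vector_derivative_mult refl)+
         (simp add: algebra_simps power2_eq_square)
    show "continuous_on UNIV (\<lambda>\<xi>. f'' \<xi> * ?e \<xi> + of_real (x\<^sup>2) * (f \<xi> * ?e \<xi>))"
      by (intro continuous_intros cont cf ce)
  qed (use supp in auto)
  moreover have "integrable lborel (\<lambda>\<xi>. g \<xi> * ?e \<xi>)"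
    if "continuous_on UNIV g" "\<And>\<xi>. b < \<bar>\<xi>\<bar> \<Longrightarrow> g \<xi> = 0" for g
    using that(2) by (intro integrable_compact_support[where b = b] continuous_on_mult that(1) ce) simp
  note this[OF cf(1) supp(1)] this[OF cont supp(3)]
  ultimately have "?I f'' + of_real (x\<^sup>2) * ?I f = 0" by simp
  then have "of_real (x\<^sup>2) * ?I f = - ?I f''" by (simp add: eq_neg_iff_add_eq_0 add.commute)
  then have "norm (of_real (x\<^sup>2) * ?I f) = norm (?I f'')" by (metis norm_minus_cancel)
  then have "x\<^sup>2 * norm (?I f) = norm (?I f'')" by (simp add: norm_mult norm_power)
  also have "\<dots> \<le> 2 * b * M" by (rule bound[OF cont supp(3) M(2)])
  finally have "(1 + x\<^sup>2) * norm (?I f) \<le> 4 * b * M"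
    using bound[OF cf(1) supp(1) M(1)] by (simp add: algebra_simps)
  then show ?thesis by (simp add: pos_le_divide_eq add_pos_nonneg mult.commute)
qed

lemma norm_exp_i_minus_one_le: "norm (exp (\<i> * of_real t) - 1) \<le> \<bar>t\<bar>"
proof -
  have "norm (exp (\<i> * of_real t) - exp (\<i> * of_real 0)) \<le> norm \<i> * norm (complex_of_real t - of_real 0)"
  proof (rule field_differentiable_bound[of "{z. Im z = 0}"])
    show "convex {z. Im z = 0}"
      using convex_Reals by (simp add: complex_is_Real_iff[symmetric] Collect_mem_eq)
    show "norm (\<i> * exp (\<i> * z)) \<le> norm \<i>" if "z \<in> {z. Im z = 0}" for z
      using that by (simp add: norm_mult)
  qed (auto intro!: derivative_eq_intros)
  then show ?thesis by simp
qed

text \<open>The increment of the transform is the transform of \<open>f (e\<^bsup>i\<xi>h\<^esup> - 1)\<close>, which together with its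
  second derivative is \<open>O (\<bar>h\<bar>)\<close>; so \<open>fourier_integral_decay\<close> applies to both.\<close>

lemma smooth_fourier_kernel_bounds:
  fixes \<phi> :: "real \<Rightarrow> real"
  defines "I \<equiv> \<lambda>x. LINT \<xi>|lborel. of_real (\<phi> \<xi>) * exp (\<i> * of_real (\<xi> * x))"
  assumes sm: "smooth \<phi>" and supp: "\<And>x. b < \<bar>x\<bar> \<Longrightarrow> \<phi> x = 0"
  obtains C where "C > 0" "\<And>x. norm (I x) \<le> C / (1 + x\<^sup>2)"
    "\<And>x h. \<bar>h\<bar> \<le> 1 \<Longrightarrow> norm (I (x + h) - I x) \<le> C * \<bar>h\<bar> / (1 + x\<^sup>2)"
proof -
  have "test_function \<phi>" by (rule test_functionI[OF sm supp])
  then obtain b where b: "b > 0" and s0: "\<And>x. b < \<bar>x\<bar> \<Longrightarrow> \<phi> x = 0"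
    and s1: "\<And>x. b < \<bar>x\<bar> \<Longrightarrow> deriv \<phi> x = 0"
    using test_function_support by metis
  have "test_function (deriv \<phi>)" by (rule test_functionI[OF smooth_deriv[OF sm] s1])
  then obtain b' where s2': "\<And>x. b' < \<bar>x\<bar> \<Longrightarrow> deriv (deriv \<phi>) x = 0"
    using test_function_support by metis
  define c where "c = max b b'"
  have c: "c > 0" using b by (simp add: c_def)
  have s: "\<phi> x = 0" "deriv \<phi> x = 0" "deriv (deriv \<phi>) x = 0" if "c < \<bar>x\<bar>" for x
    using s0 s1 s2' that by (auto simp: c_def)
  have bdd: "\<exists>M. \<forall>x. \<bar>g x\<bar> \<le> M" if g: "smooth g" "\<And>x. c < \<bar>x\<bar> \<Longrightarrow> g x = 0" for g :: "real \<Rightarrow> real"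
  proof -
    have "compact (g ` {-c..c})"
      by (intro compact_continuous_image smooth_continuous_on[OF g(1)] compact_Icc)
    then have "bounded (g ` {-c..c})" by (rule compact_imp_bounded)
    then obtain M where M: "\<forall>y\<in>g ` {-c..c}. norm y \<le> M" unfolding bounded_iff by blast
    have "\<bar>g x\<bar> \<le> max M 0" for x
    proof (cases "c < \<bar>x\<bar>")
      case False
      then have "x \<in> {-c..c}" by auto
      then have "\<bar>g x\<bar> \<le> M" using M by auto
      then show ?thesis by simp
    qed (simp add: g(2))
    then show ?thesis by blast
  qed
  obtain M0 M1 M2 where M': "\<And>x. \<bar>\<phi> x\<bar> \<le> M0" "\<And>x. \<bar>deriv \<phi> x\<bar> \<le> M1" "\<And>x. \<bar>deriv (deriv \<phi>) x\<bar> \<le> M2"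
    using bdd[OF sm s(1)] bdd[OF smooth_deriv[OF sm] s(2)]
      bdd[OF smooth_deriv[OF smooth_deriv[OF sm]] s(3)] by metis
  define M where "M = max M0 (max M1 (max M2 1))"
  have M: "\<bar>\<phi> x\<bar> \<le> M" "\<bar>deriv \<phi> x\<bar> \<le> M" "\<bar>deriv (deriv \<phi>) x\<bar> \<le> M" for x
    using M'[of x] by (auto simp: M_def)
  have M1: "M \<ge> 1" by (simp add: M_def)
  have der: "((\<lambda>x. complex_of_real (g x)) has_vector_derivative of_real (deriv g x)) (at x)"
    if "smooth g" for g :: "real \<Rightarrow> real" and x
    using smooth_has_derivative[OF that]
    by (simp add: has_vector_derivative_of_real has_real_derivative_iff_has_vector_derivative)
  have cont: "continuous_on UNIV (\<lambda>x. complex_of_real (g x))" if "smooth g" for g :: "real \<Rightarrow> real"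
    using smooth_continuous_on[OF that] by (intro continuous_intros)
  note d0 = der[OF sm] and d1 = der[OF smooth_deriv[OF sm]]
  note c0 = cont[OF sm] and c1 = cont[OF smooth_deriv[OF sm]]
    and c2 = cont[OF smooth_deriv[OF smooth_deriv[OF sm]]]
  define C where "C = 4 * c * M * (c + 4)"
  have Cpos: "C > 0" using c M1 by (simp add: C_def)
  show thesis
  proof (rule that[OF Cpos])
    show "norm (I x) \<le> C / (1 + x\<^sup>2)" for x
    proof -
      have "norm (I x) \<le> 4 * c * M / (1 + x\<^sup>2)"
        unfolding I_def using M s c by (intro fourier_integral_decay[OF d0 d1 c2]) auto
      also have "4 * c * M \<le> C" using c M1 by (simp add: C_def)
      then have "4 * c * M / (1 + x\<^sup>2) \<le> C / (1 + x\<^sup>2)" by (rule divide_right_mono) simp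
      finally show ?thesis .
    qed
    fix x h :: real assume h: "\<bar>h\<bar> \<le> 1"
    let ?e = "\<lambda>\<xi>. exp (\<i> * of_real (\<xi> * h)) :: complex"
    let ?f = "\<lambda>\<xi>. of_real (\<phi> \<xi>) * (?e \<xi> - 1)"
    let ?f' = "\<lambda>\<xi>. of_real (\<phi> \<xi>) * (\<i> * of_real h * ?e \<xi>) + of_real (deriv \<phi> \<xi>) * (?e \<xi> - 1)"
    let ?f'' = "\<lambda>\<xi>. of_real (\<phi> \<xi>) * (\<i> * of_real h * (\<i> * of_real h * ?e \<xi>))
        + of_real (deriv \<phi> \<xi>) * (\<i> * of_real h * ?e \<xi>)
        + (of_real (deriv \<phi> \<xi>) * (\<i> * of_real h * ?e \<xi>) + of_real (deriv (deriv \<phi>) \<xi>) * (?e \<xi> - 1))"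
    let ?M = "M * ((c + 3) * \<bar>h\<bar>)"
    have de: "(?e has_vector_derivative \<i> * of_real h * ?e \<xi>) (at \<xi>)" for \<xi>
    proof -
      have "((\<lambda>z. exp (\<i> * (z * of_real h))) has_field_derivative \<i> * of_real h * ?e \<xi>) (at (of_real \<xi>))"
        by (auto intro!: derivative_eq_intros)
      then show ?thesis using has_vector_derivative_real_field by fastforce
    qed
    have de1: "((\<lambda>\<xi>. ?e \<xi> - 1) has_vector_derivative \<i> * of_real h * ?e \<xi>) (at \<xi>)" for \<xi>
      using has_vector_derivative_diff[OF de has_vector_derivative_const[of 1]] by simp
    have de2: "((\<lambda>\<xi>. \<i> * of_real h * ?e \<xi>) has_vector_derivative \<i> * of_real h * (\<i> * of_real h * ?e \<xi>)) (at \<xi>)" for \<xi>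
      by (intro has_vector_derivative_mult_right de)
    have ne: "norm (?e \<xi>) = 1" for \<xi> by simp
    have ce: "continuous_on UNIV ?e" by (intro continuous_intros)
    have e1: "norm (?e \<xi> - 1) \<le> c * \<bar>h\<bar>" if "\<not> c < \<bar>\<xi>\<bar>" for \<xi>
    proof -
      have "norm (?e \<xi> - 1) \<le> \<bar>\<xi>\<bar> * \<bar>h\<bar>"
        using norm_exp_i_minus_one_le[of "\<xi> * h"] by (simp only: abs_mult)
      also have "\<dots> \<le> c * \<bar>h\<bar>" using that by (intro mult_right_mono) auto
      finally show ?thesis .
    qed
    have "norm (LINT \<xi>|lborel. ?f \<xi> * exp (\<i> * of_real (\<xi> * x))) \<le> 4 * c * ?M / (1 + x\<^sup>2)"
    proof (rule fourier_integral_decay[where f' = ?f' and f'' = ?f''])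
      show "(?f has_vector_derivative ?f' \<xi>) (at \<xi>)" for \<xi>
        by (intro has_vector_derivative_mult d0 de1)
      show "(?f' has_vector_derivative ?f'' \<xi>) (at \<xi>)" for \<xi>
        by (intro has_vector_derivative_add has_vector_derivative_mult d0 d1 de1 de2)
      show "continuous_on UNIV ?f''"
        by (intro continuous_on_add continuous_on_mult continuous_on_diff continuous_on_const c0 c1 c2 ce)
      show "norm (?f \<xi>) \<le> ?M" for \<xi>
      proof (cases "c < \<bar>\<xi>\<bar>")
        case False
        have "norm (?f \<xi>) \<le> M * (c * \<bar>h\<bar>)"
          unfolding norm_mult using M e1[OF False] M1 by (intro mult_mono) auto
        also have "\<dots> \<le> ?M" using M1 by (intro mult_left_mono mult_right_mono) auto
        finally show ?thesis .
      qed (use s c M1 in simp)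
      show "norm (?f'' \<xi>) \<le> ?M" for \<xi>
      proof (cases "c < \<bar>\<xi>\<bar>")
        case False
        have h2: "\<bar>h\<bar> * \<bar>h\<bar> \<le> \<bar>h\<bar>" using h mult_left_le[of "\<bar>h\<bar>" "\<bar>h\<bar>"] by simp
        have 1: "norm (of_real (\<phi> \<xi>) * (\<i> * of_real h * (\<i> * of_real h * ?e \<xi>))) \<le> M * \<bar>h\<bar>"
        proof -
          have "norm (of_real (\<phi> \<xi>) * (\<i> * of_real h * (\<i> * of_real h * ?e \<xi>))) = \<bar>\<phi> \<xi>\<bar> * (\<bar>h\<bar> * \<bar>h\<bar>)"
            unfolding norm_mult ne by simp
          also have "\<dots> \<le> M * \<bar>h\<bar>" using M h2 M1 by (intro mult_mono) auto
          finally show ?thesis .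
        qed
        have 2: "norm (of_real (deriv \<phi> \<xi>) * (\<i> * of_real h * ?e \<xi>)) \<le> M * \<bar>h\<bar>"
        proof -
          have "norm (of_real (deriv \<phi> \<xi>) * (\<i> * of_real h * ?e \<xi>)) = \<bar>deriv \<phi> \<xi>\<bar> * \<bar>h\<bar>"
            unfolding norm_mult ne by simp
          also have "\<dots> \<le> M * \<bar>h\<bar>" using M M1 by (intro mult_mono) auto
          finally show ?thesis .
        qed
        have 3: "norm (of_real (deriv (deriv \<phi>) \<xi>) * (?e \<xi> - 1)) \<le> M * (c * \<bar>h\<bar>)"
          unfolding norm_mult using M e1[OF False] M1 by (intro mult_mono) auto
        have "norm (?f'' \<xi>) \<le> M * \<bar>h\<bar> + M * \<bar>h\<bar> + (M * \<bar>h\<bar> + M * (c * \<bar>h\<bar>))"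
          by (intro norm_triangle_le add_mono 1 2 3 order_trans[OF norm_triangle_ineq])
        also have "\<dots> = ?M" by (simp add: algebra_simps)
        finally show ?thesis .
      qed (use s c M1 in simp)
    qed (use s c in auto)
    moreover have "I (x + h) - I x = (LINT \<xi>|lborel. ?f \<xi> * exp (\<i> * of_real (\<xi> * x)))"
    proof -
      have int: "integrable lborel (\<lambda>\<xi>. complex_of_real (\<phi> \<xi>) * exp (\<i> * of_real (\<xi> * y)))"
        for y :: real
        by (rule integrable_compact_support[where b = c]) (use s in \<open>auto intro!: continuous_intros c0\<close>)
      have "I (x + h) - I x = (LINT \<xi>|lborel. of_real (\<phi> \<xi>) * exp (\<i> * of_real (\<xi> * (x + h)))
          - of_real (\<phi> \<xi>) * exp (\<i> * of_real (\<xi> * x)))"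
        unfolding I_def
        by (rule Bochner_Integration.integral_diff[OF int[of "x + h"] int[of x], symmetric])
      also have "\<dots> = (LINT \<xi>|lborel. ?f \<xi> * exp (\<i> * of_real (\<xi> * x)))"
      proof (rule Bochner_Integration.integral_cong[OF refl])
        fix \<xi>
        have "\<i> * of_real (\<xi> * (x + h)) = \<i> * of_real (\<xi> * h) + \<i> * complex_of_real (\<xi> * x)"
          by (simp add: algebra_simps)
        then have "exp (\<i> * of_real (\<xi> * (x + h))) = ?e \<xi> * exp (\<i> * of_real (\<xi> * x))"
          by (simp only: exp_add)
        then show "of_real (\<phi> \<xi>) * exp (\<i> * of_real (\<xi> * (x + h)))
          - of_real (\<phi> \<xi>) * exp (\<i> * of_real (\<xi> * x)) = ?f \<xi> * exp (\<i> * of_real (\<xi> * x))"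
          by (simp only: right_diff_distrib left_diff_distrib mult_1_right mult.assoc)
      qed
      finally show ?thesis .
    qed
    moreover have "4 * c * ?M \<le> C * \<bar>h\<bar>"
      using c M1 by (simp add: C_def algebra_simps mult_left_mono)
    then have "4 * c * ?M / (1 + x\<^sup>2) \<le> C * \<bar>h\<bar> / (1 + x\<^sup>2)" by (rule divide_right_mono) simp
    ultimately show "norm (I (x + h) - I x) \<le> C * \<bar>h\<bar> / (1 + x\<^sup>2)" by simp
  qed
qed

lemma integrable_one_over_one_plus_square: "integrable lborel (\<lambda>x::real. 1 / (1 + x\<^sup>2))"
  using integrable_inverse_1_plus_square
  by (simp add: set_integrable_def divide_inverse)

text \<open>The kernel is Lipschitz as a map into the integrable functions, and \<open>u\<close> is bounded.\<close>

lemma convolution_Lipschitz: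
  fixes K u :: "real \<Rightarrow> complex"
  assumes C: "C > 0" and K: "\<And>x. norm (K x) \<le> C / (1 + x\<^sup>2)"
    and dK: "\<And>x h. \<bar>h\<bar> \<le> 1 \<Longrightarrow> norm (K (x + h) - K x) \<le> C * \<bar>h\<bar> / (1 + x\<^sup>2)"
    and u: "continuous_on UNIV u" "\<And>x. norm (u x) \<le> U"
  obtains L where "L > 0" "\<And>x h. \<bar>h\<bar> \<le> 1 \<Longrightarrow>
    norm ((LINT y|lborel. K (x + h - y) * u y) - (LINT y|lborel. K (x - y) * u y)) \<le> L * \<bar>h\<bar>"
proof -
  let ?p = "\<lambda>x::real. 1 / (1 + x\<^sup>2)"
  have U: "U \<ge> 0" using u(2)[of 0] norm_ge_zero order_trans by blast
  have p_le: "?p x \<le> 1" for x by (simp add: divide_le_eq add_pos_nonneg)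
  have "continuous_on UNIV K"
  proof (rule continuous_at_imp_continuous_on, rule ballI)
    fix x
    have "((\<lambda>h. K (x + h) - K x) \<longlongrightarrow> 0) (at 0)"
    proof (rule Lim_null_comparison)
      have "norm (K (x + h) - K x) \<le> C * \<bar>h\<bar>" if "\<bar>h\<bar> \<le> 1" for h
      proof -
        have "norm (K (x + h) - K x) \<le> (C * \<bar>h\<bar>) * ?p x" using dK[OF that] by simp
        also have "\<dots> \<le> (C * \<bar>h\<bar>) * 1" using C p_le by (intro mult_left_mono) auto
        finally show ?thesis by simp
      qed
      then show "eventually (\<lambda>h. norm (K (x + h) - K x) \<le> C * \<bar>h\<bar>) (at 0)"
        unfolding eventually_at by (intro exI[of _ 1]) (auto simp: dist_real_def)
      show "((\<lambda>h. C * \<bar>h\<bar>) \<longlongrightarrow> 0) (at 0)" by (auto intro!: tendsto_eq_intros)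
    qed
    then show "isCont K x" by (simp add: isCont_iff LIM_zero_cancel)
  qed
  then have mK[measurable]: "K \<in> borel_measurable borel" by (rule borel_measurable_continuous_onI)
  have mu[measurable]: "u \<in> borel_measurable borel" using u(1) by (rule borel_measurable_continuous_onI)
  have ip: "integrable lborel (\<lambda>y. ?p (x - y))" for x
    using lborel_integrable_real_affine[OF integrable_one_over_one_plus_square, of "-1" x] by simp
  have Ip: "(LINT y|lborel. ?p (x - y)) = (LINT y|lborel. ?p y)" for x
    using lborel_integral_real_affine[of "-1" ?p x] by simp
  define J where "J = (LINT y|lborel. ?p y)"
  have J: "J \<ge> 0" unfolding J_def by (rule Bochner_Integration.integral_nonneg) simp
  have iK: "integrable lborel (\<lambda>y. K (x - y) * u y)" for x
  proof (rule Bochner_Integration.integrable_bound)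
    show "integrable lborel (\<lambda>y. C * U * ?p (x - y))" by (intro integrable_mult_right ip)
    show "AE y in lborel. norm (K (x - y) * u y) \<le> norm (C * U * ?p (x - y))"
    proof (rule AE_I2)
      fix y
      have "norm (K (x - y) * u y) \<le> (C / (1 + (x - y)\<^sup>2)) * U"
        unfolding norm_mult by (intro mult_mono K u(2)) (use C in \<open>auto intro: divide_nonneg_nonneg\<close>)
      also have "\<dots> = C * U * ?p (x - y)" by simp
      also have "\<dots> \<le> norm (C * U * ?p (x - y))" unfolding real_norm_def by (rule abs_ge_self)
      finally show "norm (K (x - y) * u y) \<le> norm (C * U * ?p (x - y))" .
    qed
  qed measurable
  show thesis
  proof (rule that[of "C * U * J + 1"])
    show "C * U * J + 1 > 0" using C U J by (simp add: add_nonneg_pos)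
    fix x h :: real assume h: "\<bar>h\<bar> \<le> 1"
    have "norm ((LINT y|lborel. K (x + h - y) * u y) - (LINT y|lborel. K (x - y) * u y))
        = norm (LINT y|lborel. K (x + h - y) * u y - K (x - y) * u y)"
      using iK[of "x + h"] iK[of x] by (simp add: Bochner_Integration.integral_diff)
    also have "\<dots> \<le> (LINT y|lborel. norm (K (x + h - y) * u y - K (x - y) * u y))"
      by (rule integral_norm_bound)
    also have "\<dots> \<le> (LINT y|lborel. C * U * \<bar>h\<bar> * ?p (x - y))"
    proof (rule integral_mono)
      show "integrable lborel (\<lambda>y. norm (K (x + h - y) * u y - K (x - y) * u y))"
        using iK by (intro integrable_norm Bochner_Integration.integrable_diff)
      show "integrable lborel (\<lambda>y. C * U * \<bar>h\<bar> * ?p (x - y))" by (intro integrable_mult_right ip)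
      fix y
      have "norm (K (x + h - y) * u y - K (x - y) * u y) = norm (K ((x - y) + h) - K (x - y)) * norm (u y)"
        unfolding norm_mult[symmetric] by (simp add: algebra_simps)
      also have "\<dots> \<le> (C * \<bar>h\<bar> / (1 + (x - y)\<^sup>2)) * U"
        by (intro mult_mono dK h u(2)) (use C in \<open>auto intro!: divide_nonneg_nonneg\<close>)
      finally show "norm (K (x + h - y) * u y - K (x - y) * u y) \<le> C * U * \<bar>h\<bar> * ?p (x - y)"
        by (simp add: ac_simps)
    qed
    also have "\<dots> = C * U * \<bar>h\<bar> * (LINT y|lborel. ?p (x - y))"
      by (rule integral_mult_right_zero)
    also have "\<dots> = (C * U * J) * \<bar>h\<bar>" unfolding Ip J_def by (simp add: ac_simps)
    also have "\<dots> \<le> (C * U * J + 1) * \<bar>h\<bar>" by (intro mult_right_mono) auto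
    finally show "norm ((LINT y|lborel. K (x + h - y) * u y) - (LINT y|lborel. K (x - y) * u y))
        \<le> (C * U * J + 1) * \<bar>h\<bar>" .
  qed
qed

text \<open>A value of size \<open>e\<close> at \<open>x\<close> forces \<open>\<bar>f\<bar> \<ge> e/2\<close> on an interval of fixed length \<open>d\<close>, which
  the square integrable tail cannot afford for large \<open>\<bar>x\<bar>\<close>.\<close>

lemma L2_Lipschitz_vanishes_at_infinity:
  fixes f :: "real \<Rightarrow> complex"
  assumes f: "in_L2 f" and L: "L > 0" "\<And>x h. \<bar>h\<bar> \<le> 1 \<Longrightarrow> norm (f (x + h) - f x) \<le> L * \<bar>h\<bar>"
  shows "(f \<longlongrightarrow> 0) at_infinity"
proof (rule tendstoI)
  fix e :: real assume e: "e > 0"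
  let ?F = "\<lambda>x. (norm (f x))\<^sup>2"
  have int: "integrable lborel ?F" and [measurable]: "f \<in> borel_measurable borel"
    using f by (simp_all add: in_L2_def)
  define d where "d = min 1 (e / (2 * L))"
  have d: "d > 0" "d \<le> 1" "L * d \<le> e / 2" using e L by (auto simp: d_def min_def field_simps)
  have tail: "(\<lambda>n. LINT x|lborel. indicator {x. real n \<le> \<bar>x\<bar>} x * ?F x) \<longlonglongrightarrow> (LINT x|(lborel :: real measure). 0)"
  proof (rule Bochner_Integration.integral_dominated_convergence[where w = ?F])
    show "AE x in lborel. (\<lambda>n. indicator {x. real n \<le> \<bar>x\<bar>} x * ?F x) \<longlonglongrightarrow> 0"
    proof (rule AE_I2)
      fix x :: real
      have "eventually (\<lambda>n. indicator {x. real n \<le> \<bar>x\<bar>} x * ?F x = 0) sequentially"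
        using eventually_gt_at_top[of "nat \<lceil>\<bar>x\<bar>\<rceil>"]
      proof eventually_elim
        case (elim n)
        then have "\<bar>x\<bar> < real n" by linarith
        then show ?case by simp
      qed
      then show "(\<lambda>n. indicator {x. real n \<le> \<bar>x\<bar>} x * ?F x) \<longlonglongrightarrow> 0" by (rule tendsto_eventually)
    qed
    show "AE x in lborel. norm (indicator {x. real n \<le> \<bar>x\<bar>} x * ?F x) \<le> ?F x" for n
      by (auto simp: indicator_def)
  qed (use int in auto)
  have "eventually (\<lambda>n. (LINT x|lborel. indicator {x. real n \<le> \<bar>x\<bar>} x * ?F x) < d * (e / 2)\<^sup>2) sequentially"
    using order_tendstoD(2)[OF tail, of "d * (e / 2)\<^sup>2"] d e by simp
  then obtain n where n: "(LINT x|lborel. indicator {x. real n \<le> \<bar>x\<bar>} x * ?F x) < d * (e / 2)\<^sup>2"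
    using eventually_happens by fastforce
  have "dist (f x) 0 < e" if x: "real n + 1 \<le> norm x" for x
  proof (rule ccontr)
    assume "\<not> dist (f x) 0 < e"
    then have fx: "e \<le> norm (f x)" by simp
    have near: "e / 2 \<le> norm (f y)" if "y \<in> {x..x + d}" for y
    proof -
      have "norm (f (x + (y - x)) - f x) \<le> L * \<bar>y - x\<bar>" using that d by (intro L) auto
      also have "\<dots> \<le> L * d" using that L by (intro mult_left_mono) auto
      finally show ?thesis using d fx norm_triangle_ineq3[of "f y" "f x"] by simp
    qed
    have "d * (e / 2)\<^sup>2 = (LINT y|lborel. indicator {x..x + d} y *\<^sub>R (e / 2)\<^sup>2)" using d by simp
    also have "\<dots> \<le> (LINT y|lborel. indicator {x. real n \<le> \<bar>x\<bar>} y * ?F y)"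
    proof (rule integral_mono)
      show "integrable lborel (\<lambda>y. indicator {x..x + d} y *\<^sub>R (e / 2)\<^sup>2)"
        using d by (intro integrable_scaleR_left integrable_real_indicator) auto
      show "integrable lborel (\<lambda>y. indicator {x. real n \<le> \<bar>x\<bar>} y * ?F y)"
        by (rule Bochner_Integration.integrable_bound[OF int]) (auto simp: indicator_def)
      fix y
      show "indicator {x..x + d} y *\<^sub>R (e / 2)\<^sup>2 \<le> indicator {x. real n \<le> \<bar>x\<bar>} y * ?F y"
      proof (cases "y \<in> {x..x + d}")
        case True
        then have "real n \<le> \<bar>y\<bar>" using x d by auto
        moreover have "(e / 2)\<^sup>2 \<le> ?F y" using near[OF True] e by (intro power_mono) auto
        ultimately show ?thesis using True by simp
      qed simp
    qed
    finally show False using n by simp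
  qed
  then show "eventually (\<lambda>x. dist (f x) 0 < e) at_infinity"
    unfolding eventually_at_infinity by blast
qed

text \<open>The series of dyadic pieces converges uniformly, so it suffices that each piece vanishes at
  infinity. A piece is square integrable by assumption and Lipschitz as a convolution of a
  bounded function with a rapidly decaying kernel.\<close>

lemma besov_half_2_1_vanishes_at_infinity:
  assumes lp: "littlewood_paley \<phi>" and u: "besov_half_2_1 \<phi> u"
  shows "(u \<longlongrightarrow> 0) at_infinity"
proof -
  have cu: "continuous_on UNIV u" and L2: "\<And>k. in_L2 (LP_proj \<phi> k u)"
    and lim: "uniform_limit UNIV (\<lambda>K x. \<Sum>k\<in>K. LP_proj \<phi> k u x) u (finite_subsets_at_top UNIV)"
    using u unfolding besov_half_2_1_def by auto
  obtain U where U: "\<And>x. norm (u x) \<le> U"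
    using u unfolding besov_half_2_1_def bounded_iff by auto
  obtain a b where sm: "smooth \<phi>" and supp: "\<And>x. \<phi> x \<noteq> 0 \<Longrightarrow> \<bar>x\<bar> \<le> b"
    using lp unfolding littlewood_paley_def by blast
  have P: "(LP_proj \<phi> k u \<longlongrightarrow> 0) at_infinity" for k
  proof -
    define r :: real where "r = 2 powi k"
    have r: "r > 0" by (simp add: r_def)
    have smr: "smooth (\<lambda>\<xi>. \<phi> (\<xi> / r))"
      using smooth_affine_combination[OF sm, of 1 "1 / r" 0 0 0] by simp
    have suppr: "\<phi> (\<xi> / r) = 0" if "r * b < \<bar>\<xi>\<bar>" for \<xi>
      using supp[of "\<xi> / r"] that r by (cases "\<phi> (\<xi> / r) = 0") (auto simp: abs_divide field_simps)
    obtain C where C: "C > 0"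
      "\<And>x. norm (LINT \<xi>|lborel. of_real (\<phi> (\<xi> / r)) * exp (\<i> * of_real (\<xi> * x))) \<le> C / (1 + x\<^sup>2)"
      "\<And>x h. \<bar>h\<bar> \<le> 1 \<Longrightarrow> norm ((LINT \<xi>|lborel. of_real (\<phi> (\<xi> / r)) * exp (\<i> * of_real (\<xi> * (x + h))))
         - (LINT \<xi>|lborel. of_real (\<phi> (\<xi> / r)) * exp (\<i> * of_real (\<xi> * x)))) \<le> C * \<bar>h\<bar> / (1 + x\<^sup>2)"
    proof (rule smooth_fourier_kernel_bounds[OF smr, where b = "r * b"])
      show "\<phi> (\<xi> / r) = 0" if "r * b < \<bar>\<xi>\<bar>" for \<xi> by (rule suppr[OF that])
    qed (rule that)
    have pi1: "norm z / (2 * pi) \<le> norm z" for z :: complex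
      using pi_gt3 by (simp add: divide_le_eq mult_le_cancel_left1)
    have K: "norm (LP_kernel \<phi> k x) \<le> C / (1 + x\<^sup>2)" for x
      using order_trans[OF pi1 C(2)[of x]] by (simp add: LP_kernel_def r_def norm_divide norm_mult)
    have dK: "norm (LP_kernel \<phi> k (x + h) - LP_kernel \<phi> k x) \<le> C * \<bar>h\<bar> / (1 + x\<^sup>2)" if "\<bar>h\<bar> \<le> 1" for x h
      using order_trans[OF pi1 C(3)[OF that, of x]]
      by (simp add: LP_kernel_def r_def norm_divide norm_mult flip: diff_divide_distrib)
    obtain L where L: "L > 0" "\<And>x h. \<bar>h\<bar> \<le> 1 \<Longrightarrow>
        norm ((LINT y|lborel. LP_kernel \<phi> k (x + h - y) * u y)
          - (LINT y|lborel. LP_kernel \<phi> k (x - y) * u y)) \<le> L * \<bar>h\<bar>"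
    proof (rule convolution_Lipschitz[OF C(1) K _ cu U])
      show "norm (LP_kernel \<phi> k (x + h) - LP_kernel \<phi> k x) \<le> C * \<bar>h\<bar> / (1 + x\<^sup>2)"
        if "\<bar>h\<bar> \<le> 1" for x h by (rule dK[OF that])
    qed (rule that)
    show ?thesis
    proof (rule L2_Lipschitz_vanishes_at_infinity[OF L2 L(1)])
      show "norm (LP_proj \<phi> k u (x + h) - LP_proj \<phi> k u x) \<le> L * \<bar>h\<bar>" if "\<bar>h\<bar> \<le> 1" for x h
        using L(2)[OF that] by (simp add: LP_proj_def)
    qed
  qed
  show ?thesis
  proof (rule tendstoI)
    fix e :: real assume e: "e > 0"
    have "eventually (\<lambda>K. \<forall>x\<in>UNIV. dist (\<Sum>k\<in>K. LP_proj \<phi> k u x) (u x) < e / 2) (finite_subsets_at_top UNIV)"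
      using lim half_gt_zero[OF e] unfolding uniform_limit_iff by blast
    then obtain K where K: "\<And>x. dist (\<Sum>k\<in>K. LP_proj \<phi> k u x) (u x) < e / 2"
      using eventually_happens'[OF finite_subsets_at_top_neq_bot] by blast
    have "((\<lambda>x. \<Sum>k\<in>K. LP_proj \<phi> k u x) \<longlongrightarrow> (\<Sum>k\<in>K. 0)) at_infinity"
      by (intro tendsto_sum P)
    then have "((\<lambda>x. \<Sum>k\<in>K. LP_proj \<phi> k u x) \<longlongrightarrow> 0) at_infinity" by simp
    from tendstoD[OF this half_gt_zero[OF e]]
    have "eventually (\<lambda>x. dist (\<Sum>k\<in>K. LP_proj \<phi> k u x) 0 < e / 2) at_infinity" .
    then show "eventually (\<lambda>x. dist (u x) 0 < e) at_infinity"
    proof eventually_elim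
      case (elim x)
      then show ?case using K[of x] dist_triangle[of "u x" 0 "\<Sum>k\<in>K. LP_proj \<phi> k u x"]
        by (simp add: dist_commute)
    qed
  qed
qed

section \<open>The logarithm of the holomorphic derivative\<close>

lemma uniformly_continuous_of_vanishing:
  fixes w :: "real \<Rightarrow> complex"
  assumes w: "continuous_on UNIV w" and lim: "(w \<longlongrightarrow> 0) at_infinity" and e: "e > 0"
  obtains d where "d > 0" "\<And>x y. \<bar>x - y\<bar> < d \<Longrightarrow> norm (w x - w y) < e"
proof -
  have "eventually (\<lambda>x. dist (w x) 0 < e / 2) at_infinity"
    using lim e by (intro tendstoD) auto
  then obtain R where R: "\<And>x. R \<le> \<bar>x\<bar> \<Longrightarrow> norm (w x) < e / 2"
    unfolding eventually_at_infinity by auto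
  have "uniformly_continuous_on {- R - 1..R + 1} w"
    by (intro compact_uniformly_continuous continuous_on_subset[OF w]) auto
  then obtain d where d: "d > 0"
    "\<And>x y. x \<in> {- R - 1..R + 1} \<Longrightarrow> y \<in> {- R - 1..R + 1} \<Longrightarrow> dist y x < d \<Longrightarrow> dist (w y) (w x) < e"
    unfolding uniformly_continuous_on_def using e by metis
  show thesis
  proof (rule that[of "min d 1"])
    fix x y :: real assume xy: "\<bar>x - y\<bar> < min d 1"
    show "norm (w x - w y) < e"
    proof (cases "x \<in> {- R - 1..R + 1} \<and> y \<in> {- R - 1..R + 1}")
      case True
      then show ?thesis using d(2)[of y x] xy by (simp add: dist_norm)
    next
      case False
      then have "R \<le> \<bar>x\<bar>" "R \<le> \<bar>y\<bar>" using xy by auto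
      then have "norm (w x) + norm (w y) < e" using R[of x] R[of y] by simp
      then show ?thesis using norm_triangle_ineq4[of "w x" "w y"] by simp
    qed
  qed (use d in simp)
qed

text \<open>The difference quotients of \<open>E\<close> are bounded by the Lipschitz constant and converge uniformly
  on the line, because \<open>w\<close> is uniformly continuous. By the maximum principle they converge
  uniformly on the closed half plane, and the limit is \<open>D\<close>.\<close>

lemma lower_extension_derivative:
  fixes w :: "real \<Rightarrow> complex"
  assumes ext: "lower_extension W E"
    and dW: "\<And>x. (W has_vector_derivative w x) (at x)"
    and w: "continuous_on UNIV w" "(w \<longlongrightarrow> 0) at_infinity"
  defines "D \<equiv> \<lambda>z. if Im z < 0 then deriv E z else w (Re z)"
  shows lower_extension_derivative_continuous: "continuous_on lower_closed D"
    and lower_extension_derivative_holomorphic: "D holomorphic_on lower"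
    and lower_extension_derivative_bounded: "\<exists>K. \<forall>z. Im z \<le> 0 \<longrightarrow> norm (D z) \<le> K"
proof -
  obtain L where L: "L-lipschitz_on lower_closed E" and holE: "E holomorphic_on lower"
    and EW: "\<And>x. E (of_real x) = W x"
    using ext unfolding lower_extension_def by blast
  have L0: "L \<ge> 0" by (rule lipschitz_on_nonneg[OF L])
  have contE: "continuous_on lower_closed E" by (rule lipschitz_on_continuous_on[OF L])
  have "deriv E holomorphic_on lower" by (rule holomorphic_deriv[OF holE open_lower])
  then show "D holomorphic_on lower"
    by (rule holomorphic_transform) (simp add: D_def)
  let ?q = "\<lambda>h z. (E (z + of_real h) - E z) / of_real h"
  have contq: "continuous_on lower_closed (?q h)" if "h > 0" for h :: real
  proof -
    have "continuous_on lower_closed (\<lambda>z. E (z + of_real h))"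
      by (rule continuous_on_compose2[OF contE]) (auto intro!: continuous_intros)
    then show ?thesis using that by (intro continuous_intros contE) auto
  qed
  have holq: "?q h holomorphic_on lower" if "h > 0" for h :: real
  proof -
    have "E \<circ> (\<lambda>z. z + of_real h) holomorphic_on lower"
      by (rule holomorphic_on_compose_gen[OF _ holE]) (auto intro!: holomorphic_intros)
    then have "(\<lambda>z. E (z + of_real h)) holomorphic_on lower" by (simp add: o_def)
    then show ?thesis using that by (intro holomorphic_intros holE) auto
  qed
  have normq: "norm (?q h z) \<le> L" if "h > 0" "Im z \<le> 0" for h :: real and z
  proof -
    have "dist (E (z + of_real h)) (E z) \<le> L * dist (z + of_real h) z"
      by (rule lipschitz_onD[OF L]) (use that in auto)
    then show ?thesis using that by (simp add: dist_norm norm_divide divide_le_eq)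
  qed
  have unif: "\<exists>d>0. \<forall>h z. 0 < h \<and> h < d \<and> Im z \<le> 0 \<longrightarrow> norm (?q h z - D z) \<le> 2 * e"
    if e: "e > 0" for e
  proof -
    obtain d where d: "d > 0" "\<And>x y. \<bar>x - y\<bar> < d \<Longrightarrow> norm (w x - w y) < e"
      using uniformly_continuous_of_vanishing[OF w e] by metis
    have bd: "norm (?q h (of_real x) - w x) \<le> e" if h: "0 < h" "h < d" for h x
    proof -
      have "norm ((W (x + h) - (x + h) *\<^sub>R w x) - (W x - x *\<^sub>R w x)) \<le> e * (x + h) - e * x"
      proof (rule differentiable_bound_general[where f' = "\<lambda>t. w t - w x" and \<phi>' = "\<lambda>_. e"])
        have "((\<lambda>t. t *\<^sub>R w x) has_vector_derivative w x) (at t)" for t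
          by (auto intro!: derivative_eq_intros)
        then show d': "((\<lambda>t. W t - t *\<^sub>R w x) has_vector_derivative w t - w x) (at t)" for t
          by (intro has_vector_derivative_diff dW)
        then show "continuous_on {x..x + h} (\<lambda>t. W t - t *\<^sub>R w x)"
          by (meson continuous_at_imp_continuous_on has_vector_derivative_continuous)
        show "norm (w t - w x) \<le> e" if "x < t" "t < x + h" for t
          using d(2)[of t x] that h by simp
        show "((\<lambda>t. e * t) has_vector_derivative e) (at t)" for t
          by (auto intro!: derivative_eq_intros)
      qed (use h in \<open>auto intro!: continuous_intros\<close>)
      also have "(W (x + h) - (x + h) *\<^sub>R w x) - (W x - x *\<^sub>R w x) = of_real h * (?q h (of_real x) - w x)"
      proof -
        have "E (of_real x + of_real h) = W (x + h)" using EW[of "x + h"] by simp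
        then show ?thesis using h by (simp add: EW scaleR_conv_of_real field_simps)
      qed
      finally have "norm (of_real h * (?q h (of_real x) - w x)) \<le> e * (x + h) - e * x" .
      moreover have "norm X \<le> e" if "norm (of_real h * X) \<le> e * (x + h) - e * x" for X :: complex
        using that h by (simp add: norm_mult distrib_left)
      ultimately show ?thesis by blast
    qed
    have Cauchy: "norm (?q h z - ?q k z) \<le> 2 * e"
      if h: "0 < h" "h < d" and k: "0 < k" "k < d" and z: "Im z \<le> 0" for h k z
    proof (rule lower_maximum_modulus[where f = "\<lambda>z. ?q h z - ?q k z" and K = "L + L", OF _ _ _ _ z])
      show "continuous_on lower_closed (\<lambda>z. ?q h z - ?q k z)"
        by (intro continuous_on_diff contq h k)
      show "(\<lambda>z. ?q h z - ?q k z) holomorphic_on lower"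
        by (intro holomorphic_on_diff holq h k)
      show "norm (?q h (of_real x) - ?q k (of_real x)) \<le> 2 * e" for x
        using norm_triangle_ineq4[of "?q h (of_real x) - w x" "?q k (of_real x) - w x"]
          bd[OF h, of x] bd[OF k, of x] by simp
      show "norm (?q h z - ?q k z) \<le> L + L" if "Im z \<le> 0" for z
        using norm_triangle_ineq4[of "?q h z" "?q k z"] normq[OF h(1) that] normq[OF k(1) that]
        by linarith
    qed
    show ?thesis
    proof (intro exI conjI allI impI)
      show "d > 0" by (rule d)
      fix h z assume "0 < h \<and> h < d \<and> Im z \<le> 0"
      then have h: "0 < h" "h < d" and z: "Im z \<le> 0" by auto
      show "norm (?q h z - D z) \<le> 2 * e"
      proof (cases "Im z < 0")
        case False
        then have "z = of_real (Re z)" using z by (simp add: complex_eq_iff)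
        moreover have "norm (?q h (of_real (Re z)) - w (Re z)) \<le> 2 * e"
          using bd[OF h, of "Re z"] e by linarith
        ultimately show ?thesis using False by (simp add: D_def)
      next
        case True
        have "(E has_field_derivative deriv E z) (at z)"
          using holE True open_lower by (intro holomorphic_derivI[of _ lower]) auto
        then have "((\<lambda>k. (E (z + k) - E z) / k) \<longlongrightarrow> deriv E z) (at 0)"
          by (simp add: DERIV_def)
        moreover have "filterlim complex_of_real (at 0) (at_right 0)"
          by (auto simp: filterlim_at eventually_at_filter intro!: tendsto_eq_intros)
        ultimately have "((\<lambda>k. ?q k z) \<longlongrightarrow> deriv E z) (at_right 0)"
          by (rule filterlim_compose)
        then have lim: "((\<lambda>k. norm (?q h z - ?q k z)) \<longlongrightarrow> norm (?q h z - deriv E z)) (at_right 0)"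
          by (intro tendsto_intros)
        have "eventually (\<lambda>k. norm (?q h z - ?q k z) \<le> 2 * e) (at_right 0)"
          by (rule eventually_at_rightI[of 0 d]) (use d Cauchy[OF h _ _ z] in auto)
        then have "norm (?q h z - deriv E z) \<le> 2 * e"
          by (intro tendsto_upperbound[OF lim]) auto
        then show ?thesis using True by (simp add: D_def)
      qed
    qed
  qed
  have ul: "uniform_limit lower_closed (\<lambda>n. ?q (inverse (real (Suc n)))) D sequentially"
  proof (rule uniform_limitI)
    fix e :: real assume "e > 0"
    then obtain d where d: "d > 0"
      "\<And>h z. 0 < h \<Longrightarrow> h < d \<Longrightarrow> Im z \<le> 0 \<Longrightarrow> norm (?q h z - D z) \<le> 2 * (e / 4)"
      using unif[of "e / 4"] by auto
    have "eventually (\<lambda>n. inverse (real (Suc n)) < d) sequentially"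
      using order_tendstoD(2)[OF LIMSEQ_inverse_real_of_nat d(1)] .
    then show "eventually (\<lambda>n. \<forall>z\<in>lower_closed. dist (?q (inverse (real (Suc n))) z) (D z) < e) sequentially"
    proof eventually_elim
      case (elim n)
      show ?case
      proof
        fix z assume "z \<in> lower_closed"
        then have "norm (?q (inverse (real (Suc n))) z - D z) \<le> 2 * (e / 4)"
          using elim by (intro d) auto
        then show "dist (?q (inverse (real (Suc n))) z) (D z) < e"
          using \<open>e > 0\<close> unfolding dist_norm by linarith
      qed
    qed
  qed
  have "eventually (\<lambda>n. continuous_on lower_closed (?q (inverse (real (Suc n))))) sequentially"
    by (intro always_eventually allI contq) simp
  then show "continuous_on lower_closed D"
    by (rule uniform_limit_theorem[OF _ ul]) simp
  obtain d where d: "d > 0"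
    "\<And>h z. 0 < h \<Longrightarrow> h < d \<Longrightarrow> Im z \<le> 0 \<Longrightarrow> norm (?q h z - D z) \<le> 2 * 1"
    using unif[of 1] by auto
  have "norm (D z) \<le> L + 2" if "Im z \<le> 0" for z
    using d(2)[of "d/2" z] normq[of "d/2" z] d(1) that
      norm_triangle_ineq4[of "?q (d/2) z" "?q (d/2) z - D z"] by simp
  then show "\<exists>K. \<forall>z. Im z \<le> 0 \<longrightarrow> norm (D z) \<le> K" by blast
qed

text \<open>In polar coordinates the set is a rectangle. The negative real axis, whose principal argument
  is \<open>\<pi>\<close>, appears at the angle \<open>- \<pi>\<close>.\<close>

lemma connected_lower_closed_exterior:
  assumes "R \<ge> 0" shows "connected {z. Im z \<le> 0 \<and> R < norm z}"
proof -
  have "{z. Im z \<le> 0 \<and> R < norm z} = (\<lambda>(r, t). of_real r * cis t) ` ({R<..} \<times> {- pi..0})"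
  proof (intro equalityI subsetI)
    fix z assume z: "z \<in> {z. Im z \<le> 0 \<and> R < norm z}"
    show "z \<in> (\<lambda>(r, t). of_real r * cis t) ` ({R<..} \<times> {- pi..0})"
    proof (cases "Arg z = pi")
      case True
      have "cis (- pi) = cis pi" by (simp add: complex_eq_iff)
      with True have "z = of_real (norm z) * cis (- pi)" by (metis rcis_cmod_Arg rcis_def)
      moreover have "(norm z, - pi) \<in> {R<..} \<times> {- pi..0}" using z by simp
      ultimately show ?thesis by (metis (no_types, lifting) case_prod_conv image_eqI)
    next
      case False
      have "Arg z \<le> 0"
        using z False Arg_lt_pi[of z] Arg_le_pi[of z] by (metis (mono_tags) Arg_eq_pi linorder_not_less
            mem_Collect_eq order_le_less Im_complex_of_real complex_is_Real_iff)
      then have "(norm z, Arg z) \<in> {R<..} \<times> {- pi..0}"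
        using z mpi_less_Arg[of z] by simp
      moreover have "z = of_real (norm z) * cis (Arg z)" by (metis rcis_cmod_Arg rcis_def)
      ultimately show ?thesis by (metis (no_types, lifting) case_prod_conv image_eqI)
    qed
  next
    fix z assume "z \<in> (\<lambda>(r, t). of_real r * cis t) ` ({R<..} \<times> {- pi..0})"
    then obtain r t where rt: "R < r" "- pi \<le> t" "t \<le> 0" "z = of_real r * cis t" by auto
    have "sin t \<le> 0" using rt sin_ge_zero[of "- t"] by simp
    then show "z \<in> {z. Im z \<le> 0 \<and> R < norm z}"
      using rt assms by (simp add: norm_mult mult_nonneg_nonpos)
  qed
  moreover have "connected ((\<lambda>(r, t). complex_of_real r * cis t) ` ({R<..} \<times> {- pi..0}))"
    by (intro connected_continuous_image connected_Times)
       (auto simp: case_prod_unfold intro!: continuous_intros)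
  ultimately show ?thesis by simp
qed

lemma holomorphic_of_continuous_logarithm:
  assumes S: "open S" and F: "continuous_on S F" and f: "f holomorphic_on S"
    and eq: "\<And>z. z \<in> S \<Longrightarrow> exp (F z) = f z"
  shows "F holomorphic_on S"
  unfolding holomorphic_on_open[OF S]
proof
  fix z assume z: "z \<in> S"
  have df: "(f has_field_derivative deriv f z) (at z)" by (rule holomorphic_derivI[OF f S z])
  have nz: "f z \<noteq> 0" using eq[OF z] by (metis exp_not_eq_zero)
  let ?g = "\<lambda>y. F z + Ln (f y / f z)"
  have "((\<lambda>y. f y / f z) has_field_derivative deriv f z / f z) (at z)"
    using df by (rule DERIV_cdivide)
  moreover have "f z / f z \<notin> \<real>\<^sub>\<le>\<^sub>0" using nz by simp
  ultimately have "(?g has_field_derivative 0 + inverse (f z / f z) * (deriv f z / f z)) (at z)"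
    by (intro DERIV_add DERIV_const DERIV_chain2[OF has_field_derivative_Ln])
  moreover have "eventually (\<lambda>y. ?g y = F y) (nhds z)"
  proof -
    have "isCont F z" using F S z by (simp add: continuous_on_eq_continuous_at)
    then have "eventually (\<lambda>y. dist (F y) (F z) < pi) (at z)"
      unfolding isCont_def by (rule tendstoD) simp
    then have "eventually (\<lambda>y. dist (F y) (F z) < pi) (nhds z)"
      by (simp add: eventually_nhds_conv_at)
    moreover have "eventually (\<lambda>y. y \<in> S) (nhds z)" using S z by (simp add: eventually_nhds_in_open)
    ultimately show ?thesis
    proof eventually_elim
      case (elim y)
      then have "\<bar>Im (F y - F z)\<bar> < pi" using abs_Im_le_cmod[of "F y - F z"] by (simp add: dist_norm)
      then have "Ln (exp (F y - F z)) = F y - F z" by (intro Ln_exp) auto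
      moreover have "exp (F y - F z) = f y / f z" using elim(2) z by (simp add: exp_diff eq)
      ultimately show ?case by simp
    qed
  qed
  ultimately show "\<exists>f'. (F has_field_derivative f') (at z)"
    using DERIV_cong_ev[OF refl _ refl, of ?g F z] by blast
qed

text \<open>Near \<open>x\<close> the function \<open>\<theta>\<close> differs from \<open>\<theta> x\<close> by less than \<open>\<pi>\<close>, so it is recovered from
  \<open>e\<^sup>i\<^sup>\<theta>\<close> by the principal logarithm.\<close>

lemma real_derivative_of_exp_i:
  fixes \<theta> :: "real \<Rightarrow> real"
  assumes \<theta>: "isCont \<theta> x"
    and d: "((\<lambda>y. exp (\<i> * of_real (\<theta> y))) has_vector_derivative g) (at x)"
  shows "(\<theta> has_real_derivative Im (g / exp (\<i> * of_real (\<theta> x)))) (at x)"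
proof -
  let ?n = "\<lambda>y. exp (\<i> * of_real (\<theta> y))"
  have "((\<lambda>y. ?n y * inverse (?n x)) has_vector_derivative g * inverse (?n x)) (at x)"
    by (rule has_vector_derivative_mult_left[OF d])
  moreover have "(Ln has_field_derivative inverse (?n x * inverse (?n x))) (at (?n x * inverse (?n x)))"
    by (rule has_field_derivative_Ln) simp
  ultimately have "(Ln \<circ> (\<lambda>y. ?n y * inverse (?n x)) has_vector_derivative
      (g * inverse (?n x)) * inverse (?n x * inverse (?n x))) (at x)"
    by (rule field_vector_diff_chain_at)
  then have "((\<lambda>y. Ln (?n y * inverse (?n x))) has_vector_derivative g / ?n x) (at x)"
    by (simp add: o_def divide_inverse)
  then have "((\<lambda>y. Im (Ln (?n y * inverse (?n x)))) has_vector_derivative Im (g / ?n x)) (at x)"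
    by (rule bounded_linear.has_vector_derivative[OF bounded_linear_Im])
  then have "((\<lambda>y. Im (Ln (?n y * inverse (?n x)))) has_real_derivative Im (g / ?n x)) (at x)"
    by (simp add: has_real_derivative_iff_has_vector_derivative)
  from DERIV_add[OF DERIV_const this, of "\<theta> x"]
  have "((\<lambda>y. \<theta> x + Im (Ln (?n y * inverse (?n x)))) has_real_derivative Im (g / ?n x)) (at x)"
    by simp
  moreover have "eventually (\<lambda>y. \<theta> x + Im (Ln (?n y * inverse (?n x))) = \<theta> y) (nhds x)"
  proof -
    have "eventually (\<lambda>y. dist (\<theta> y) (\<theta> x) < pi) (at x)"
      using \<theta> unfolding isCont_def by (rule tendstoD) simp
    then have "eventually (\<lambda>y. dist (\<theta> y) (\<theta> x) < pi) (nhds x)"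
      by (simp add: eventually_nhds_conv_at)
    then show ?thesis
    proof eventually_elim
      case (elim y)
      then have "\<bar>\<theta> y - \<theta> x\<bar> < pi" by (simp add: dist_norm)
      then have "Ln (exp (\<i> * of_real (\<theta> y - \<theta> x))) = \<i> * of_real (\<theta> y - \<theta> x)"
        by (intro Ln_exp) auto
      moreover have "exp (\<i> * of_real (\<theta> y - \<theta> x)) = ?n y * inverse (?n x)"
        by (simp add: right_diff_distrib exp_diff divide_inverse)
      ultimately show ?case by simp
    qed
  qed
  ultimately show ?thesis
    using DERIV_cong_ev[OF refl _ refl, of "\<lambda>y. \<theta> x + Im (Ln (?n y * inverse (?n x)))" \<theta> x] by blast
qed

text \<open>On the simply connected closed half plane there is a continuous logarithm. Near infinity it
  differs from the principal one by a constant multiple of \<open>2 \<pi> i\<close>, since the exterior of a disc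
  in the half plane is connected; subtracting this constant makes it vanish at infinity.\<close>

lemma vanishing_logarithm:
  assumes cont: "continuous_on lower_closed D" and hol: "D holomorphic_on lower"
    and vanish: "\<And>e. e > 0 \<Longrightarrow> \<exists>R. \<forall>z. Im z \<le> 0 \<and> R \<le> norm z \<longrightarrow> norm (D z) \<le> e"
    and nz: "\<And>z. Im z \<le> 0 \<Longrightarrow> 1 + D z \<noteq> 0"
  obtains F where "continuous_on lower_closed F" "F holomorphic_on lower"
    "\<And>z. Im z \<le> 0 \<Longrightarrow> exp (F z) = 1 + D z"
    "\<And>e. e > 0 \<Longrightarrow> \<exists>R. \<forall>z. Im z \<le> 0 \<and> R \<le> norm z \<longrightarrow> norm (F z) \<le> e"
proof -
  have "continuous_on lower_closed (\<lambda>z. 1 + D z)" by (intro continuous_intros cont)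
  then obtain F0 where F0: "continuous_on lower_closed F0"
    "\<And>z. z \<in> lower_closed \<Longrightarrow> 1 + D z = exp (F0 z)"
    using continuous_logarithm_on_contractible[of lower_closed "\<lambda>z. 1 + D z"] nz
      convex_imp_contractible[OF convex_lower_closed] by (metis (mono_tags, lifting) mem_Collect_eq)
  obtain R0 where R0: "\<And>z. Im z \<le> 0 \<Longrightarrow> R0 \<le> norm z \<Longrightarrow> norm (D z) \<le> 1/2"
    using vanish[of "1/2"] by auto
  define R where "R = max R0 0"
  define X where "X = {z. Im z \<le> 0 \<and> R < norm z}"
  have DX: "norm (D z) \<le> 1/2" if "z \<in> X" for z
    using that R0[of z] by (auto simp: X_def R_def)
  have off: "1 + D z \<notin> \<real>\<^sub>\<le>\<^sub>0" if "z \<in> X" for z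
    using DX[OF that] abs_Re_le_cmod[of "D z"] by (auto simp: complex_nonpos_Reals_iff)
  have "(\<lambda>z. F0 z - Ln (1 + D z)) constant_on X"
  proof (rule continuous_discrete_range_constant)
    show "connected X" unfolding X_def by (rule connected_lower_closed_exterior) (simp add: R_def)
    have sub: "X \<subseteq> lower_closed" by (auto simp: X_def)
    show "continuous_on X (\<lambda>z. F0 z - Ln (1 + D z))"
      by (intro continuous_on_diff continuous_on_Ln' continuous_on_add continuous_on_const
          continuous_on_subset[OF F0(1) sub] continuous_on_subset[OF cont sub] off)
    fix x assume x: "x \<in> X"
    have ex: "exp (F0 z - Ln (1 + D z)) = 1" if "z \<in> X" for z
      using F0(2)[of z] nz[of z] that by (auto simp: X_def exp_diff)
    show "\<exists>e>0. \<forall>y. y \<in> X \<and> F0 y - Ln (1 + D y) \<noteq> F0 x - Ln (1 + D x) \<longrightarrow>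
        e \<le> norm (F0 y - Ln (1 + D y) - (F0 x - Ln (1 + D x)))"
    proof (intro exI[of _ "2 * pi"] conjI allI impI)
      fix y assume y: "y \<in> X \<and> F0 y - Ln (1 + D y) \<noteq> F0 x - Ln (1 + D x)"
      let ?a = "F0 y - Ln (1 + D y)" and ?b = "F0 x - Ln (1 + D x)"
      have "exp ?a = exp ?b" using ex[of x] ex[of y] x y by simp
      then obtain n :: int where n: "?a = ?b + (of_int (2 * n) * pi) * \<i>"
        unfolding exp_eq by blast
      then have "n \<noteq> 0" using y by auto
      then have "2 * pi \<le> \<bar>of_int (2 * n) * pi\<bar>" by (simp add: abs_mult)
      also have "\<dots> = norm (?a - ?b)" unfolding n by (simp add: norm_mult abs_mult)
      finally show "2 * pi \<le> norm (?a - ?b)" .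
    qed simp
  qed
  then obtain c where c: "\<And>z. z \<in> X \<Longrightarrow> F0 z - Ln (1 + D z) = c"
    unfolding constant_on_def by auto
  define F where "F z = F0 z - c" for z
  have "exp c = 1"
  proof -
    define p where "p = Complex 0 (- (R + 1))"
    have "R \<ge> 0" by (simp add: R_def)
    then have p: "p \<in> X" "Im p \<le> 0" by (simp_all add: X_def p_def cmod_def)
    show ?thesis using c[OF p(1), symmetric] F0(2)[of p] nz[OF p(2)] p(2) by (simp add: exp_diff)
  qed
  then have expF: "exp (F z) = 1 + D z" if "Im z \<le> 0" for z
    using F0(2)[of z] that by (simp add: F_def exp_diff)
  show thesis
  proof (rule that)
    show contF: "continuous_on lower_closed F" unfolding F_def by (intro continuous_intros F0)
    show "F holomorphic_on lower"
    proof (rule holomorphic_of_continuous_logarithm[OF open_lower])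
      show "continuous_on lower F" using contF by (rule continuous_on_subset) auto
      show "(\<lambda>z. 1 + D z) holomorphic_on lower" using hol by (intro holomorphic_intros)
    qed (use expF in auto)
    show "exp (F z) = 1 + D z" if "Im z \<le> 0" for z by (rule expF[OF that])
    fix e :: real assume e: "e > 0"
    have "isCont Ln 1" by (intro continuous_at_Ln) simp
    then obtain d where d: "d > 0" "\<And>z. norm (z - 1) < d \<Longrightarrow> norm (Ln z - Ln 1) < e"
      using e unfolding continuous_at_eps_delta dist_norm by blast
    obtain R1 where R1: "\<And>z. Im z \<le> 0 \<Longrightarrow> R1 \<le> norm z \<Longrightarrow> norm (D z) \<le> d / 2"
      using vanish[of "d / 2"] d by auto
    show "\<exists>R. \<forall>z. Im z \<le> 0 \<and> R \<le> norm z \<longrightarrow> norm (F z) \<le> e"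
    proof (intro exI allI impI)
      fix z assume "Im z \<le> 0 \<and> max (R + 1) R1 \<le> norm z"
      then have z: "Im z \<le> 0" "R1 \<le> norm z" "z \<in> X" by (auto simp: X_def)
      have "F z = Ln (1 + D z)" using c[OF z(3)] by (simp add: F_def algebra_simps)
      then show "norm (F z) \<le> e" using d(2)[of "1 + D z"] R1[OF z(1,2)] d(1) by simp
    qed
  qed
qed

text \<open>The maximum principle for \<open>\<plusminus> i F\<close> gives \<open>Im F = 0\<close> inside. Then the derivative bound in
  terms of the imaginary part applies to every multiple of \<open>F\<close> with the same constant.\<close>

lemma lower_zero_of_Im_boundary_zero:
  assumes cont: "continuous_on lower_closed F" and hol: "F holomorphic_on lower"
    and vanish: "\<And>e. e > 0 \<Longrightarrow> \<exists>R. \<forall>z. Im z \<le> 0 \<and> R \<le> norm z \<longrightarrow> norm (F z) \<le> e"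
    and bd: "\<And>x. Im (F (of_real x)) = 0" and z: "Im z < 0"
  shows "F z = 0"
proof -
  have Im0: "Im (F z) = 0" if z: "Im z \<le> 0" for z
  proof -
    have "Re (s * F z) \<le> 0" if s: "s = \<i> \<or> s = - \<i>" for s
    proof (rule lower_maximum_real_at_infinity[where f = "\<lambda>z. s * F z"])
      show "continuous_on lower_closed (\<lambda>z. s * F z)" by (intro continuous_intros cont)
      show "(\<lambda>z. s * F z) holomorphic_on lower" by (intro holomorphic_intros hol)
      show "Re (s * F (of_real x)) \<le> 0" for x using bd[of x] s by auto
      fix e :: real assume "e > 0"
      then obtain R where R: "\<And>z. Im z \<le> 0 \<Longrightarrow> R \<le> norm z \<Longrightarrow> norm (F z) \<le> e"
        using vanish by blast
      have "Re (s * F z) \<le> norm (F z)" for z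
        using complex_Re_le_cmod[of "s * F z"] s by (auto simp: norm_mult)
      then show "\<exists>R. \<forall>z. Im z \<le> 0 \<and> R \<le> norm z \<longrightarrow> Re (s * F z) \<le> 0 + e"
        using R by (intro exI[of _ R]) (auto intro: order_trans)
    qed (rule z)
    from this[of "\<i>"] this[of "- \<i>"] show ?thesis by simp
  qed
  have dF: "(F has_field_derivative deriv F z) (at z)" if "Im z < 0" for z
    using hol that open_lower by (intro holomorphic_derivI[of _ lower]) auto
  have d0: "deriv F z = 0" if z: "Im z < 0" for z
  proof -
    have "norm (deriv F z) \<le> 2 / (- Im z) / real (Suc n)" for n
    proof -
      have "norm (deriv (\<lambda>z. of_nat (Suc n) * F z) z) \<le> 2 * exp (2 * 0) / (- Im z)"
      proof (rule deriv_norm_le_of_Im_bounded)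
        have low: "Im w < 0" if "w \<in> ball z (- Im z)" for w
          using that abs_Im_le_cmod[of "z - w"] z by (auto simp: dist_norm)
        show "(\<lambda>z. of_nat (Suc n) * F z) holomorphic_on ball z (- Im z)"
          using hol by (intro holomorphic_intros) (rule holomorphic_on_subset, use low in auto)
        show "\<bar>Im (of_nat (Suc n) * F w)\<bar> \<le> 0" if "w \<in> ball z (- Im z)" for w
          using Im0[of w] low[OF that] by simp
      qed (use z in simp)
      moreover have "deriv (\<lambda>z. of_nat (Suc n) * F z) z = of_nat (Suc n) * deriv F z"
        by (rule DERIV_imp_deriv[OF DERIV_cmult[OF dF[OF z]]])
      ultimately have "real (Suc n) * norm (deriv F z) \<le> 2 / (- Im z)"
        by (simp add: norm_mult del: of_nat_Suc)
      then have "norm (deriv F z) * real (Suc n) \<le> 2 / (- Im z)"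
        by (simp only: mult.commute)
      then show ?thesis by (subst pos_le_divide_eq) auto
    qed
    moreover have "(\<lambda>n. 2 / (- Im z) * inverse (real (Suc n))) \<longlonglongrightarrow> 2 / (- Im z) * 0"
      by (intro tendsto_intros LIMSEQ_inverse_real_of_nat)
    ultimately have "norm (deriv F z) \<le> 2 / (- Im z) * 0"
      by (intro LIMSEQ_le_const) (auto simp: divide_inverse)
    then show ?thesis by simp
  qed
  have "\<exists>c. \<forall>z\<in>lower. F z = c"
    using dF d0 by (intro has_field_derivative_zero_constant convex_lower)
      (auto intro: has_field_derivative_at_within)
  then obtain c where c: "\<And>z. Im z < 0 \<Longrightarrow> F z = c" by auto
  have "norm c \<le> 0 + e" if e: "e > 0" for e
  proof -
    obtain R where R: "\<And>z. Im z \<le> 0 \<Longrightarrow> R \<le> norm z \<Longrightarrow> norm (F z) \<le> e"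
      using vanish[OF e] by auto
    let ?z = "- \<i> * of_real (\<bar>R\<bar> + 1)"
    have "norm (F ?z) \<le> e" by (rule R) (simp_all add: norm_mult)
    moreover have "F ?z = c" by (rule c) simp
    ultimately show ?thesis by simp
  qed
  then have "norm c \<le> 0" by (rule field_le_epsilon)
  then show ?thesis using c[OF z] by simp
qed

section \<open>Nonexistence of solitary waves\<close>

theorem theorem4:
  fixes \<sigma> c :: real and \<phi> :: "real \<Rightarrow> real"
    and W W\<alpha> :: "real \<Rightarrow> complex" and E :: "complex \<Rightarrow> complex"
  assumes "\<sigma> > 0"
    and "littlewood_paley \<phi>"
    and "lower_extension W E"
    and "\<And>z. Im z < 0 \<Longrightarrow> 1 + deriv E z \<noteq> 0"
    and "\<And>\<theta>. test_function \<theta> \<Longrightarrow> dist_deriv (dist_of W) \<theta> = dist_of W\<alpha> \<theta>"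
    and "besov_half_2_1 \<phi> W\<alpha>"
    and "\<exists>\<delta>>0. \<forall>\<alpha>. \<delta> \<le> norm (1 + W\<alpha> \<alpha>)"
    and "\<And>\<theta>. test_function \<theta> \<Longrightarrow>
           \<i> * of_real \<sigma> *
             dist_deriv (dist_of (\<lambda>\<alpha>. (1 + W\<alpha> \<alpha>) / of_real (norm (1 + W\<alpha> \<alpha>)))) \<theta>
         = of_real (c\<^sup>2) *
             dist_of (\<lambda>\<alpha>. W\<alpha> \<alpha> + cnj (W\<alpha> \<alpha>) / (1 + cnj (W\<alpha> \<alpha>))) \<theta>"
  shows "\<forall>\<alpha>. W\<alpha> \<alpha> = 0"
proof -
  note \<sigma> = assms(1) and lp = assms(2) and ext = assms(3)
  have w: "continuous_on UNIV W\<alpha>" using assms(6) by (simp add: besov_half_2_1_def)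
  have w0: "(W\<alpha> \<longlongrightarrow> 0) at_infinity"
    by (rule besov_half_2_1_vanishes_at_infinity[OF lp assms(6)])
  have nzw: "1 + W\<alpha> x \<noteq> 0" for x using assms(7) by (metis norm_zero not_less)
  obtain L where L: "L-lipschitz_on lower_closed E" and EW: "\<And>x. E (of_real x) = W x"
    using ext unfolding lower_extension_def by blast
  have "continuous_on UNIV (\<lambda>x. E (of_real x))"
    by (rule continuous_on_compose2[OF lipschitz_on_continuous_on[OF L]]) (auto intro!: continuous_intros)
  then have contW: "continuous_on UNIV W" by (simp add: EW)
  have dW: "(W has_vector_derivative W\<alpha> x) (at x)" for x
    by (rule has_vector_derivative_of_weak_derivative[OF lp contW w assms(5)])
  define D where "D z = (if Im z < 0 then deriv E z else W\<alpha> (Re z))" for z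
  have contD: "continuous_on lower_closed D" and holD: "D holomorphic_on lower"
    and bddD: "\<exists>K. \<forall>z. Im z \<le> 0 \<longrightarrow> norm (D z) \<le> K"
    unfolding D_def
    using lower_extension_derivative_continuous[OF ext dW w w0]
      lower_extension_derivative_holomorphic[OF ext dW w w0]
      lower_extension_derivative_bounded[OF ext dW w w0] by auto
  obtain K where K: "\<And>z. Im z \<le> 0 \<Longrightarrow> norm (D z) \<le> K" using bddD by blast
  have D_real: "D (of_real x) = W\<alpha> x" for x by (simp add: D_def)
  have vanD: "\<exists>R. \<forall>z. Im z \<le> 0 \<and> R \<le> norm z \<longrightarrow> norm (D z) \<le> e" if "e > 0" for e
    by (rule lower_vanishing_at_infinity[OF contD holD K _ that]) (simp_all add: D_real w0)
  have nzD: "1 + D z \<noteq> 0" if "Im z \<le> 0" for z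
    using assms(4)[of z] nzw[of "Re z"] by (simp add: D_def)
  obtain F where F: "continuous_on lower_closed F" "F holomorphic_on lower"
    and expF: "\<And>z. Im z \<le> 0 \<Longrightarrow> exp (F z) = 1 + D z"
    and vanF: "\<And>e. e > 0 \<Longrightarrow> \<exists>R. \<forall>z. Im z \<le> 0 \<and> R \<le> norm z \<longrightarrow> norm (F z) \<le> e"
    using vanishing_logarithm[OF contD holD vanD nzD] by metis
  define A where "A x = Re (F (of_real x))" for x
  define \<theta> where "\<theta> x = Im (F (of_real x))" for x
  have F_eq: "F (of_real x) = of_real (A x) + \<i> * of_real (\<theta> x)" for x
    by (simp add: A_def \<theta>_def complex_eq_iff)
  have u: "1 + W\<alpha> x = of_real (exp (A x)) * exp (\<i> * of_real (\<theta> x))" for x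
    using expF[of "of_real x"] by (simp add: D_real F_eq exp_add exp_of_real)
  have n: "(1 + W\<alpha> x) / of_real (norm (1 + W\<alpha> x)) = exp (\<i> * of_real (\<theta> x))" for x
    unfolding u by (simp add: norm_mult)
  let ?g = "\<lambda>x. of_real (c\<^sup>2) / (\<i> * of_real \<sigma>) * (W\<alpha> x + cnj (W\<alpha> x) / (1 + cnj (W\<alpha> x)))"
  have nzc: "1 + cnj (W\<alpha> x) \<noteq> 0" for x
    using nzw[of x] by (metis complex_cnj_add complex_cnj_one complex_cnj_zero_iff)
  have cF: "continuous_on UNIV (\<lambda>x. F (of_real x))"
    by (rule continuous_on_compose2[OF F(1)]) (auto intro!: continuous_intros)
  have c\<theta>: "continuous_on UNIV \<theta>" unfolding \<theta>_def by (intro continuous_intros cF)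
  have dn: "((\<lambda>x. exp (\<i> * of_real (\<theta> x))) has_vector_derivative ?g x) (at x)" for x
  proof (rule has_vector_derivative_of_weak_derivative[OF lp])
    show "continuous_on UNIV (\<lambda>x. exp (\<i> * complex_of_real (\<theta> x)))"
      by (intro continuous_intros c\<theta>)
    have "continuous_on UNIV (\<lambda>x. cnj (W\<alpha> x))" by (intro continuous_intros w)
    then show "continuous_on UNIV ?g"
      by (intro continuous_on_mult continuous_on_add continuous_on_divide continuous_on_const w ballI nzc)
    fix \<eta> assume "test_function \<eta>"
    from assms(8)[OF this, unfolded n]
    have "dist_deriv (dist_of (\<lambda>x. exp (\<i> * of_real (\<theta> x)))) \<eta>
       = of_real (c\<^sup>2) / (\<i> * of_real \<sigma>) * dist_of (\<lambda>\<alpha>. W\<alpha> \<alpha> + cnj (W\<alpha> \<alpha>) / (1 + cnj (W\<alpha> \<alpha>))) \<eta>"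
      using \<sigma> by (simp add: field_simps)
    also have "\<dots> = dist_of ?g \<eta>"
      unfolding dist_of_def mult.assoc[of "of_real (c\<^sup>2) / (\<i> * of_real \<sigma>)"]
      by (rule integral_mult_right_zero[symmetric])
    finally show "dist_deriv (dist_of (\<lambda>x. exp (\<i> * of_real (\<theta> x)))) \<eta> = dist_of ?g \<eta>" .
  qed
  define \<kappa> where "\<kappa> = 2 * c\<^sup>2 / \<sigma>"
  have boundary: "(\<theta> has_real_derivative - \<kappa> * sinh (A x)) (at x)" for x
  proof -
    have "isCont \<theta> x" using c\<theta> by (simp add: continuous_on_eq_continuous_at)
    then have "(\<theta> has_real_derivative Im (?g x / exp (\<i> * of_real (\<theta> x)))) (at x)"
      by (rule real_derivative_of_exp_i[OF _ dn])
    \<comment> \<open>With \<open>u = 1 + W\<^sub>\<alpha>\<close> the right side of the equation is \<open>u - 1 / cnj u = e\<^sup>i\<^sup>\<theta> (e\<^sup>A - e\<^bsup>-A\<^esup>)\<close>.\<close>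
    moreover have "?g x / exp (\<i> * of_real (\<theta> x)) = - \<i> * of_real (\<kappa> * sinh (A x))"
    proof -
      let ?e = "exp (\<i> * of_real (\<theta> x))"
      have ce: "cnj ?e = inverse ?e" by (simp add: exp_cnj exp_minus)
      have cu: "1 + cnj (W\<alpha> x) = of_real (exp (A x)) * inverse ?e"
        using arg_cong[OF u[of x], of cnj] by (simp add: ce)
      have "W\<alpha> x + cnj (W\<alpha> x) / (1 + cnj (W\<alpha> x)) = (1 + W\<alpha> x) - 1 / (1 + cnj (W\<alpha> x))"
        using nzc[of x] by (simp add: field_simps)
      also have "\<dots> = ?e * of_real (exp (A x) - exp (- A x))"
        unfolding u cu by (simp add: field_simps exp_minus)
      also have "exp (A x) - exp (- A x) = 2 * sinh (A x)" by (simp add: sinh_field_def)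
      finally show ?thesis using \<sigma> by (simp add: \<kappa>_def field_simps)
    qed
    ultimately show ?thesis by simp
  qed
  have F0: "F (of_real x) = 0" for x
  proof (cases "c = 0")
    case False
    then interpret sinh_boundary_problem F \<kappa>
      using F vanF boundary \<sigma> by unfold_locales (auto simp: A_def \<theta>_def[abs_def] \<kappa>_def)
    show ?thesis by (rule boundary_zero)
  next
    case True
    then have "(\<theta> has_real_derivative 0) (at x)" for x using boundary[of x] by (simp add: \<kappa>_def)
    then have const: "\<theta> x = \<theta> y" for x y using DERIV_isconst_all by blast
    have "\<theta> x = 0" for x
    proof -
      have "\<bar>\<theta> x\<bar> \<le> 0 + e" if e: "e > 0" for e
      proof -
        obtain R where R: "\<And>z. Im z \<le> 0 \<Longrightarrow> R \<le> norm z \<Longrightarrow> norm (F z) \<le> e"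
          using vanF[OF e] by auto
        have "norm (F (of_real \<bar>R\<bar>)) \<le> e" by (rule R) auto
        then show ?thesis
          using abs_Im_le_cmod[of "F (of_real \<bar>R\<bar>)"] const[of x "\<bar>R\<bar>"] by (simp add: \<theta>_def)
      qed
      then have "\<bar>\<theta> x\<bar> \<le> 0" by (rule field_le_epsilon)
      then show ?thesis by simp
    qed
    then have low: "F z = 0" if "Im z < 0" for z
      using lower_zero_of_Im_boundary_zero[OF F vanF _ that] by (simp add: \<theta>_def)
    have "(\<lambda>n. F (Complex x (- inverse (real (Suc n))))) \<longlonglongrightarrow> F (of_real x)"
    proof (rule continuous_on_tendsto_compose[OF F(1)])
      have "(\<lambda>n. Complex x (- inverse (real (Suc n)))) \<longlonglongrightarrow> Complex x (- 0)"
        by (intro tendsto_intros LIMSEQ_inverse_real_of_nat)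
      then show "(\<lambda>n. Complex x (- inverse (real (Suc n)))) \<longlonglongrightarrow> of_real x"
        by (simp add: complex_of_real_def)
    qed auto
    moreover have "F (Complex x (- inverse (real (Suc n)))) = 0" for n by (rule low) simp
    ultimately show ?thesis by (simp add: LIMSEQ_const_iff)
  qed
  show ?thesis
  proof
    fix x
    show "W\<alpha> x = 0" using expF[of "of_real x"] by (simp add: F0 D_real)
  qed
qed

end
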